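(* Let $\mathcal L$ be the operator in $L_2(\mathbb R^d)$ given by $(\mathcal L u)(x)=\int_{\mathbb R^d}a(x-y)u(y)\,dy+V(x)u(x)$, where $a$ and $V$ satisfy the standing assumptions in the context. Let $x_0$ be a point of the global minimum of $V$, and assume that $V_{\min}\le a_{\min}$. Assume furthermore that there exists $\delta>0$ such that $$\int_{Q_2(0)}\prod_{i=1}^{d}(1-|x_i|)\,\operatorname{Re}a(\delta x)\,dx+\delta^{-d}\int_{Q_1(0)}\big(V(x_0+\delta x)-V_{\min}\big)\,dx<0.$$ Then the discrete spectrum of $\mathcal L$ in the semi-interval $[a_{\min}+V_{\min},\mu_0)$ is non-empty.
   Context: Let $d\ge 1$. Standing assumptions: $a\in L_1(\mathbb R^d)$ is complex-valued with $a(-x)=\overline{a(x)}$; $V=\mathcal F[\hat V]$ for some $\hat V\in L_1(\mathbb R^d)$ with $\hat V(-x)=\overline{\hat V(x)}$, where $\mathcal F[u](x):=\int_{\mathbb R^d}u(\xi)e^{-\mathrm i x\cdot\xi}\,d\xi$. Put $\hat a:=\mathcal F[a]$. Then $\hat a$ and $V$ are real-valued, bounded, continuous and tend to zero at infinity. Define $a_{\min}:=\inf_{\mathbb R^d}\hat a$, $V_{\min}:=\inf_{\mathbb R^d}V$ and $\mu_0:=\min\{a_{\min},V_{\min}\}$. The operator $\mathcal L$ is bounded and self-adjoint in $L_2(\mathbb R^d)$, and $\mu_0$ is the bottom of its essential spectrum. $Q_r(x_0)$ denotes the cube in $\mathbb R^d$ with side $r$ centered at $x_0$. *)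

theory Defs
  imports "HOL-Analysis.Analysis"
begin

text \<open>Fourier transform with the non-unitary convention \<open>e\<^sup>-\<^sup>i\<^sup>x\<^sup>\<xi>\<close> and no normalising factor.\<close>

definition fourier :: "(real ^ 'n \<Rightarrow> complex) \<Rightarrow> real ^ 'n \<Rightarrow> complex" where
  "fourier u x = (\<integral>\<xi>. u \<xi> * exp (- \<i> * complex_of_real (x \<bullet> \<xi>)) \<partial>lborel)"

definition cube :: "real \<Rightarrow> real ^ 'n \<Rightarrow> (real ^ 'n) set" where
  "cube r x0 = {x. \<forall>i. \<bar>x $ i - x0 $ i\<bar> \<le> r / 2}"

text \<open>The space \<open>L\<^sub>2\<close> is represented by its square-integrable representatives;
  equality in \<open>L\<^sub>2\<close> is equality almost everywhere, and every notion below is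
  stated up to null sets.\<close>

definition L2 :: "'a measure \<Rightarrow> ('a \<Rightarrow> complex) set" where
  "L2 M = {f \<in> borel_measurable M. integrable M (\<lambda>x. (cmod (f x))\<^sup>2)}"

definition L2_norm :: "'a measure \<Rightarrow> ('a \<Rightarrow> complex) \<Rightarrow> real" where
  "L2_norm M f = sqrt (\<integral>x. (cmod (f x))\<^sup>2 \<partial>M)"

text \<open>For an operator \<open>T\<close> on \<open>L\<^sub>2(M)\<close>, a complex number \<open>z\<close> is in the resolvent set iff
  \<open>T - z\<close> is onto (first conjunct), one-to-one (second conjunct), and its inverse
  is bounded (third conjunct).\<close>

definition resolvent_set ::
  "'a measure \<Rightarrow> (('a \<Rightarrow> complex) \<Rightarrow> 'a \<Rightarrow> complex) \<Rightarrow> complex set" where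
  "resolvent_set M T = {z.
     (\<forall>g \<in> L2 M. \<exists>f \<in> L2 M. AE x in M. T f x - z * f x = g x) \<and>
     (\<forall>f \<in> L2 M. (AE x in M. T f x - z * f x = 0) \<longrightarrow> (AE x in M. f x = 0)) \<and>
     (\<exists>C. \<forall>f \<in> L2 M. L2_norm M f \<le> C * L2_norm M (\<lambda>x. T f x - z * f x))}"

definition op_spectrum ::
  "'a measure \<Rightarrow> (('a \<Rightarrow> complex) \<Rightarrow> 'a \<Rightarrow> complex) \<Rightarrow> complex set" where
  "op_spectrum M T = - resolvent_set M T"

definition eigenfunctions ::
  "'a measure \<Rightarrow> (('a \<Rightarrow> complex) \<Rightarrow> 'a \<Rightarrow> complex) \<Rightarrow> complex \<Rightarrow> ('a \<Rightarrow> complex) set" where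
  "eigenfunctions M T z = {f \<in> L2 M. AE x in M. T f x = z * f x}"

definition eigenvalue ::
  "'a measure \<Rightarrow> (('a \<Rightarrow> complex) \<Rightarrow> 'a \<Rightarrow> complex) \<Rightarrow> complex \<Rightarrow> bool" where
  "eigenvalue M T z \<longleftrightarrow> (\<exists>f \<in> eigenfunctions M T z. \<not> (AE x in M. f x = 0))"

definition finite_multiplicity ::
  "'a measure \<Rightarrow> (('a \<Rightarrow> complex) \<Rightarrow> 'a \<Rightarrow> complex) \<Rightarrow> complex \<Rightarrow> bool" where
  "finite_multiplicity M T z \<longleftrightarrow>
     (\<exists>B. finite B \<and> B \<subseteq> eigenfunctions M T z \<and>
       (\<forall>f \<in> eigenfunctions M T z. \<exists>c. AE x in M. f x = (\<Sum>b\<in>B. c b * b x)))"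

text \<open>Isolated eigenvalues of finite (geometric) multiplicity; for self-adjoint operators
  geometric and algebraic multiplicity coincide.\<close>

definition discrete_spectrum ::
  "'a measure \<Rightarrow> (('a \<Rightarrow> complex) \<Rightarrow> 'a \<Rightarrow> complex) \<Rightarrow> complex set" where
  "discrete_spectrum M T =
     {z \<in> op_spectrum M T. eigenvalue M T z \<and> finite_multiplicity M T z \<and>
        \<not> z islimpt op_spectrum M T}"

text \<open>For integrable \<open>a\<close> and square-integrable \<open>u\<close> the integral converges absolutely for almost
  every \<open>x\<close>; on the exceptional null set the Bochner integral is \<open>0\<close> by convention.\<close>

definition L_op :: "(real ^ 'n \<Rightarrow> complex) \<Rightarrow> (real ^ 'n \<Rightarrow> complex) \<Rightarrow>
    (real ^ 'n \<Rightarrow> complex) \<Rightarrow> real ^ 'n \<Rightarrow> complex" where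
  "L_op a V u x = (\<integral>y. a (x - y) * u y \<partial>lborel) + V x * u x"

text \<open>Infimum of a function that is in fact real-valued but typed as complex-valued; it is
  applied to Fourier transforms of integrable Hermitian functions, which are real-valued
  and bounded.\<close>

definition inf_Re :: "('a \<Rightarrow> complex) \<Rightarrow> real" where
  "inf_Re f = (INF x. Re (f x))"

end

theory Submission
  imports Defs "HOL-Complex_Analysis.Great_Picard" "HOL-Probability.Characteristic_Functions"
begin

text \<open>Let \<open>A\<close> be the convolution with \<open>a\<close> and \<open>M\<close> the multiplication by \<open>V\<close>, and let \<open>\<kappa>\<close> be
  the bottom of the numerical range of \<open>\<L> = A + M\<close>. A Gaussian-regularised Plancherel argument
  gives \<open>A \<ge> a_min\<close>, and \<open>M \<ge> V_min\<close> is trivial, so \<open>\<kappa> \<ge> a_min + V_min\<close>; the indicator function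
  of the cube \<open>Q\<^sub>\<delta>(x\<^sub>0)\<close> as trial function turns the integral condition into \<open>\<kappa> < V_min = \<mu>\<^sub>0\<close>.

  Instead of locating the essential spectrum, one uses
  \<open>(A - \<kappa>) (M - \<kappa>) = A M - \<kappa> (\<L> - \<kappa>)\<close>: below \<open>\<mu>\<^sub>0\<close> both factors on the left are bounded below,
  and \<open>A M\<close> is compact because \<open>a\<close> is integrable and \<open>V\<close> vanishes at infinity. Hence normalised
  approximate eigenvectors at \<open>\<kappa>\<close> have convergent subsequences. This single compactness property
  makes \<open>\<kappa>\<close> an eigenvalue (by minimisation), of finite multiplicity, and isolated.\<close>

section \<open>The bottom of a quadratic form under a Palais--Smale condition\<close>

text \<open>Neither convolution nor multiplication is compact in general, so \<L> is no compact
  perturbation of a scalar; only the product, which damps both high frequencies and distant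
  positions, is compact. A product of two maps bounded below is again bounded below, so the product
  of the shifted operators need not be symmetric: convergence of its values along a sequence already
  forces convergence of the sequence.

  The spectral notions are stated for representatives, whereas the abstract argument needs a
  complete inner product space; hence the quotient by almost everywhere equality. It is taken over
  the reals, with the real part of the Hermitian product. Complex scalars return through
  multiplication by \<i>, which commutes with the operator: this places all non-real points in the
  resolvent set, and only real ones remain to be studied.

  The weight \<open>\<Prod>(1 - |x_i|)\<close> in the hypothesis is the autocorrelation of the
  indicator of a unit cube, and \<open>\<delta>^-d\<close> balances the two powers
  \<open>\<delta>^d\<close> of the convolution form against the single one of the multiplication
  form.\<close>

lemma LIMSEQ_one_over_Suc: "(\<lambda>n. 1 / real (Suc n)) \<longlonglongrightarrow> 0"
  using LIMSEQ_inverse_real_of_nat by (simp add: inverse_eq_divide)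

text \<open>The equation is solved in the form \<open>T (S v) = g\<close>: \<open>T S\<close> is
  coercive because \<open>inner (T (S v)) v\<close> is the squared norm of \<open>S v\<close>, so
  the damped iteration \<open>v - \<tau> (T (S v) - g)\<close> is a contraction for a suitable
  \<tau>. This turns a lower bound for \<open>T - cnj z\<close> into surjectivity of
  \<open>T - z\<close>.\<close>

lemma bounded_below_adjoint_imp_surj:
  fixes T S :: "'a::{real_inner,complete_space} \<Rightarrow> 'a"
  assumes T: "bounded_linear T" and S: "bounded_linear S"
    and adj: "\<And>u v. inner (T u) v = inner u (S v)"
    and c: "c > 0" "\<And>v. c * norm v \<le> norm (S v)"
  shows "surj T"
proof -
  define P where "P = (\<lambda>v. T (S v))"
  have P: "bounded_linear P"
    unfolding P_def by (rule bounded_linear_compose[OF T S])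
  obtain M0 where M0: "\<And>x. norm (P x) \<le> norm x * M0"
    using bounded_linear.bounded[OF P] by blast
  \<comment> \<open>The maximum with \<open>c^2\<close> makes \<open>M\<close> positive and
    \<open>c^4 \<le> M^2\<close>, so that the root defining \<open>q\<close> is taken of a
    non-negative number.\<close>
  define M where "M = max \<bar>M0\<bar> (c\<^sup>2)"
  have "M > 0" "c\<^sup>2 \<le> M" using c(1) by (auto simp: M_def less_max_iff_disj)
  have M: "norm (P x) \<le> M * norm x" for x
  proof -
    have "norm x * M0 \<le> M * norm x"
      by (metis M_def abs_ge_self max.coboundedI1 mult.commute mult_right_mono norm_ge_zero)
    then show ?thesis using M0[of x] by linarith
  qed
  \<comment> \<open>This \<tau> minimises the bound \<open>1 - 2 \<tau> c^2 + \<tau>^2 M^2\<close>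
    for the squared contraction factor; the minimum \<open>1 - c^4 / M^2\<close> is
    \<open>q^2\<close>.\<close>
  define \<tau> where "\<tau> = c\<^sup>2 / M\<^sup>2"
  define q where "q = sqrt (1 - c^4 / M\<^sup>2)"
  have c4: "c^4 \<le> M\<^sup>2"
    using \<open>c\<^sup>2 \<le> M\<close> power_mono[of "c\<^sup>2" M 2] by simp
  have q: "0 \<le> q" "q < 1" "q\<^sup>2 = 1 - c^4 / M\<^sup>2"
    using c(1) \<open>M > 0\<close> c4 by (auto simp: q_def divide_le_eq)
  have contr: "norm (v - \<tau> *\<^sub>R P v) \<le> q * norm v" for v
  proof -
    have coer: "c\<^sup>2 * (norm v)\<^sup>2 \<le> inner v (P v)"
    proof -
      have "inner v (P v) = inner (T (S v)) v" by (simp add: P_def inner_commute)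
      also have "\<dots> = (norm (S v))\<^sup>2" by (simp add: adj power2_norm_eq_inner)
      also have "(c * norm v)\<^sup>2 \<le> \<dots>" using c by (intro power_mono) auto
      finally show ?thesis by (simp add: power_mult_distrib)
    qed
    have "(norm (v - \<tau> *\<^sub>R P v))\<^sup>2 = (norm v)\<^sup>2 - 2 * \<tau> * inner v (P v) + \<tau>\<^sup>2 * (norm (P v))\<^sup>2"
      unfolding power2_norm_eq_inner by (simp add: inner_diff inner_commute algebra_simps power2_eq_square)
    also have "\<dots> \<le> (norm v)\<^sup>2 - 2 * \<tau> * (c\<^sup>2 * (norm v)\<^sup>2) + \<tau>\<^sup>2 * (M * norm v)\<^sup>2"
    proof -
      have "(norm (P v))\<^sup>2 \<le> (M * norm v)\<^sup>2" using M by (intro power_mono) auto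
      moreover have "\<tau> \<ge> 0" by (simp add: \<tau>_def)
      ultimately show ?thesis
        using coer by (intro add_mono diff_mono mult_left_mono) auto
    qed
    also have "\<dots> = (q * norm v)\<^sup>2"
      unfolding power_mult_distrib q(3) using \<open>M > 0\<close> by (simp add: \<tau>_def field_simps power2_eq_square power4_eq_xxxx)
    finally show ?thesis using q(1) by (meson mult_nonneg_nonneg norm_ge_zero power2_le_imp_le)
  qed
  have "\<exists>v. T v = g" for g
  proof -
    define F where "F = (\<lambda>v. v - \<tau> *\<^sub>R (P v - g))"
    have "dist (F x) (F y) \<le> q * dist x y" for x y
    proof -
      have "F x - F y = (x - y) - \<tau> *\<^sub>R P (x - y)"
        by (simp add: F_def linear_diff[OF bounded_linear.linear[OF P]] algebra_simps)
      then show ?thesis using contr[of "x - y"] by (simp add: dist_norm)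
    qed
    then obtain v where "F v = v" using banach_fix_type[of q F] q by blast
    moreover have "\<tau> \<noteq> 0" using c(1) \<open>M > 0\<close> by (simp add: \<tau>_def)
    ultimately have "P v = g" by (simp add: F_def)
    then show ?thesis unfolding P_def by blast
  qed
  then show ?thesis by (metis surjI)
qed

text \<open>The last assumption of the locale is a Palais--Smale condition for the quadratic form of
  \<open>T\<close> at the level \<open>\<kappa>\<close>; it is what remains of the compactness of the perturbation.\<close>

locale palais_smale =
  fixes T :: "'a::{real_inner,complete_space} \<Rightarrow> 'a" and \<kappa> :: real
  assumes bounded_linear: "bounded_linear T"
    and symmetric: "inner (T u) v = inner u (T v)"
    and compactness: "\<lbrakk>\<And>n. norm (x n) = 1; (\<lambda>n. T (x n) - \<kappa> *\<^sub>R x n) \<longlonglongrightarrow> 0\<rbrakk>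
      \<Longrightarrow> \<exists>l r. strict_mono (r :: nat \<Rightarrow> nat) \<and> (x \<circ> r) \<longlonglongrightarrow> l"
begin

lemma limit_is_eigenvector:
  assumes "\<And>n. norm (x n) = 1" "(\<lambda>n. T (x n) - \<kappa> *\<^sub>R x n) \<longlonglongrightarrow> 0"
  obtains l r where "strict_mono (r :: nat \<Rightarrow> nat)" "(x \<circ> r) \<longlonglongrightarrow> l" "norm l = 1" "T l = \<kappa> *\<^sub>R l"
proof -
  obtain l r where lr: "strict_mono (r :: nat \<Rightarrow> nat)" "(x \<circ> r) \<longlonglongrightarrow> l"
    using compactness[OF assms] by blast
  have "(\<lambda>n. norm ((x \<circ> r) n)) \<longlonglongrightarrow> norm l" by (rule tendsto_norm[OF lr(2)])
  then have "norm l = 1" using assms(1) by (simp add: LIMSEQ_const_iff)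
  have "(\<lambda>n. T ((x \<circ> r) n) - \<kappa> *\<^sub>R (x \<circ> r) n) \<longlonglongrightarrow> T l - \<kappa> *\<^sub>R l"
    by (intro tendsto_intros bounded_linear.tendsto[OF bounded_linear] lr(2))
  moreover have "(\<lambda>n. T ((x \<circ> r) n) - \<kappa> *\<^sub>R (x \<circ> r) n) \<longlonglongrightarrow> 0"
    using LIMSEQ_subseq_LIMSEQ[OF assms(2) lr(1)] by (simp add: o_def)
  ultimately have "T l - \<kappa> *\<^sub>R l = 0" by (rule LIMSEQ_unique)
  then show ?thesis using that[OF lr \<open>norm l = 1\<close>] by simp
qed

text \<open>A minimising sequence of the form is a sequence of approximate eigenvectors: for the
  non-negative symmetric \<open>S = T - \<kappa>\<close> the squared norm of \<open>S u\<close> is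
  at most a constant times \<open>inner (S u) u\<close>, which tends to 0. Compactness then produces
  an eigenvector in the limit.\<close>

lemma minimum_attained:
  assumes lower: "\<And>u. \<kappa> * (norm u)\<^sup>2 \<le> inner (T u) u"
    and inf: "\<And>e. e > 0 \<Longrightarrow> \<exists>u. norm u = 1 \<and> inner (T u) u < \<kappa> + e"
  shows "\<exists>u. norm u = 1 \<and> T u = \<kappa> *\<^sub>R u"
proof -
  define S where "S = (\<lambda>u. T u - \<kappa> *\<^sub>R u)"
  have S: "bounded_linear S"
    unfolding S_def by (intro bounded_linear_sub bounded_linear bounded_linear_scaleR_right)
  have S_sym: "inner (S u) v = inner u (S v)" for u v
    by (simp add: S_def symmetric inner_diff)
  have S_pos: "0 \<le> inner (S u) u" for u
    using lower[of u] by (simp add: S_def inner_diff power2_norm_eq_inner)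
  obtain M where M: "M > 0" "\<And>x. norm (S x) \<le> norm x * M"
    using bounded_linear.pos_bounded[OF S] by blast
  \<comment> \<open>Non-negativity of the form is tested at \<open>u - t S u\<close>; the value
    \<open>t = 1 / M\<close> minimises the coefficient \<open>-2 t + t^2 M\<close> that
    results.\<close>
  have CS: "(norm (S u))\<^sup>2 \<le> M * inner (S u) u" for u
  proof -
    define t where "t = 1 / M"
    have "0 \<le> inner (S (u - t *\<^sub>R S u)) (u - t *\<^sub>R S u)" by (rule S_pos)
    also have "\<dots> = inner (S u) u - 2 * t * (norm (S u))\<^sup>2 + t\<^sup>2 * inner (S (S u)) (S u)"
      unfolding power2_norm_eq_inner using S_sym[of "S u" u]
      by (simp add: linear_diff[OF bounded_linear.linear[OF S]] linear_scale[OF bounded_linear.linear[OF S]]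
          inner_diff inner_commute power2_eq_square algebra_simps)
    also have "inner (S (S u)) (S u) \<le> norm (S (S u)) * norm (S u)" by (rule norm_cauchy_schwarz)
    also have "\<dots> \<le> (norm (S u) * M) * norm (S u)" by (intro mult_right_mono M) auto
    finally have "0 \<le> inner (S u) u - 2 * t * (norm (S u))\<^sup>2 + t\<^sup>2 * ((norm (S u) * M) * norm (S u))"
      by (simp add: mult_left_mono)
    then show ?thesis using M(1) by (simp add: t_def field_simps power2_eq_square)
  qed
  have "\<forall>n. \<exists>u. norm u = 1 \<and> inner (T u) u < \<kappa> + 1 / Suc n" using inf by simp
  then obtain x where x: "\<And>n. norm (x n) = 1" "\<And>n. inner (T (x n)) (x n) < \<kappa> + 1 / Suc n" by metis
  have bnd: "(norm (S (x n)))\<^sup>2 \<le> M * (1 / Suc n)" for n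
  proof -
    have "inner (S (x n)) (x n) = inner (T (x n)) (x n) - \<kappa> * (norm (x n))\<^sup>2"
      by (simp add: S_def inner_diff power2_norm_eq_inner)
    also have "\<dots> \<le> 1 / Suc n" using x[of n] by simp
    finally show ?thesis using CS[of "x n"] M(1) by (meson mult_left_mono less_imp_le order_trans)
  qed
  have "(\<lambda>n. M * (1 / Suc n)) \<longlonglongrightarrow> M * 0"
    by (intro tendsto_mult tendsto_const) (rule LIMSEQ_one_over_Suc)
  then have "(\<lambda>n. M * (1 / Suc n)) \<longlonglongrightarrow> 0" by simp
  moreover have "eventually (\<lambda>n. norm ((norm (S (x n)))\<^sup>2) \<le> M * (1 / Suc n)) sequentially"
    by (intro always_eventually allI) (use bnd in \<open>simp del: of_nat_Suc\<close>)
  ultimately have "(\<lambda>n. (norm (S (x n)))\<^sup>2) \<longlonglongrightarrow> 0"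
    by (rule Lim_null_comparison[rotated])
  then have "(\<lambda>n. S (x n)) \<longlonglongrightarrow> 0"
    by (simp add: tendsto_norm_zero_iff)
  then show ?thesis using limit_is_eigenvector[of x] x(1) unfolding S_def by metis
qed

lemma compact_eigensphere: "compact {u. norm u = 1 \<and> T u = \<kappa> *\<^sub>R u}"
  unfolding compact_def
proof (intro allI impI)
  fix x :: "nat \<Rightarrow> 'a" assume "\<forall>n. x n \<in> {u. norm u = 1 \<and> T u = \<kappa> *\<^sub>R u}"
  then have "\<And>n. norm (x n) = 1" "(\<lambda>n. T (x n) - \<kappa> *\<^sub>R x n) \<longlonglongrightarrow> 0" by auto
  then obtain l r where "strict_mono (r :: nat \<Rightarrow> nat)" "(x \<circ> r) \<longlonglongrightarrow> l" "norm l = 1" "T l = \<kappa> *\<^sub>R l"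
    by (rule limit_is_eigenvector)
  then show "\<exists>l\<in>{u. norm u = 1 \<and> T u = \<kappa> *\<^sub>R u}. \<exists>r. strict_mono r \<and> (x \<circ> r) \<longlonglongrightarrow> l" by blast
qed

text \<open>Riesz's argument: the unit sphere of the eigenspace is compact, distinct orthonormal
  vectors are at distance sqrt 2, and a finite cover by balls of radius 1/2 therefore bounds the
  size of orthonormal systems. A system of maximal size spans, since otherwise a Gram-Schmidt step
  would enlarge it.\<close>

lemma eigenspace_finite_dim:
  "\<exists>B. finite B \<and> B \<subseteq> {u. T u = \<kappa> *\<^sub>R u} \<and> {u. T u = \<kappa> *\<^sub>R u} \<subseteq> span B"
proof -
  define E where "E = {u. T u = \<kappa> *\<^sub>R u}"
  have lin: "linear T" by (rule bounded_linear.linear[OF bounded_linear])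
  have E_sub: "subspace E"
    unfolding E_def using lin by (auto simp: subspace_def linear_0 linear_add linear_scale algebra_simps)
  define orth where
    "orth B \<longleftrightarrow> finite B \<and> B \<subseteq> E \<and> (\<forall>b\<in>B. norm b = 1) \<and> (\<forall>b\<in>B. \<forall>c\<in>B. b \<noteq> c \<longrightarrow> inner b c = 0)" for B
  define Sph where "Sph = {u. norm u = 1 \<and> T u = \<kappa> *\<^sub>R u}"
  have "\<forall>e>0. \<exists>k. finite k \<and> k \<subseteq> Sph \<and> Sph \<subseteq> (\<Union>x\<in>k. ball x e)"
    unfolding Sph_def by (rule seq_compact_imp_totally_bounded[OF compact_imp_seq_compact[OF compact_eigensphere]])
  from spec[OF this, of "1/2"] obtain K where K: "finite K" "Sph \<subseteq> (\<Union>x\<in>K. ball x (1/2))"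
    by auto
  have bound: "card B \<le> card K" if B: "orth B" for B
  proof -
    have "\<forall>b\<in>B. \<exists>k\<in>K. b \<in> ball k (1/2)"
    proof
      fix b assume "b \<in> B"
      then have "b \<in> Sph" using B unfolding orth_def E_def Sph_def by blast
      then show "\<exists>k\<in>K. b \<in> ball k (1/2)" using K(2) by blast
    qed
    then obtain f where f: "\<And>b. b \<in> B \<Longrightarrow> f b \<in> K" "\<And>b. b \<in> B \<Longrightarrow> dist (f b) b < 1/2"
      by (metis mem_ball)
    have "inj_on f B"
    proof (rule inj_onI, rule ccontr)
      fix b c assume bc: "b \<in> B" "c \<in> B" "f b = f c" "b \<noteq> c"
      have "dist b c \<le> dist (f b) b + dist (f c) c" using bc(3) by (metis dist_commute dist_triangle2 dist_triangle3)
      then have "dist b c < 1" using f(2)[OF bc(1)] f(2)[OF bc(2)] by linarith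
      moreover have "(dist b c)\<^sup>2 = 2"
      proof -
        have "(dist b c)\<^sup>2 = (norm b)\<^sup>2 + (norm c)\<^sup>2 - 2 * inner b c"
          by (simp add: dist_norm power2_norm_eq_inner inner_diff inner_commute)
        then show ?thesis using B bc unfolding orth_def by simp
      qed
      ultimately show False using power_le_one[of "dist b c" 2] by simp
    qed
    then show ?thesis using f(1) K(1) by (meson card_inj_on_le image_subsetI)
  qed
  have "orth {}" by (simp add: orth_def)
  moreover have "\<forall>B. orth B \<longrightarrow> card B < Suc (card K)" using bound by (simp add: less_Suc_eq_le)
  ultimately have "\<exists>B. orth B \<and> (\<forall>C. orth C \<longrightarrow> card C \<le> card B)"
    by (rule ex_has_greatest_nat)
  then obtain B where B: "orth B" "\<And>C. orth C \<Longrightarrow> card C \<le> card B" by blast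
  have BE: "B \<subseteq> E" and finB: "finite B" using B(1) by (auto simp: orth_def)
  have "u \<in> span B" if u: "u \<in> E" for u
  proof (rule ccontr)
    assume "u \<notin> span B"
    define p where "p = (\<Sum>b\<in>B. inner u b *\<^sub>R b)"
    define w where "w = u - p"
    have pB: "p \<in> span B" unfolding p_def by (intro span_sum span_scale span_base)
    then have "p \<in> E" using E_sub BE by (meson span_minimal subsetD)
    then have wE: "w \<in> E" unfolding w_def using u E_sub by (simp add: subspace_diff)
    have w0: "w \<noteq> 0" using \<open>u \<notin> span B\<close> pB by (auto simp: w_def)
    have wb: "inner w b = 0" if b: "b \<in> B" for b
    proof -
      have "inner p b = (\<Sum>c\<in>B. inner u c * inner c b)" by (simp add: p_def inner_sum_left)
      also have "\<dots> = (\<Sum>c\<in>B. if c = b then inner u b else 0)"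
        using B(1) b unfolding orth_def by (intro sum.cong) (auto simp flip: power2_norm_eq_inner)
      also have "\<dots> = inner u b" using finB b by simp
      finally show ?thesis by (simp add: w_def inner_diff)
    qed
    define v where "v = w /\<^sub>R norm w"
    have "v \<in> E" unfolding v_def using E_sub wE by (rule subspace_scale)
    moreover have "norm v = 1" using w0 by (simp add: v_def)
    moreover have vb: "inner v b = 0" if "b \<in> B" for b using wb[OF that] by (simp add: v_def)
    moreover have "v \<notin> B"
      using vb[of v] \<open>norm v = 1\<close> by (auto simp flip: power2_norm_eq_inner)
    ultimately have "orth (insert v B)" "card (insert v B) = Suc (card B)"
      using B(1) unfolding orth_def by (auto simp: inner_commute)
    then show False using B(2)[of "insert v B"] by simp
  qed
  then show ?thesis using BE finB unfolding E_def by blast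
qed

text \<open>Approximate eigenvectors for a nearby \<open>\<mu> \<noteq> \<kappa>\<close> are almost orthogonal to the eigenspace
  of \<open>\<kappa>\<close>, whereas by compactness they cluster at it as \<open>\<mu>\<close> tends to \<open>\<kappa>\<close>.\<close>

lemma isolated:
  "\<exists>r>0. \<forall>\<mu>. \<mu> \<noteq> \<kappa> \<and> \<bar>\<mu> - \<kappa>\<bar> < r \<longrightarrow> (\<exists>c>0. \<forall>u. c * norm u \<le> norm (T u - \<mu> *\<^sub>R u))"
proof (rule ccontr)
  assume contr: "\<not> ?thesis"
  have lin: "linear T" by (rule bounded_linear.linear[OF bounded_linear])
  \<comment> \<open>Negating the claim permits any positive constant; with
    \<open>|\<mu> - \<kappa>| / (n + 1)\<close> the residual is still a null sequence after division
    by \<open>|\<mu> - \<kappa>|\<close>, as the estimate of \<open>inner (x n) l\<close>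
    requires.\<close>
  have "\<exists>\<mu> u. \<mu> \<noteq> \<kappa> \<and> \<bar>\<mu> - \<kappa>\<bar> < 1 / Suc n \<and> norm u = 1 \<and>
      norm (T u - \<mu> *\<^sub>R u) < \<bar>\<mu> - \<kappa>\<bar> / Suc n" for n :: nat
  proof -
    have "1 / real (Suc n) > 0" by simp
    then obtain \<mu> where \<mu>: "\<mu> \<noteq> \<kappa>" "\<bar>\<mu> - \<kappa>\<bar> < 1 / Suc n"
      "\<not> (\<exists>c>0. \<forall>u. c * norm u \<le> norm (T u - \<mu> *\<^sub>R u))"
      using contr by metis
    have "\<bar>\<mu> - \<kappa>\<bar> / Suc n > 0" using \<mu>(1) by simp
    then obtain u where u: "norm (T u - \<mu> *\<^sub>R u) < (\<bar>\<mu> - \<kappa>\<bar> / Suc n) * norm u"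
      using \<mu>(3) by (meson not_le)
    then have u0: "norm u > 0" by (cases "u = 0") (auto simp: linear_0[OF lin])
    define v where "v = u /\<^sub>R norm u"
    have "T v - \<mu> *\<^sub>R v = (T u - \<mu> *\<^sub>R u) /\<^sub>R norm u"
      by (simp add: v_def linear_scale[OF lin] algebra_simps)
    then have "norm (T v - \<mu> *\<^sub>R v) = norm (T u - \<mu> *\<^sub>R u) / norm u"
      by (simp add: divide_inverse)
    also have "\<dots> < \<bar>\<mu> - \<kappa>\<bar> / Suc n" using u u0 by (simp add: divide_less_eq)
    finally have "norm (T v - \<mu> *\<^sub>R v) < \<bar>\<mu> - \<kappa>\<bar> / Suc n" .
    moreover have "norm v = 1" using u0 by (simp add: v_def)
    ultimately show ?thesis using \<mu> by blast
  qed
  then obtain \<mu> x where \<mu>x: "\<And>n::nat. \<mu> n \<noteq> \<kappa>" "\<And>n. \<bar>\<mu> n - \<kappa>\<bar> < 1 / Suc n"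
    "\<And>n. norm (x n) = 1" "\<And>n. norm (T (x n) - \<mu> n *\<^sub>R x n) < \<bar>\<mu> n - \<kappa>\<bar> / Suc n" by metis
  have "norm (T (x n) - \<kappa> *\<^sub>R x n) \<le> 2 * (1 / Suc n)" for n
  proof -
    have "T (x n) - \<kappa> *\<^sub>R x n = (T (x n) - \<mu> n *\<^sub>R x n) + (\<mu> n - \<kappa>) *\<^sub>R x n"
      by (simp add: algebra_simps)
    then have "norm (T (x n) - \<kappa> *\<^sub>R x n) \<le> norm (T (x n) - \<mu> n *\<^sub>R x n) + norm ((\<mu> n - \<kappa>) *\<^sub>R x n)"
      by (metis norm_triangle_ineq)
    also have "\<dots> \<le> \<bar>\<mu> n - \<kappa>\<bar> / Suc n + \<bar>\<mu> n - \<kappa>\<bar>"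
      using \<mu>x(3,4)[of n] by simp
    also have "\<bar>\<mu> n - \<kappa>\<bar> / Suc n \<le> \<bar>\<mu> n - \<kappa>\<bar>" by (simp add: divide_le_eq mult_left_le algebra_simps)
    finally show ?thesis using \<mu>x(2)[of n] by simp
  qed
  then have "eventually (\<lambda>n. norm (T (x n) - \<kappa> *\<^sub>R x n) \<le> 2 * (1 / real (Suc n))) sequentially"
    by (intro always_eventually) blast
  moreover have "(\<lambda>n. 2 * (1 / real (Suc n))) \<longlonglongrightarrow> 0"
    using tendsto_mult[OF tendsto_const[of 2] LIMSEQ_one_over_Suc] by simp
  ultimately have "(\<lambda>n. T (x n) - \<kappa> *\<^sub>R x n) \<longlonglongrightarrow> 0"
    by (rule Lim_null_comparison)
  then obtain l r where lr: "strict_mono (r :: nat \<Rightarrow> nat)" "(x \<circ> r) \<longlonglongrightarrow> l" "norm l = 1" "T l = \<kappa> *\<^sub>R l"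
    using limit_is_eigenvector \<mu>x(3) by metis
  \<comment> \<open>Since \<open>l\<close> is an eigenvector for \<kappa> and \<open>T\<close> is
    symmetric, pairing the residual with \<open>l\<close> leaves exactly
    \<open>(\<kappa> - \<mu> n) * inner (x n) l\<close>.\<close>
  have orth: "\<bar>inner (x n) l\<bar> \<le> 1 / Suc n" for n
  proof -
    have "inner (T (x n) - \<mu> n *\<^sub>R x n) l = (\<kappa> - \<mu> n) * inner (x n) l"
      by (simp add: inner_diff symmetric lr(4) algebra_simps)
    then have "\<bar>\<mu> n - \<kappa>\<bar> * \<bar>inner (x n) l\<bar> = \<bar>inner (T (x n) - \<mu> n *\<^sub>R x n) l\<bar>"
      by (simp add: abs_mult abs_minus_commute)
    also have "\<dots> \<le> norm (T (x n) - \<mu> n *\<^sub>R x n) * norm l" by (rule Cauchy_Schwarz_ineq2)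
    also have "\<dots> \<le> \<bar>\<mu> n - \<kappa>\<bar> * (1 / Suc n)" using \<mu>x(4)[of n] lr(3) by simp
    finally show ?thesis using \<mu>x(1)[of n]
      by (metis abs_0_eq abs_ge_zero eq_iff_diff_eq_0 less_eq_real_def mult_le_cancel_left_pos)
  qed
  then have "(\<lambda>n. inner (x n) l) \<longlonglongrightarrow> 0"
    by (intro Lim_null_comparison[OF _ LIMSEQ_one_over_Suc]) auto
  then have "(\<lambda>n. inner ((x \<circ> r) n) l) \<longlonglongrightarrow> 0"
    using LIMSEQ_subseq_LIMSEQ[OF _ lr(1)] by (fastforce simp: o_def)
  moreover have "(\<lambda>n. inner ((x \<circ> r) n) l) \<longlonglongrightarrow> inner l l"
    by (intro tendsto_intros lr(2))
  ultimately have "inner l l = 0" by (rule LIMSEQ_unique[symmetric])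
  then show False using lr(3) by simp
qed

end

section \<open>The Hilbert space of square-integrable functions\<close>

lemma borel_measurable_cnj [measurable (raw)]:
  "f \<in> borel_measurable M \<Longrightarrow> (\<lambda>x. cnj (f x)) \<in> borel_measurable M"
  by (rule borel_measurable_continuous_on[of cnj]) (auto intro!: continuous_intros)

lemma L2_measurable [measurable_dest]: "f \<in> L2 M \<Longrightarrow> f \<in> borel_measurable M"
  by (simp add: L2_def)

lemma L2_integrable: "f \<in> L2 M \<Longrightarrow> integrable M (\<lambda>x. (cmod (f x))\<^sup>2)"
  by (simp add: L2_def)

lemma L2_bound:
  assumes "f \<in> borel_measurable M" "integrable M g" "AE x in M. (cmod (f x))\<^sup>2 \<le> g x"
  shows "f \<in> L2 M"
  unfolding L2_def using assms
  by (auto intro!: Bochner_Integration.integrable_bound[OF assms(2)] elim!: eventually_mono)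

lemma L2_zero: "(\<lambda>x. 0) \<in> L2 M"
  by (simp add: L2_def)

lemma norm_add_square_le: "(norm (x + y))\<^sup>2 \<le> 2 * (norm x)\<^sup>2 + 2 * (norm y)\<^sup>2"
  for x y :: "'a::real_normed_vector"
proof -
  have "(norm (x + y))\<^sup>2 \<le> (norm x + norm y)\<^sup>2" by (intro power_mono norm_triangle_ineq) auto
  also have "\<dots> \<le> 2 * (norm x)\<^sup>2 + 2 * (norm y)\<^sup>2"
    using sum_squares_bound[of "norm x" "norm y"] by (simp add: power2_sum)
  finally show ?thesis .
qed

lemma L2_add:
  assumes "f \<in> L2 M" "g \<in> L2 M"
  shows "(\<lambda>x. f x + g x) \<in> L2 M"
proof (rule L2_bound)
  show "integrable M (\<lambda>x. 2 * (cmod (f x))\<^sup>2 + 2 * (cmod (g x))\<^sup>2)"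
    using L2_integrable[OF assms(1)] L2_integrable[OF assms(2)] by simp
qed (use assms norm_add_square_le in \<open>auto simp: L2_measurable\<close>)

lemma L2_bounded_mult:
  assumes "f \<in> L2 M" "V \<in> borel_measurable M" "\<And>x. cmod (V x) \<le> B"
  shows "(\<lambda>x. V x * f x) \<in> L2 M"
proof (rule L2_bound)
  show "integrable M (\<lambda>x. B\<^sup>2 * (cmod (f x))\<^sup>2)" using assms by (auto dest: L2_integrable)
  show "AE x in M. (cmod (V x * f x))\<^sup>2 \<le> B\<^sup>2 * (cmod (f x))\<^sup>2"
    using assms(3) by (auto simp: norm_mult power_mult_distrib intro!: mult_right_mono power_mono)
  show "(\<lambda>x. V x * f x) \<in> borel_measurable M" using assms(1,2) by measurable
qed

lemma L2_cmult: "f \<in> L2 M \<Longrightarrow> (\<lambda>x. c * f x) \<in> L2 M"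
  by (rule L2_bounded_mult[of _ _ "\<lambda>_. c" "cmod c"]) auto

lemma L2_uminus: "f \<in> L2 M \<Longrightarrow> (\<lambda>x. - f x) \<in> L2 M"
  using L2_cmult[of f M "-1"] by simp

lemma L2_diff: "f \<in> L2 M \<Longrightarrow> g \<in> L2 M \<Longrightarrow> (\<lambda>x. f x - g x) \<in> L2 M"
  using L2_add[OF _ L2_uminus, of f M g] by simp

lemma L2_integrable_mult_cnj:
  assumes "f \<in> L2 M" "g \<in> L2 M"
  shows "integrable M (\<lambda>x. f x * cnj (g x))"
proof (rule Bochner_Integration.integrable_bound)
  show "integrable M (\<lambda>x. (cmod (f x))\<^sup>2 + (cmod (g x))\<^sup>2)"
    using assms by (auto dest: L2_integrable)
  show "AE x in M. norm (f x * cnj (g x)) \<le> norm ((cmod (f x))\<^sup>2 + (cmod (g x))\<^sup>2)"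
  proof (rule AE_I2)
    fix x
    have "2 * (cmod (f x) * cmod (g x)) \<le> (cmod (f x))\<^sup>2 + (cmod (g x))\<^sup>2"
      using sum_squares_bound[of "cmod (f x)" "cmod (g x)"] by simp
    moreover have "0 \<le> cmod (f x) * cmod (g x)" by simp
    ultimately have "cmod (f x) * cmod (g x) \<le> (cmod (f x))\<^sup>2 + (cmod (g x))\<^sup>2" by linarith
    then show "norm (f x * cnj (g x)) \<le> norm ((cmod (f x))\<^sup>2 + (cmod (g x))\<^sup>2)"
      by (simp add: norm_mult)
  qed
  show "(\<lambda>x. f x * cnj (g x)) \<in> borel_measurable M" using assms by measurable
qed

text \<open>Reflexive only on square-integrable functions: the quotient by this partial equivalence
  selects them and identifies functions equal almost everywhere in one construction.\<close>

definition l2_rel :: "('a::euclidean_space \<Rightarrow> complex) \<Rightarrow> ('a \<Rightarrow> complex) \<Rightarrow> bool" where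
  "l2_rel f g \<longleftrightarrow> f \<in> L2 lborel \<and> g \<in> L2 lborel \<and> (AE x in lborel. f x = g x)"

quotient_type (overloaded) 'a l2 = "'a::euclidean_space \<Rightarrow> complex" / partial: l2_rel
  morphisms l2_rep l2_abs
proof (rule part_equivpI)
  show "\<exists>f. l2_rel f f" by (rule exI[of _ "\<lambda>x. 0"]) (simp add: l2_rel_def L2_zero)
  show "symp l2_rel" by (auto simp: symp_def l2_rel_def)
  show "transp l2_rel" by (auto simp: transp_def l2_rel_def)
qed

text \<open>The representative of a class is arbitrary, so pointwise formulas for the result of an
  operation hold only almost everywhere; equalities of classes are therefore proved by
  \<open>l2_eqI\<close> on the intersection of full-measure sets.\<close>

definition l2_fun :: "'a::euclidean_space l2 \<Rightarrow> 'a \<Rightarrow> complex" where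
  "l2_fun u = l2_rep u"

lemma l2_fun_L2 [simp]: "l2_fun u \<in> L2 lborel"
  using Quotient3_rep_reflp[OF Quotient3_l2, of u] by (simp add: l2_fun_def l2_rel_def)

lemma l2_fun_measurable [measurable]: "l2_fun u \<in> borel_measurable lborel"
  by (rule L2_measurable[OF l2_fun_L2])

lemma l2_abs_fun [simp]: "l2_abs (l2_fun u) = u"
  by (simp add: l2_fun_def Quotient3_abs_rep[OF Quotient3_l2])

lemma l2_abs_eq_iff:
  assumes "f \<in> L2 lborel" "g \<in> L2 lborel"
  shows "l2_abs f = l2_abs g \<longleftrightarrow> (AE x in lborel. f x = g x)"
  using Quotient3_rel[OF Quotient3_l2, of f g] assms by (auto simp: l2_rel_def)

lemma l2_fun_abs: "f \<in> L2 lborel \<Longrightarrow> AE x in lborel. l2_fun (l2_abs f) x = f x"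
  by (subst l2_abs_eq_iff[symmetric]) auto

lemma l2_eqI: "(AE x in lborel. l2_fun u x = l2_fun v x) \<Longrightarrow> u = v"
  using l2_abs_eq_iff[of "l2_fun u" "l2_fun v"] by simp

text \<open>Scalars are real and the inner product is the real part of the Hermitian one, which
  induces the usual norm. Nothing is lost: the imaginary part is the real part after multiplying one
  argument by a power of \<i>.\<close>

instantiation l2 :: (euclidean_space) real_inner
begin

definition zero_l2 :: "'a l2" where
  "zero_l2 = l2_abs (\<lambda>x. 0)"

definition plus_l2 :: "'a l2 \<Rightarrow> 'a l2 \<Rightarrow> 'a l2" where
  "plus_l2 u v = l2_abs (\<lambda>x. l2_fun u x + l2_fun v x)"

definition minus_l2 :: "'a l2 \<Rightarrow> 'a l2 \<Rightarrow> 'a l2" where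
  "minus_l2 u v = l2_abs (\<lambda>x. l2_fun u x - l2_fun v x)"

definition uminus_l2 :: "'a l2 \<Rightarrow> 'a l2" where
  "uminus_l2 u = l2_abs (\<lambda>x. - l2_fun u x)"

definition scaleR_l2 :: "real \<Rightarrow> 'a l2 \<Rightarrow> 'a l2" where
  "scaleR_l2 r u = l2_abs (\<lambda>x. complex_of_real r * l2_fun u x)"

definition inner_l2 :: "'a l2 \<Rightarrow> 'a l2 \<Rightarrow> real" where
  "inner_l2 u v = (LBINT x. Re (l2_fun u x * cnj (l2_fun v x)))"

definition norm_l2 :: "'a l2 \<Rightarrow> real" where
  "norm_l2 u = sqrt (inner u u)"

definition dist_l2 :: "'a l2 \<Rightarrow> 'a l2 \<Rightarrow> real" where
  "dist_l2 u v = norm (u - v)"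

definition sgn_l2 :: "'a l2 \<Rightarrow> 'a l2" where
  "sgn_l2 u = inverse (norm u) *\<^sub>R u"

definition uniformity_l2 :: "('a l2 \<times> 'a l2) filter" where
  "uniformity_l2 = (INF e\<in>{0 <..}. principal {(x, y). dist x y < e})"

definition open_l2 :: "'a l2 set \<Rightarrow> bool" where
  "open_l2 U \<longleftrightarrow> (\<forall>x\<in>U. eventually (\<lambda>(x', y). x' = x \<longrightarrow> y \<in> U) uniformity)"

lemma l2_fun_zero: "AE x in lborel. l2_fun (0 :: 'a l2) x = 0"
  unfolding zero_l2_def by (rule l2_fun_abs[OF L2_zero])

lemma l2_fun_add: "AE x in lborel. l2_fun (u + v) x = l2_fun u x + l2_fun v x" for u v :: "'a l2"
  unfolding plus_l2_def by (intro l2_fun_abs L2_add l2_fun_L2)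

lemma l2_fun_diff: "AE x in lborel. l2_fun (u - v) x = l2_fun u x - l2_fun v x" for u v :: "'a l2"
  unfolding minus_l2_def by (intro l2_fun_abs L2_diff l2_fun_L2)

lemma l2_fun_uminus: "AE x in lborel. l2_fun (- u) x = - l2_fun u x" for u :: "'a l2"
  unfolding uminus_l2_def by (intro l2_fun_abs L2_uminus l2_fun_L2)

lemma l2_fun_scaleR: "AE x in lborel. l2_fun (r *\<^sub>R u) x = complex_of_real r * l2_fun u x" for u :: "'a l2"
  unfolding scaleR_l2_def by (intro l2_fun_abs L2_cmult l2_fun_L2)

lemma l2_inner_integrable: "integrable lborel (\<lambda>x. Re (l2_fun u x * cnj (l2_fun v x)))" for u v :: "'a l2"
  by (rule integrable_Re[OF L2_integrable_mult_cnj]) auto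

instance
proof
  fix u v w :: "'a l2" and r s :: real
  show "u + v + w = u + (v + w)"
    by (rule l2_eqI) (use l2_fun_add[of "u + v" w] l2_fun_add[of u v] l2_fun_add[of u "v + w"] l2_fun_add[of v w]
      in eventually_elim, simp add: algebra_simps)
  show "u + v = v + u"
    by (rule l2_eqI) (use l2_fun_add[of u v] l2_fun_add[of v u] in eventually_elim, simp add: algebra_simps)
  show "0 + u = u"
    by (rule l2_eqI) (use l2_fun_add[of 0 u] l2_fun_zero in eventually_elim, simp)
  show "- u + u = 0"
    by (rule l2_eqI) (use l2_fun_add[of "- u" u] l2_fun_uminus[of u] l2_fun_zero in eventually_elim, simp)
  show "u - v = u + - v"
    by (rule l2_eqI) (use l2_fun_add[of u "- v"] l2_fun_uminus[of v] l2_fun_diff[of u v] in eventually_elim, simp)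
  show "r *\<^sub>R (u + v) = r *\<^sub>R u + r *\<^sub>R v"
    by (rule l2_eqI) (use l2_fun_add[of u v] l2_fun_scaleR[of r "u + v"] l2_fun_scaleR[of r u] l2_fun_scaleR[of r v]
      l2_fun_add[of "r *\<^sub>R u" "r *\<^sub>R v"] in eventually_elim, simp add: algebra_simps)
  show "(r + s) *\<^sub>R u = r *\<^sub>R u + s *\<^sub>R u"
    by (rule l2_eqI) (use l2_fun_scaleR[of "r + s" u] l2_fun_scaleR[of r u] l2_fun_scaleR[of s u]
      l2_fun_add[of "r *\<^sub>R u" "s *\<^sub>R u"] in eventually_elim, simp add: algebra_simps)
  show "r *\<^sub>R s *\<^sub>R u = (r * s) *\<^sub>R u"
    by (rule l2_eqI) (use l2_fun_scaleR[of r "s *\<^sub>R u"] l2_fun_scaleR[of s u] l2_fun_scaleR[of "r * s" u]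
      in eventually_elim, simp)
  show "1 *\<^sub>R u = u"
    by (rule l2_eqI) (use l2_fun_scaleR[of 1 u] in eventually_elim, simp)
  show "dist u v = norm (u - v)" by (rule dist_l2_def)
  show "sgn u = inverse (norm u) *\<^sub>R u" by (rule sgn_l2_def)
  show "(uniformity :: ('a l2 \<times> 'a l2) filter) = (INF e\<in>{0 <..}. principal {(x, y). dist x y < e})"
    by (rule uniformity_l2_def)
  show "open U \<longleftrightarrow> (\<forall>x\<in>U. eventually (\<lambda>(x', y). x' = x \<longrightarrow> y \<in> U) uniformity)" for U :: "'a l2 set"
    by (rule open_l2_def)
  show "inner u v = inner v u"
    unfolding inner_l2_def by (rule Bochner_Integration.integral_cong) (auto simp: algebra_simps)
  show "inner (u + v) w = inner u w + inner v w"
  proof -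
    have "inner (u + v) w = (LBINT x. Re (l2_fun u x * cnj (l2_fun w x)) + Re (l2_fun v x * cnj (l2_fun w x)))"
      unfolding inner_l2_def
      by (rule integral_cong_AE; (measurable)?) (use l2_fun_add[of u v] in eventually_elim, simp add: algebra_simps)
    then show ?thesis
      unfolding inner_l2_def using l2_inner_integrable by (subst (asm) Bochner_Integration.integral_add)
  qed
  show "inner (r *\<^sub>R u) v = r * inner u v"
  proof -
    have "inner (r *\<^sub>R u) v = (LBINT x. r * Re (l2_fun u x * cnj (l2_fun v x)))"
      unfolding inner_l2_def
      by (rule integral_cong_AE; (measurable)?) (use l2_fun_scaleR[of r u] in eventually_elim, simp add: algebra_simps)
    then show ?thesis by (simp add: inner_l2_def)
  qed
  have eq: "Re (l2_fun u x * cnj (l2_fun u x)) = (cmod (l2_fun u x))\<^sup>2" for x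
    by (simp flip: complex_norm_square)
  show "0 \<le> inner u u"
    unfolding inner_l2_def eq by (rule integral_nonneg_AE) auto
  show "inner u u = 0 \<longleftrightarrow> u = 0"
  proof -
    have "inner u u = 0 \<longleftrightarrow> (AE x in lborel. (cmod (l2_fun u x))\<^sup>2 = 0)"
      unfolding inner_l2_def eq by (rule integral_nonneg_eq_0_iff_AE) (auto intro: L2_integrable)
    also have "\<dots> \<longleftrightarrow> l2_abs (l2_fun u) = l2_abs (\<lambda>x. 0)"
      by (subst l2_abs_eq_iff) (auto simp: L2_zero)
    also have "\<dots> \<longleftrightarrow> u = 0" by (simp add: zero_l2_def)
    finally show ?thesis .
  qed
  show "norm u = sqrt (inner u u)" by (rule norm_l2_def)
qed

end

section \<open>Norms, inner products and vector operations through representatives\<close>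

lemma norm_l2_eq: "norm u = L2_norm lborel (l2_fun u)"
proof -
  have "Re (l2_fun u x * cnj (l2_fun u x)) = (cmod (l2_fun u x))\<^sup>2" for x
    by (simp flip: complex_norm_square)
  then show ?thesis by (simp add: norm_eq_sqrt_inner inner_l2_def L2_norm_def)
qed

lemma inner_l2_abs:
  assumes "f \<in> L2 lborel" "g \<in> L2 lborel"
  shows "inner (l2_abs f) (l2_abs g) = (LBINT x. Re (f x * cnj (g x)))"
  unfolding inner_l2_def
proof (rule integral_cong_AE)
  show "AE x in lborel. Re (l2_fun (l2_abs f) x * cnj (l2_fun (l2_abs g) x)) = Re (f x * cnj (g x))"
    using l2_fun_abs[OF assms(1)] l2_fun_abs[OF assms(2)] by eventually_elim simp
qed (use assms in measurable)

lemma norm_l2_abs: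
  assumes "f \<in> L2 lborel"
  shows "norm (l2_abs f) = L2_norm lborel f"
proof -
  have "Re (f x * cnj (f x)) = (cmod (f x))\<^sup>2" for x
    by (simp flip: complex_norm_square)
  then show ?thesis by (simp add: norm_eq_sqrt_inner inner_l2_abs assms L2_norm_def)
qed

lemma l2_abs_add:
  assumes "f \<in> L2 lborel" "g \<in> L2 lborel"
  shows "l2_abs (\<lambda>x. f x + g x) = l2_abs f + l2_abs g"
proof (rule l2_eqI)
  show "AE x in lborel. l2_fun (l2_abs (\<lambda>x. f x + g x)) x = l2_fun (l2_abs f + l2_abs g) x"
    using l2_fun_add[of "l2_abs f" "l2_abs g"] l2_fun_abs[OF assms(1)] l2_fun_abs[OF assms(2)]
      l2_fun_abs[OF L2_add[OF assms]] by eventually_elim simp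
qed

lemma l2_abs_diff:
  assumes "f \<in> L2 lborel" "g \<in> L2 lborel"
  shows "l2_abs (\<lambda>x. f x - g x) = l2_abs f - l2_abs g"
proof (rule l2_eqI)
  show "AE x in lborel. l2_fun (l2_abs (\<lambda>x. f x - g x)) x = l2_fun (l2_abs f - l2_abs g) x"
    using l2_fun_diff[of "l2_abs f" "l2_abs g"] l2_fun_abs[OF assms(1)] l2_fun_abs[OF assms(2)]
      l2_fun_abs[OF L2_diff[OF assms]] by eventually_elim simp
qed

lemma l2_abs_scaleR:
  assumes "f \<in> L2 lborel"
  shows "l2_abs (\<lambda>x. complex_of_real r * f x) = r *\<^sub>R l2_abs f"
proof (rule l2_eqI)
  show "AE x in lborel. l2_fun (l2_abs (\<lambda>x. complex_of_real r * f x)) x = l2_fun (r *\<^sub>R l2_abs f) x"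
    using l2_fun_scaleR[of r "l2_abs f"] l2_fun_abs[OF assms] l2_fun_abs[OF L2_cmult[OF assms]]
    by eventually_elim simp
qed

section \<open>Completeness (Riesz-Fischer)\<close>

lemma summable_if_weighted_squares_bounded:
  fixes d :: "nat \<Rightarrow> 'a::banach"
  assumes "\<And>n. 2 ^ n * (norm (d n))\<^sup>2 \<le> C"
  shows "summable d"
proof (rule summable_comparison_test)
  show "summable (\<lambda>n. sqrt C * (1 / sqrt 2) ^ n)"
    by (intro summable_mult summable_geometric) simp
  have "norm (d n) \<le> sqrt C * (1 / sqrt 2) ^ n" for n
  proof -
    have "norm (d n) \<le> sqrt (C / 2 ^ n)"
      using assms[of n] by (intro real_le_rsqrt) (simp add: field_simps)
    also have "\<dots> = sqrt C * (1 / sqrt 2) ^ n"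
      by (simp add: real_sqrt_divide real_sqrt_power power_divide)
    finally show ?thesis .
  qed
  then show "\<exists>N. \<forall>n\<ge>N. norm (d n) \<le> sqrt C * (1 / sqrt 2) ^ n" by blast
qed

lemma nn_integral_l2_fun: "(\<integral>\<^sup>+x. ennreal ((cmod (l2_fun u x))\<^sup>2) \<partial>lborel) = ennreal ((norm u)\<^sup>2)"
  by (subst nn_integral_eq_integral) (auto simp: norm_l2_eq L2_norm_def integral_nonneg_AE intro: L2_integrable)

text \<open>Weighting the squared increments by \<open>2\<^sup>n\<close> replaces Minkowski's inequality for series.\<close>

lemma l2_fast_Cauchy_AE_convergent:
  fixes X :: "nat \<Rightarrow> 'a::euclidean_space l2"
  assumes "\<And>n. norm (X (Suc n) - X n) \<le> (1 / 2) ^ n"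
  shows "AE x in lborel. convergent (\<lambda>n. l2_fun (X n) x)"
proof -
  define d where "d n x = l2_fun (X (Suc n)) x - l2_fun (X n) x" for n x
  let ?w = "\<lambda>x n. ennreal (2 ^ n * (cmod (d n x))\<^sup>2)"
  have [measurable]: "d n \<in> borel_measurable lborel" for n unfolding d_def by measurable
  \<comment> \<open>The squared increment has integral at most \<open>4^-n\<close>, so the weight
    \<open>2^n\<close> still leaves the summable bound \<open>2^-n\<close>.\<close>
  have int_d: "(\<integral>\<^sup>+x. ?w x n \<partial>lborel) \<le> ennreal ((1 / 2) ^ n)" for n
  proof -
    have "(\<integral>\<^sup>+x. ?w x n \<partial>lborel)
        = ennreal (2 ^ n) * (\<integral>\<^sup>+x. ennreal ((cmod (d n x))\<^sup>2) \<partial>lborel)"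
      by (simp add: ennreal_mult' nn_integral_cmult)
    also have "(\<integral>\<^sup>+x. ennreal ((cmod (d n x))\<^sup>2) \<partial>lborel) = (\<integral>\<^sup>+x. ennreal ((cmod (l2_fun (X (Suc n) - X n) x))\<^sup>2) \<partial>lborel)"
      by (rule nn_integral_cong_AE) (use l2_fun_diff[of "X (Suc n)" "X n"] in eventually_elim, simp add: d_def)
    also have "\<dots> = ennreal ((norm (X (Suc n) - X n))\<^sup>2)" by (rule nn_integral_l2_fun)
    also have "ennreal (2 ^ n) * \<dots> = ennreal (2 ^ n * (norm (X (Suc n) - X n))\<^sup>2)" by (simp add: ennreal_mult')
    also have "\<dots> \<le> ennreal (2 ^ n * ((1 / 2) ^ n)\<^sup>2)"
      using assms by (intro ennreal_leI mult_left_mono power_mono) auto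
    also have "2 ^ n * ((1 / 2) ^ n)\<^sup>2 = ((1 / 2) ^ n :: real)"
      by (simp add: power2_eq_square power_divide)
    finally show ?thesis .
  qed
  have "(\<integral>\<^sup>+x. (\<Sum>n. ?w x n) \<partial>lborel)
      = (\<Sum>n. \<integral>\<^sup>+x. ?w x n \<partial>lborel)"
    by (rule nn_integral_suminf) measurable
  also have "\<dots> \<le> (\<Sum>n. ennreal ((1 / 2) ^ n))" by (intro suminf_le int_d) auto
  also have "\<dots> = ennreal (\<Sum>n. (1 / 2) ^ n)"
    by (intro suminf_ennreal2 summable_geometric) simp_all
  also have "\<dots> < \<infinity>" by simp
  finally have "AE x in lborel. (\<Sum>n. ?w x n) \<noteq> \<infinity>"
    by (intro nn_integral_PInf_AE) (auto simp: less_top)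
  note finite_AE = this
  have fin: "\<exists>C\<ge>0. S = ennreal C" if "S \<noteq> \<infinity>" for S :: ennreal
    using that by (cases S) auto
  have term_le: "f n \<le> suminf f" for f :: "nat \<Rightarrow> ennreal" and n
    using sum_le_suminf[OF summableI, of "{n}" f] by simp
  show ?thesis
    using finite_AE
  proof eventually_elim
    fix x assume "(\<Sum>n. ?w x n) \<noteq> \<infinity>"
    from fin[OF this] obtain C
      where C: "C \<ge> 0" "(\<Sum>n. ?w x n) = ennreal C" by blast
    have "2 ^ n * (cmod (d n x))\<^sup>2 \<le> C" for n
      using term_le[of "\<lambda>n. ?w x n" n] unfolding C(2)
      by (rule ennreal_le_iff[OF C(1), THEN iffD1])
    then have "summable (\<lambda>n. d n x)" by (rule summable_if_weighted_squares_bounded)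
    then have "convergent (\<lambda>n. \<Sum>i<n. d i x)" by (simp add: summable_iff_convergent)
    moreover have "(\<Sum>i<n. d i x) = l2_fun (X n) x - l2_fun (X 0) x" for n
      unfolding d_def by (rule sum_lessThan_telescope)
    ultimately show "convergent (\<lambda>n. l2_fun (X n) x)"
      by (simp add: convergent_diff_const_right_iff)
  qed
qed

lemma l2_fast_Cauchy_convergent:
  fixes X :: "nat \<Rightarrow> 'a::euclidean_space l2"
  assumes "\<And>n. norm (X (Suc n) - X n) \<le> (1 / 2) ^ n" and Cauchy: "Cauchy X"
  shows "convergent X"
proof -
  let ?d = "\<lambda>m n x. ennreal ((cmod (l2_fun (X m) x - l2_fun (X n) x))\<^sup>2)"
  \<comment> \<open>On the null set of divergence \<open>lim\<close> is an unspecified value; only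
    measurability of \<open>g\<close> and convergence almost everywhere are used.\<close>
  define g where "g x = lim (\<lambda>n. l2_fun (X n) x)" for x
  let ?e = "\<lambda>n x. ennreal ((cmod (g x - l2_fun (X n) x))\<^sup>2)"
  have [measurable]: "g \<in> borel_measurable lborel" unfolding g_def by measurable
  have lim: "AE x in lborel. (\<lambda>n. l2_fun (X n) x) \<longlonglongrightarrow> g x"
    using l2_fast_Cauchy_AE_convergent[OF assms(1)]
    by eventually_elim (simp add: g_def convergent_LIMSEQ_iff)
  have fatou: "(\<integral>\<^sup>+x. ?e n x \<partial>lborel) \<le> ennreal (e\<^sup>2)"
    if e: "\<And>m. m \<ge> n \<Longrightarrow> norm (X m - X n) \<le> e" for n e
  proof -
    have "(\<integral>\<^sup>+x. ?e n x \<partial>lborel)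
        = (\<integral>\<^sup>+x. liminf (\<lambda>m. ?d m n x) \<partial>lborel)"
    proof (rule nn_integral_cong_AE, use lim in eventually_elim)
      fix x assume "(\<lambda>n. l2_fun (X n) x) \<longlonglongrightarrow> g x"
      then have "(\<lambda>m. ?d m n x) \<longlonglongrightarrow> ?e n x"
        by (intro tendsto_intros)
      then show "?e n x = liminf (\<lambda>m. ?d m n x)"
        using lim_imp_Liminf[OF sequentially_bot] by metis
    qed
    also have "\<dots> \<le> liminf (\<lambda>m. \<integral>\<^sup>+x. ?d m n x \<partial>lborel)"
      by (rule nn_integral_liminf) measurable
    also have "\<dots> \<le> liminf (\<lambda>m. ennreal (e\<^sup>2))"
    proof (rule Liminf_mono)
      have "(\<integral>\<^sup>+x. ?d m n x \<partial>lborel) \<le> ennreal (e\<^sup>2)" if "m \<ge> n" for m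
      proof -
        have "(\<integral>\<^sup>+x. ?d m n x \<partial>lborel)
            = (\<integral>\<^sup>+x. ennreal ((cmod (l2_fun (X m - X n) x))\<^sup>2) \<partial>lborel)"
          by (rule nn_integral_cong_AE) (use l2_fun_diff[of "X m" "X n"] in eventually_elim, simp)
        also have "\<dots> = ennreal ((norm (X m - X n))\<^sup>2)" by (rule nn_integral_l2_fun)
        also have "\<dots> \<le> ennreal (e\<^sup>2)" using e[OF that] by (intro ennreal_leI power_mono) auto
        finally show ?thesis .
      qed
      then show "\<forall>\<^sub>F m in sequentially. (\<integral>\<^sup>+x. ?d m n x \<partial>lborel) \<le> ennreal (e\<^sup>2)"
        using eventually_ge_at_top by (rule eventually_mono[rotated])
    qed
    also have "\<dots> = ennreal (e\<^sup>2)" by (simp add: Liminf_const)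
    finally show ?thesis .
  qed
  have dL2: "(\<lambda>x. g x - l2_fun (X n) x) \<in> L2 lborel" if "\<And>m. m \<ge> n \<Longrightarrow> norm (X m - X n) \<le> e" for n e
  proof -
    have "integrable lborel (\<lambda>x. (cmod (g x - l2_fun (X n) x))\<^sup>2)"
      by (rule integrableI_nonneg) (use fatou[OF that] in \<open>auto intro: le_less_trans\<close>)
    then show ?thesis by (simp add: L2_def)
  qed
  have CauchyN: "\<exists>N. \<forall>m\<ge>N. \<forall>n\<ge>N. norm (X m - X n) < e" if "e > 0" for e
    using Cauchy that unfolding Cauchy_iff by blast
  obtain N1 where N1: "\<And>m n. m \<ge> N1 \<Longrightarrow> n \<ge> N1 \<Longrightarrow> norm (X m - X n) < 1" using CauchyN[of 1] by auto
  \<comment> \<open>Fatou bounds only the distance from \<open>g\<close> to members of the sequence;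
    \<open>g\<close> is square-integrable as such a difference plus \<open>X N1\<close>.\<close>
  have "(\<lambda>x. (g x - l2_fun (X N1) x) + l2_fun (X N1) x) \<in> L2 lborel"
    by (intro L2_add dL2[of N1 1]) (use N1 in \<open>auto intro: less_imp_le\<close>)
  then have gL2: "g \<in> L2 lborel" by simp
  have "X \<longlonglongrightarrow> l2_abs g"
  proof (rule LIMSEQ_I)
    fix r :: real assume r: "r > 0"
    obtain N where N: "\<And>m n. m \<ge> N \<Longrightarrow> n \<ge> N \<Longrightarrow> norm (X m - X n) < r / 2"
      using CauchyN[of "r / 2"] r by auto
    have "norm (X n - l2_abs g) < r" if n: "n \<ge> N" for n
    proof -
      have le: "norm (X m - X n) \<le> r / 2" if "m \<ge> n" for m using N[of m n] n that by simp
      have "ennreal ((norm (l2_abs g - X n))\<^sup>2) = (\<integral>\<^sup>+x. ennreal ((cmod (l2_fun (l2_abs g - X n) x))\<^sup>2) \<partial>lborel)"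
        by (rule nn_integral_l2_fun[symmetric])
      also have "\<dots> = (\<integral>\<^sup>+x. ?e n x \<partial>lborel)"
        by (rule nn_integral_cong_AE)
          (use l2_fun_diff[of "l2_abs g" "X n"] l2_fun_abs[OF gL2] in eventually_elim, simp)
      also have "\<dots> \<le> ennreal ((r / 2)\<^sup>2)" by (rule fatou[OF le])
      finally have "(norm (l2_abs g - X n))\<^sup>2 \<le> (r / 2)\<^sup>2" by (simp add: ennreal_le_iff)
      then have "norm (l2_abs g - X n) \<le> r / 2" using r by (auto intro: power2_le_imp_le)
      then show ?thesis using r by (simp add: norm_minus_commute)
    qed
    then show "\<exists>no. \<forall>n\<ge>no. norm (X n - l2_abs g) < r" by blast
  qed
  then show ?thesis by (rule convergentI)
qed

instance l2 :: (euclidean_space) complete_space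
proof
  fix X :: "nat \<Rightarrow> 'a l2" assume X: "Cauchy X"
  have ex: "\<exists>N. \<forall>m\<ge>N. \<forall>n\<ge>N. norm (X m - X n) < (1 / 2) ^ k" for k :: nat
    using X unfolding Cauchy_iff by simp
  have "\<exists>r. strict_mono r \<and> (\<forall>k. \<forall>m\<ge>r k. \<forall>n\<ge>r k. norm (X m - X n) < (1 / 2) ^ k)"
  proof -
    obtain N where N: "\<And>k m n. m \<ge> N k \<Longrightarrow> n \<ge> N k \<Longrightarrow> norm (X m - X n) < (1 / 2) ^ k"
      using ex by metis
    \<comment> \<open>Summing all thresholds up to \<open>k\<close> and adding \<open>k\<close>
      makes \<open>r\<close> strictly increasing while keeping \<open>r k\<close> above
      \<open>N k\<close>.\<close>
    define r where "r k = (\<Sum>i\<le>k. N i) + k" for k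
    have "strict_mono r" unfolding strict_mono_Suc_iff r_def by simp
    moreover have "N k \<le> r k" for k
      unfolding r_def by (simp add: member_le_sum trans_le_add1)
    ultimately show ?thesis using N by (meson order_trans)
  qed
  then obtain r where r: "strict_mono r" "\<And>k m n. m \<ge> r k \<Longrightarrow> n \<ge> r k \<Longrightarrow> norm (X m - X n) < (1 / 2) ^ k"
    by blast
  have "convergent (X \<circ> r)"
  proof (rule l2_fast_Cauchy_convergent)
    show "norm ((X \<circ> r) (Suc n) - (X \<circ> r) n) \<le> (1 / 2) ^ n" for n
      using r(2)[of n "r (Suc n)" "r n"] strict_mono_leD[OF r(1), of n "Suc n"] by simp
    show "Cauchy (X \<circ> r)" using X r(1) by (rule Cauchy_subseq_Cauchy)
  qed
  then obtain l where "(X \<circ> r) \<longlonglongrightarrow> l" by (auto simp: convergent_def)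
  then have "X \<longlonglongrightarrow> l" using X r(1) Cauchy_converges_subseq by blast
  then show "convergent X" by (rule convergentI)
qed

section \<open>Multiplication operators and the spectrum of a symmetric operator\<close>

text \<open>For a constant function \<open>\<lambda>_. z\<close> this is multiplication by the
  complex scalar \<open>z\<close>, which the real vector space structure of \<open>l2\<close> does
  not provide.\<close>

definition mult_op :: "('a::euclidean_space \<Rightarrow> complex) \<Rightarrow> 'a l2 \<Rightarrow> 'a l2" where
  "mult_op V u = l2_abs (\<lambda>x. V x * l2_fun u x)"

context
  fixes V :: "'a::euclidean_space \<Rightarrow> complex" and B :: real
  assumes V [measurable]: "V \<in> borel_measurable lborel" and B: "\<And>x. cmod (V x) \<le> B"
begin

lemma l2_fun_mult_op: "AE x in lborel. l2_fun (mult_op V u) x = V x * l2_fun u x"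
  unfolding mult_op_def by (intro l2_fun_abs L2_bounded_mult[OF l2_fun_L2 V B])

lemma mult_op_abs:
  assumes "f \<in> L2 lborel"
  shows "mult_op V (l2_abs f) = l2_abs (\<lambda>x. V x * f x)"
proof (rule l2_eqI)
  show "AE x in lborel. l2_fun (mult_op V (l2_abs f)) x = l2_fun (l2_abs (\<lambda>x. V x * f x)) x"
    using l2_fun_mult_op[of "l2_abs f"] l2_fun_abs[OF assms] l2_fun_abs[OF L2_bounded_mult[OF assms V B]]
    by eventually_elim simp
qed

lemma norm_mult_op_le: "norm (mult_op V u) \<le> B * norm u"
proof -
  have "0 \<le> B" by (rule order_trans[OF norm_ge_zero B])
  have "(norm (mult_op V u))\<^sup>2 = (LBINT x. (cmod (V x * l2_fun u x))\<^sup>2)"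
    unfolding mult_op_def
    by (simp add: norm_l2_abs L2_bounded_mult[OF l2_fun_L2 V B] L2_norm_def integral_nonneg_AE)
  also have "\<dots> \<le> (LBINT x. B\<^sup>2 * (cmod (l2_fun u x))\<^sup>2)"
    using L2_integrable[OF L2_bounded_mult[OF l2_fun_L2 V B]] L2_integrable[OF l2_fun_L2] B
    by (intro integral_mono) (auto simp: norm_mult power_mult_distrib intro!: mult_right_mono power_mono)
  also have "\<dots> = (B * norm u)\<^sup>2"
    by (simp add: norm_l2_eq L2_norm_def integral_nonneg_AE power_mult_distrib)
  finally show ?thesis using \<open>0 \<le> B\<close> by (auto intro: power2_le_imp_le)
qed

lemma bounded_linear_mult_op: "bounded_linear (mult_op V)"
proof (rule bounded_linear_intro)
  show "mult_op V (u + v) = mult_op V u + mult_op V v" for u v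
    by (rule l2_eqI) (use l2_fun_mult_op[of "u + v"] l2_fun_mult_op[of u] l2_fun_mult_op[of v] l2_fun_add[of u v]
      l2_fun_add[of "mult_op V u" "mult_op V v"] in eventually_elim, simp add: algebra_simps)
  show "mult_op V (r *\<^sub>R u) = r *\<^sub>R mult_op V u" for r u
    by (rule l2_eqI) (use l2_fun_mult_op[of "r *\<^sub>R u"] l2_fun_mult_op[of u] l2_fun_scaleR[of r u]
      l2_fun_scaleR[of r "mult_op V u"] in eventually_elim, simp)
  show "norm (mult_op V u) \<le> norm u * B" for u
    using norm_mult_op_le[of u] by (simp add: mult.commute)
qed

end

lemma inner_mult_op:
  assumes V [measurable]: "V \<in> borel_measurable lborel" and B: "\<And>x. cmod (V x) \<le> B"
  shows "inner (mult_op V u) v = inner u (mult_op (\<lambda>x. cnj (V x)) v)"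
  unfolding inner_l2_def
proof (rule integral_cong_AE)
  have "AE x in lborel. l2_fun (mult_op (\<lambda>x. cnj (V x)) v) x = cnj (V x) * l2_fun v x"
    by (rule l2_fun_mult_op) (use B in auto)
  with l2_fun_mult_op[OF V B, of u]
  show "AE x in lborel. Re (l2_fun (mult_op V u) x * cnj (l2_fun v x))
      = Re (l2_fun u x * cnj (l2_fun (mult_op (\<lambda>x. cnj (V x)) v) x))"
    by eventually_elim (simp add: mult_ac)
qed measurable

lemma mult_op_diff:
  assumes "V \<in> borel_measurable lborel" "\<And>x. cmod (V x) \<le> B"
    and "W \<in> borel_measurable lborel" "\<And>x. cmod (W x) \<le> C"
  shows "mult_op (\<lambda>x. V x - W x) u = mult_op V u - mult_op W u"
proof (rule l2_eqI)
  have "cmod (V x - W x) \<le> B + C" for x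
    using norm_triangle_ineq4[of "V x" "W x"] assms(2)[of x] assms(4)[of x] by linarith
  then have "AE x in lborel. l2_fun (mult_op (\<lambda>x. V x - W x) u) x = (V x - W x) * l2_fun u x"
    using assms by (intro l2_fun_mult_op) auto
  with l2_fun_mult_op[OF assms(1,2), of u] l2_fun_mult_op[OF assms(3,4), of u]
    l2_fun_diff[of "mult_op V u" "mult_op W u"]
  show "AE x in lborel. l2_fun (mult_op (\<lambda>x. V x - W x) u) x = l2_fun (mult_op V u - mult_op W u) x"
    by eventually_elim (simp add: left_diff_distrib)
qed

lemma l2_fun_sum:
  "finite B \<Longrightarrow> AE x in lborel. l2_fun (\<Sum>b\<in>B. c b *\<^sub>R b) x = (\<Sum>b\<in>B. complex_of_real (c b) * l2_fun b x)"
proof (induction B rule: finite_induct)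
  case empty
  then show ?case using l2_fun_zero by simp
next
  case (insert b B)
  then have eq: "(\<Sum>b\<in>insert b B. c b *\<^sub>R b) = c b *\<^sub>R b + (\<Sum>b\<in>B. c b *\<^sub>R b)" by simp
  show ?case
    unfolding eq
    using insert.IH l2_fun_add[of "c b *\<^sub>R b" "\<Sum>b\<in>B. c b *\<^sub>R b"] l2_fun_scaleR[of "c b" b]
    by eventually_elim (use insert.hyps in simp)
qed

section \<open>Transfer of operators between functions and classes\<close>

definition l2_lift :: "(('a::euclidean_space \<Rightarrow> complex) \<Rightarrow> 'a \<Rightarrow> complex) \<Rightarrow> 'a l2 \<Rightarrow> 'a l2" where
  "l2_lift T u = l2_abs (T (l2_fun u))"

text \<open>The two conditions under which an operator on functions, the kind for which the spectrum
  is defined, descends to classes.\<close>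

locale l2_operator =
  fixes T :: "('a::euclidean_space \<Rightarrow> complex) \<Rightarrow> 'a \<Rightarrow> complex"
  assumes maps_L2: "f \<in> L2 lborel \<Longrightarrow> T f \<in> L2 lborel"
    and cong_AE: "\<lbrakk>f \<in> L2 lborel; g \<in> L2 lborel; AE x in lborel. f x = g x\<rbrakk> \<Longrightarrow> AE x in lborel. T f x = T g x"
begin

lemma l2_lift_abs: "f \<in> L2 lborel \<Longrightarrow> l2_lift T (l2_abs f) = l2_abs (T f)"
  unfolding l2_lift_def by (subst l2_abs_eq_iff) (auto intro: maps_L2 cong_AE l2_fun_abs)

lemma l2_fun_lift: "AE x in lborel. l2_fun (l2_lift T u) x = T (l2_fun u) x"
  unfolding l2_lift_def by (intro l2_fun_abs maps_L2 l2_fun_L2)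

end

text \<open>Real linearity together with commutation with \<i> is complex linearity, and symmetry
  for the real part of the product then gives symmetry for the full Hermitian product.\<close>

locale l2_complex_symmetric = l2_operator +
  assumes bounded_linear_lift: "bounded_linear (l2_lift T)"
    and symmetric_lift: "inner (l2_lift T u) v = inner u (l2_lift T v)"
    and imaginary: "l2_lift T (mult_op (\<lambda>_. \<i>) u) = mult_op (\<lambda>_. \<i>) (l2_lift T u)"
begin

definition shifted :: "complex \<Rightarrow> 'a l2 \<Rightarrow> 'a l2" where
  "shifted z u = l2_lift T u - mult_op (\<lambda>_. z) u"

lemma bounded_linear_shifted: "bounded_linear (shifted z)"
  unfolding shifted_def
  by (intro bounded_linear_sub bounded_linear_lift bounded_linear_mult_op[of _ "cmod z"]) auto

lemma shifted_adjoint: "inner (shifted z u) v = inner u (shifted (cnj z) v)"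
  unfolding shifted_def inner_diff symmetric_lift
  by (subst inner_mult_op[of _ "cmod z"]) auto

lemma shifted_abs:
  assumes "f \<in> L2 lborel"
  shows "shifted z (l2_abs f) = l2_abs (\<lambda>x. T f x - z * f x)"
  unfolding shifted_def l2_lift_abs[OF assms]
  by (subst mult_op_abs[of _ "cmod z"]; (subst l2_abs_diff)?)
    (use assms in \<open>auto intro: maps_L2 L2_cmult\<close>)

text \<open>Pythagoras: with \<open>J\<close> the multiplication by \<i>, \<open>J u\<close> is
  orthogonal to \<open>u\<close> because \<open>J\<close> is skew, and to the image of
  \<open>u\<close> because \<open>J\<close> also commutes with the symmetric operator. The real and
  the imaginary shift thus contribute without a cross term.\<close>

lemma norm_shifted: "(norm (shifted z u))\<^sup>2 = (norm (l2_lift T u - Re z *\<^sub>R u))\<^sup>2 + (Im z)\<^sup>2 * (norm u)\<^sup>2"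
proof -
  define J where "J = mult_op (\<lambda>_::'a. \<i>)"
  have z: "mult_op (\<lambda>_. z) u = Re z *\<^sub>R u + Im z *\<^sub>R J u"
  proof (rule l2_eqI)
    have "AE x in lborel. l2_fun (mult_op (\<lambda>_. z) u) x = z * l2_fun u x"
      by (rule l2_fun_mult_op[of _ "cmod z"]) auto
    moreover have "AE x in lborel. l2_fun (J u) x = \<i> * l2_fun u x"
      unfolding J_def by (rule l2_fun_mult_op[of _ 1]) auto
    ultimately show "AE x in lborel. l2_fun (mult_op (\<lambda>_. z) u) x = l2_fun (Re z *\<^sub>R u + Im z *\<^sub>R J u) x"
      using l2_fun_add[of "Re z *\<^sub>R u" "Im z *\<^sub>R J u"] l2_fun_scaleR[of "Re z" u] l2_fun_scaleR[of "Im z" "J u"]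
      by eventually_elim (simp add: complex_eq_iff)
  qed
  have skew: "inner (J v) w = - inner v (J w)" for v w
  proof -
    have "inner (J v) w = inner v (mult_op (\<lambda>_. cnj \<i>) w)"
      unfolding J_def by (rule inner_mult_op[of _ 1]) auto
    also have "mult_op (\<lambda>_. cnj \<i>) w = (-1) *\<^sub>R J w"
    proof (rule l2_eqI)
      have "AE x in lborel. l2_fun (mult_op (\<lambda>_. cnj \<i>) w) x = cnj \<i> * l2_fun w x"
        by (rule l2_fun_mult_op[of _ 1]) auto
      moreover have "AE x in lborel. l2_fun (J w) x = \<i> * l2_fun w x"
        unfolding J_def by (rule l2_fun_mult_op[of _ 1]) auto
      ultimately show "AE x in lborel. l2_fun (mult_op (\<lambda>_. cnj \<i>) w) x = l2_fun ((-1) *\<^sub>R J w) x"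
        using l2_fun_scaleR[of "-1" "J w"] by eventually_elim simp
    qed
    finally show ?thesis by simp
  qed
  have JJ: "J (J u) = - u"
  proof (rule l2_eqI)
    have J: "AE x in lborel. l2_fun (J v) x = \<i> * l2_fun v x" for v
      unfolding J_def by (rule l2_fun_mult_op[of _ 1]) auto
    show "AE x in lborel. l2_fun (J (J u)) x = l2_fun (- u) x"
      using J[of "J u"] J[of u] l2_fun_uminus[of u] by eventually_elim simp
  qed
  have "inner (l2_lift T u) (J u) = - inner (J (l2_lift T u)) u" by (simp add: skew)
  also have "\<dots> = - inner (l2_lift T (J u)) u" by (simp add: J_def imaginary)
  also have "\<dots> = - inner (l2_lift T u) (J u)" by (simp add: symmetric_lift[of "J u"] inner_commute[of "J u"])
  finally have TJ: "inner (l2_lift T u) (J u) = 0" by simp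
  have uJ: "inner u (J u) = 0" using skew[of u u] by (simp add: inner_commute)
  have "inner (J u) (J u) = (norm u)\<^sup>2"
    using skew[of u "J u"] JJ by (simp add: power2_norm_eq_inner)
  moreover have "inner (J u) u = 0" "inner (J u) (l2_lift T u) = 0"
    using uJ TJ by (simp_all add: inner_commute)
  ultimately show ?thesis
    using TJ uJ unfolding shifted_def z
    by (simp add: power2_norm_eq_inner inner_diff inner_add algebra_simps power2_eq_square[of "Im z"])
qed

text \<open>Injectivity and the bounded inverse come from a lower bound for \<open>T - z\<close>,
  surjectivity from one for its adjoint \<open>T - cnj z\<close>. By \<open>norm_shifted\<close>
  both hold with the same constant: the assumed one if \<open>z\<close> is real,
  \<open>|Im z|\<close> otherwise. Hence the auxiliary bound for every \<open>w\<close> that has the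
  real part of \<open>z\<close> and an imaginary part of the same modulus.\<close>

lemma in_resolvent_set:
  assumes "(\<exists>c>0. \<forall>u. c * norm u \<le> norm (l2_lift T u - Re z *\<^sub>R u)) \<or> Im z \<noteq> 0"
  shows "z \<in> resolvent_set lborel T"
proof -
  obtain c where c: "c > 0" "\<And>u w. Re w = Re z \<Longrightarrow> \<bar>Im w\<bar> = \<bar>Im z\<bar> \<Longrightarrow> c * norm u \<le> norm (shifted w u)"
  proof (cases "Im z = 0")
    case True
    then obtain c where c: "c > 0" "\<forall>u. c * norm u \<le> norm (l2_lift T u - Re z *\<^sub>R u)"
      using assms by auto
    have "c * norm u \<le> norm (shifted w u)" if "Re w = Re z" "\<bar>Im w\<bar> = \<bar>Im z\<bar>" for u w
    proof -
      have "Im w = 0" using that True by simp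
      then have "norm (shifted w u) = norm (l2_lift T u - Re z *\<^sub>R u)"
        using norm_shifted[of w u] that(1) by simp
      then show ?thesis using c(2) by simp
    qed
    then show ?thesis using that[of c] c(1) by blast
  next
    case False
    have "\<bar>Im z\<bar> * norm u \<le> norm (shifted w u)" if "Re w = Re z" "\<bar>Im w\<bar> = \<bar>Im z\<bar>" for u w
    proof (rule power2_le_imp_le)
      have "(Im w)\<^sup>2 = (Im z)\<^sup>2" using that(2) by (simp add: power2_eq_iff abs_eq_iff)
      then show "(\<bar>Im z\<bar> * norm u)\<^sup>2 \<le> (norm (shifted w u))\<^sup>2"
        unfolding norm_shifted by (simp add: power_mult_distrib)
    qed auto
    then show ?thesis using that[of "\<bar>Im z\<bar>"] False by simp
  qed
  have below: "c * norm u \<le> norm (shifted z u)" "c * norm u \<le> norm (shifted (cnj z) u)" for u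
    using c(2) by auto
  have surj: "surj (shifted z)"
    by (rule bounded_below_adjoint_imp_surj[OF bounded_linear_shifted bounded_linear_shifted shifted_adjoint c(1) below(2)])
  have L2_T: "(\<lambda>x. T f x - z * f x) \<in> L2 lborel" if "f \<in> L2 lborel" for f
    using that by (intro L2_diff L2_cmult maps_L2)
  show ?thesis
    unfolding resolvent_set_def mem_Collect_eq
  proof (intro conjI ballI impI)
    fix g :: "'a \<Rightarrow> complex" assume g: "g \<in> L2 lborel"
    obtain u where "shifted z u = l2_abs g" using surj by (metis surj_def)
    then have "l2_abs (\<lambda>x. T (l2_fun u) x - z * l2_fun u x) = l2_abs g"
      using shifted_abs[of "l2_fun u" z] by simp
    then have "AE x in lborel. T (l2_fun u) x - z * l2_fun u x = g x"
      using l2_abs_eq_iff[OF L2_T g] by simp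
    then show "\<exists>f\<in>L2 lborel. AE x in lborel. T f x - z * f x = g x"
      using l2_fun_L2 by blast
  next
    fix f :: "'a \<Rightarrow> complex" assume f: "f \<in> L2 lborel" and 0: "AE x in lborel. T f x - z * f x = 0"
    then have "shifted z (l2_abs f) = 0"
      unfolding shifted_abs[OF f] zero_l2_def using l2_abs_eq_iff[OF L2_T[OF f] L2_zero] by simp
    then have "c * norm (l2_abs f) \<le> 0" using below(1)[of "l2_abs f"] by simp
    then have "l2_abs f = 0" using c(1) by (simp add: mult_le_0_iff)
    then show "AE x in lborel. f x = 0"
      unfolding zero_l2_def using l2_abs_eq_iff[OF f L2_zero] by simp
  next
    have "L2_norm lborel f \<le> (1 / c) * L2_norm lborel (\<lambda>x. T f x - z * f x)" if f: "f \<in> L2 lborel" for f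
      using below(1)[of "l2_abs f"] c(1) unfolding shifted_abs[OF f] norm_l2_abs[OF f] norm_l2_abs[OF L2_T[OF f]]
      by (simp add: field_simps)
    then show "\<exists>C. \<forall>f\<in>L2 lborel. L2_norm lborel f \<le> C * L2_norm lborel (\<lambda>x. T f x - z * f x)" by blast
  qed
qed

lemma eigenfunction_iff:
  assumes "f \<in> L2 lborel"
  shows "f \<in> eigenfunctions lborel T (complex_of_real \<kappa>) \<longleftrightarrow> l2_lift T (l2_abs f) = \<kappa> *\<^sub>R l2_abs f"
proof -
  have "l2_lift T (l2_abs f) = \<kappa> *\<^sub>R l2_abs f \<longleftrightarrow> l2_abs (T f) = l2_abs (\<lambda>x. complex_of_real \<kappa> * f x)"
    by (simp add: l2_lift_abs l2_abs_scaleR assms)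
  also have "\<dots> \<longleftrightarrow> (AE x in lborel. T f x = complex_of_real \<kappa> * f x)"
    by (intro l2_abs_eq_iff maps_L2 L2_cmult assms)
  finally show ?thesis using assms by (simp add: eigenfunctions_def)
qed

text \<open>All three properties are established on classes and carried back to representatives.
  Near \<kappa> the real points are excluded by \<open>isolated\<close>, the non-real ones by
  symmetry alone.\<close>

lemma bottom_in_discrete_spectrum:
  assumes ps: "palais_smale (l2_lift T) \<kappa>"
    and lower: "\<And>u. \<kappa> * (norm u)\<^sup>2 \<le> inner (l2_lift T u) u"
    and inf: "\<And>e. e > 0 \<Longrightarrow> \<exists>u. norm u = 1 \<and> inner (l2_lift T u) u < \<kappa> + e"
  shows "complex_of_real \<kappa> \<in> discrete_spectrum lborel T"
proof -
  interpret palais_smale "l2_lift T" \<kappa> by (rule ps)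
  obtain u where u: "norm u = 1" "l2_lift T u = \<kappa> *\<^sub>R u" using minimum_attained[OF lower inf] by blast
  have eigenf: "l2_fun u \<in> eigenfunctions lborel T \<kappa>"
    using u(2) by (simp add: eigenfunction_iff)
  have nonzero: "\<not> (AE x in lborel. l2_fun u x = 0)"
  proof
    assume "AE x in lborel. l2_fun u x = 0"
    then have "u = l2_abs (\<lambda>x. 0)"
      using l2_abs_eq_iff[OF l2_fun_L2 L2_zero, of u] by simp
    then show False using u(1) by (simp flip: zero_l2_def)
  qed
  have "eigenvalue lborel T \<kappa>" unfolding eigenvalue_def using eigenf nonzero by blast
  moreover have "complex_of_real \<kappa> \<in> op_spectrum lborel T"
    using eigenf nonzero unfolding op_spectrum_def resolvent_set_def eigenfunctions_def by auto
  moreover have "finite_multiplicity lborel T \<kappa>"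
  proof -
    \<comment> \<open>A finite set spanning the eigenspace over the reals also generates it over the
      complex numbers, so real coefficients suffice.\<close>
    obtain B where B: "finite B" "B \<subseteq> {u. l2_lift T u = \<kappa> *\<^sub>R u}" "{u. l2_lift T u = \<kappa> *\<^sub>R u} \<subseteq> span B"
      using eigenspace_finite_dim by blast
    have inj: "inj_on l2_fun B" by (metis inj_onI l2_abs_fun)
    show ?thesis
      unfolding finite_multiplicity_def
    proof (intro exI[of _ "l2_fun ` B"] conjI ballI)
      show "finite (l2_fun ` B)" using B(1) by simp
      show "l2_fun ` B \<subseteq> eigenfunctions lborel T \<kappa>" using B(2) by (auto simp: eigenfunction_iff)
      fix f assume f: "f \<in> eigenfunctions lborel T \<kappa>"
      then have fL2: "f \<in> L2 lborel" by (simp add: eigenfunctions_def)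
      then have "l2_abs f \<in> span B" using B(3) f by (auto simp: eigenfunction_iff)
      then obtain c where c: "l2_abs f = (\<Sum>b\<in>B. c b *\<^sub>R b)" using B(1) by (auto simp: span_finite)
      have "AE x in lborel. f x = (\<Sum>b\<in>B. complex_of_real (c b) * l2_fun b x)"
        using l2_fun_sum[OF B(1), of c] l2_fun_abs[OF fL2] unfolding c by eventually_elim simp
      moreover have "(\<Sum>b\<in>l2_fun ` B. complex_of_real (c (l2_abs b)) * b x)
          = (\<Sum>b\<in>B. complex_of_real (c b) * l2_fun b x)" for x
        by (subst sum.reindex[OF inj]) simp
      ultimately have "AE x in lborel. f x = (\<Sum>b\<in>l2_fun ` B. complex_of_real (c (l2_abs b)) * b x)" by simp
      then show "\<exists>c. AE x in lborel. f x = (\<Sum>b\<in>l2_fun ` B. c b * b x)"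
        by (intro exI[of _ "\<lambda>b. complex_of_real (c (l2_abs b))"])
    qed
  qed
  moreover have "\<not> complex_of_real \<kappa> islimpt op_spectrum lborel T"
  proof -
    obtain r where r: "r > 0"
      "\<And>\<mu>. \<mu> \<noteq> \<kappa> \<Longrightarrow> \<bar>\<mu> - \<kappa>\<bar> < r \<Longrightarrow> \<exists>c>0. \<forall>u. c * norm u \<le> norm (l2_lift T u - \<mu> *\<^sub>R u)"
      using isolated by blast
    have "z \<in> resolvent_set lborel T" if z: "z \<noteq> complex_of_real \<kappa>" "dist z (complex_of_real \<kappa>) < r" for z
    proof (rule in_resolvent_set, cases "Im z = 0")
      case True
      then have "Re z \<noteq> \<kappa>" using z(1) by (auto simp: complex_eq_iff)
      moreover have "\<bar>Re z - \<kappa>\<bar> < r"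
        using z(2) abs_Re_le_cmod[of "z - complex_of_real \<kappa>"] by (simp add: dist_norm)
      ultimately show "(\<exists>c>0. \<forall>u. c * norm u \<le> norm (l2_lift T u - Re z *\<^sub>R u)) \<or> Im z \<noteq> 0" using r(2) by blast
    qed simp
    then show ?thesis
      unfolding islimpt_approachable op_spectrum_def using r(1) by blast
  qed
  ultimately show ?thesis by (simp add: discrete_spectrum_def)
qed

end

section \<open>Density of continuous functions with compact support\<close>

lemma integrable_indicator_cball:
  "integrable lborel (\<lambda>x. c * indicator (cball (z :: 'a::euclidean_space) R) x :: real)"
  by (intro integrable_mult_right integrable_real_indicator) (use emeasure_lborel_cball_finite[of z R] in auto)

lemma integrable_bounded_support:
  fixes f :: "'a::euclidean_space \<Rightarrow> 'b::{banach, second_countable_topology}"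
  assumes "f \<in> borel_measurable lborel" and "\<And>x. norm (f x) \<le> M" and "\<And>x. norm x > R \<Longrightarrow> f x = 0"
  shows "integrable lborel f"
proof (rule Bochner_Integration.integrable_bound)
  show "integrable lborel (\<lambda>x. M * indicator (cball (0::'a) R) x :: real)"
    by (rule integrable_indicator_cball)
  show "AE x in lborel. norm (f x) \<le> norm (M * indicator (cball (0::'a) R) x)"
    using assms(2,3) by (auto simp: indicator_def intro!: order_trans[OF _ abs_ge_self])
qed (rule assms(1))

section \<open>Continuous functions of compact support\<close>

definition Cc :: "('a::euclidean_space \<Rightarrow> complex) \<Rightarrow> bool" where
  "Cc f \<longleftrightarrow> continuous_on UNIV f \<and> (\<exists>R. \<forall>x. norm x > R \<longrightarrow> f x = 0)"

lemma Cc_measurable: "Cc f \<Longrightarrow> f \<in> borel_measurable borel"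
  by (simp add: Cc_def borel_measurable_continuous_onI)

lemma Cc_continuous: "Cc f \<Longrightarrow> continuous_on S f"
  unfolding Cc_def by (blast intro: continuous_on_subset)

lemma Cc_bounded:
  assumes "Cc f"
  obtains M where "M > 0" "\<And>x. norm (f x) \<le> M"
proof -
  obtain R where R: "\<And>x. norm x > R \<Longrightarrow> f x = 0" using assms by (auto simp: Cc_def)
  have "compact (f ` cball 0 R)"
    by (rule compact_continuous_image[OF Cc_continuous[OF assms] compact_cball])
  then have "bounded (f ` cball 0 R)" by (rule compact_imp_bounded)
  then obtain M where M: "M > 0" "\<And>x. x \<in> cball 0 R \<Longrightarrow> norm (f x) \<le> M"
    unfolding bounded_pos by blast
  have "norm (f x) \<le> M" for x using M(1) M(2)[of x] R[of x] by (cases "norm x > R") auto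
  then show ?thesis using M(1) that by blast
qed

lemma Cc_integrable_power:
  assumes "Cc f" "p > 0"
  shows "integrable lborel (\<lambda>x. norm (f x) ^ p)"
proof -
  obtain M where M: "\<And>x. norm (f x) \<le> M" using Cc_bounded[OF assms(1)] by blast
  obtain R where R: "\<And>x. norm x > R \<Longrightarrow> f x = 0" using assms by (auto simp: Cc_def)
  have [measurable]: "f \<in> borel_measurable borel" by (rule Cc_measurable[OF assms(1)])
  show ?thesis
    by (rule integrable_bounded_support[of _ "M ^ p" R])
      (use M R assms(2) in \<open>auto intro!: power_mono simp: norm_power\<close>)
qed

lemma Cc_integrable: "Cc f \<Longrightarrow> integrable lborel f"
  using Cc_integrable_power[of f 1] Cc_measurable[of f] by (simp add: integrable_norm_iff)

lemma Cc_L2: "Cc f \<Longrightarrow> f \<in> L2 lborel"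
  using Cc_integrable_power[of f 2] Cc_measurable[of f] by (simp add: L2_def)

lemma Cc_uniformly_continuous:
  assumes "Cc f" "e > 0"
  obtains d where "d > 0" "\<And>x y. norm (x - y) < d \<Longrightarrow> norm (f x - f y) < e"
proof -
  obtain R where R: "\<And>x. norm x > R \<Longrightarrow> f x = 0" using assms by (auto simp: Cc_def)
  \<comment> \<open>The radius is enlarged by 1: two points closer than 1 either both lie in this
    ball or both lie outside the ball of radius \<open>R\<close>, where \<open>f\<close>
    vanishes.\<close>
  have "uniformly_continuous_on (cball 0 (R + 1)) f"
    by (rule compact_uniformly_continuous[OF Cc_continuous[OF assms(1)] compact_cball])
  then obtain d where "d > 0" and d':
    "\<forall>x\<in>cball 0 (R + 1). \<forall>y\<in>cball 0 (R + 1). dist y x < d \<longrightarrow> dist (f y) (f x) < e"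
    using assms(2) unfolding uniformly_continuous_on_def by blast
  then have d: "d > 0"
    "\<And>x y. x \<in> cball 0 (R + 1) \<Longrightarrow> y \<in> cball 0 (R + 1) \<Longrightarrow> norm (x - y) < d \<Longrightarrow> norm (f x - f y) < e"
    by (simp_all add: dist_norm norm_minus_commute)
  have "norm (f x - f y) < e" if xy: "norm (x - y) < min d 1" for x y
  proof (cases "norm x > R \<and> norm y > R")
    case True
    then show ?thesis using R assms(2) by simp
  next
    case False
    then have "norm x \<le> R + 1" "norm y \<le> R + 1"
      using xy norm_triangle_sub[of x y] norm_triangle_sub[of y x] by (auto simp: norm_minus_commute)
    then show ?thesis using d(2)[of x y] xy by simp
  qed
  then show ?thesis using d(1) that[of "min d 1"] by simp
qed

definition cutoff :: "real \<Rightarrow> 'a::real_normed_vector \<Rightarrow> real" where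
  "cutoff R x = max 0 (min 1 (R + 1 - norm x))"

lemma cutoff: "0 \<le> cutoff R x" "cutoff R x \<le> 1" "norm x \<le> R \<Longrightarrow> cutoff R x = 1" "norm x > R + 1 \<Longrightarrow> cutoff R x = 0"
  by (auto simp: cutoff_def)

lemma continuous_cutoff: "continuous_on UNIV (cutoff R)"
  unfolding cutoff_def by (intro continuous_intros)

lemma Cc_cutoff:
  assumes "continuous_on UNIV f"
  shows "Cc (\<lambda>x. complex_of_real (cutoff R x) * f x)"
  unfolding Cc_def using assms continuous_cutoff[of R]
  by (auto intro!: continuous_intros exI[of _ "R + 1"] simp: cutoff(4))

text \<open>A crude replacement for Minkowski's inequality; the factor \<open>2^p\<close> is
  absorbed by choosing the approximation errors small.\<close>

lemma add_power_le: "(a + b) ^ p \<le> 2 ^ p * (a ^ p + b ^ p)" if "a \<ge> 0" "b \<ge> 0" for a b :: real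
proof -
  have "(a + b) ^ p \<le> (2 * max a b) ^ p" using that by (intro power_mono) auto
  also have "\<dots> = 2 ^ p * (max a b) ^ p" by (simp add: power_mult_distrib)
  also have "(max a b) ^ p \<le> a ^ p + b ^ p" using that by (auto simp: max_def)
  finally show ?thesis by simp
qed

lemma tendsto_norm_power_diff:
  assumes "(\<lambda>n. g n) \<longlonglongrightarrow> (l :: 'a :: real_normed_vector)" "p > 0"
  shows "(\<lambda>n. norm (l - g n) ^ p) \<longlonglongrightarrow> 0"
proof -
  have "(\<lambda>n. norm (l - g n) ^ p) \<longlonglongrightarrow> norm (l - l) ^ p" by (intro tendsto_intros assms)
  then show ?thesis by (simp only: diff_self norm_zero zero_power[OF assms(2)])
qed

text \<open>Measurability provides continuous functions converging to \<open>f\<close> off a null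
  set, but with no common bound. Projecting their values to the disc of radius \<open>M\<close> and
  multiplying by a cutoff does not change the limit and makes dominated convergence
  applicable.\<close>

lemma Cc_dense_bounded:
  fixes f :: "'a::euclidean_space \<Rightarrow> complex"
  assumes [measurable]: "f \<in> borel_measurable lborel"
    and M: "\<And>x. norm (f x) \<le> M" and R: "\<And>x. norm x > R \<Longrightarrow> f x = 0"
    and p: "p > 0" and e: "e > 0"
  obtains g where "Cc g" "(LBINT x. norm (f x - g x) ^ p) < e"
proof -
  have "0 \<le> M" by (rule order_trans[OF norm_ge_zero M])
  have "f measurable_on UNIV"
    by (rule lebesgue_measurable_imp_measurable_on[OF measurable_completion]) auto
  then obtain N g where N: "negligible N" and g: "\<And>n. continuous_on UNIV (g n)"
    "\<And>x. x \<notin> N \<Longrightarrow> (\<lambda>n. g n x) \<longlonglongrightarrow> f x"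
    unfolding measurable_on_def by auto
  have "AE x in lebesgue. x \<notin> N" using N by (simp add: negligible_iff_null_sets AE_not_in)
  then have notN: "AE x in lborel. x \<notin> N" by (simp add: AE_completion_iff)
  define clamp where "clamp = closest_point (cball (0::complex) M)"
  have clamp_cont: "continuous_on UNIV clamp"
    unfolding clamp_def using \<open>0 \<le> M\<close> by (intro continuous_on_closest_point) auto
  have clamp_le: "norm (clamp z) \<le> M" for z
    unfolding clamp_def using closest_point_in_set[of "cball (0::complex) M" z] \<open>0 \<le> M\<close> by simp
  have clamp_id: "clamp (f x) = f x" for x
    unfolding clamp_def using M[of x] by (intro closest_point_self) simp
  define h where "h n x = complex_of_real (cutoff R x) * clamp (g n x)" for n x
  have Cc_h: "Cc (h n)" for n
    unfolding h_def by (intro Cc_cutoff continuous_on_compose2[OF clamp_cont g(1)]) auto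
  have [measurable]: "h n \<in> borel_measurable borel" for n by (rule Cc_measurable[OF Cc_h])
  have lim: "(\<lambda>n. h n x) \<longlonglongrightarrow> f x" if "x \<notin> N" for x
  proof -
    have "(\<lambda>n. h n x) \<longlonglongrightarrow> complex_of_real (cutoff R x) * clamp (f x)"
      unfolding h_def using continuous_on_tendsto_compose[OF clamp_cont g(2)[OF that]]
      by (intro tendsto_intros) auto
    also have "complex_of_real (cutoff R x) * clamp (f x) = f x"
      unfolding clamp_id using R[of x] by (cases "norm x > R") (auto simp: cutoff(3))
    finally show ?thesis .
  qed
  have h_le: "norm (h n x) \<le> M" for n x
  proof -
    have "norm (h n x) = cutoff R x * norm (clamp (g n x))"
      by (simp add: h_def norm_mult cutoff(1))
    also have "\<dots> \<le> 1 * M" using clamp_le cutoff by (intro mult_mono) auto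
    finally show ?thesis by simp
  qed
  have "(\<lambda>n. LBINT x. norm (f x - h n x) ^ p) \<longlonglongrightarrow> (\<integral>x. 0 \<partial>(lborel :: 'a measure))"
  proof (rule integral_dominated_convergence)
    show "integrable lborel (\<lambda>x. (2 * M) ^ p * indicator (cball (0::'a) (R + 1)) x :: real)"
      by (rule integrable_indicator_cball)
    show "AE x in lborel. norm (norm (f x - h n x) ^ p) \<le> (2 * M) ^ p * indicator (cball 0 (R + 1)) x" for n
    proof (rule AE_I2)
      fix x :: 'a
      show "norm (norm (f x - h n x) ^ p) \<le> (2 * M) ^ p * indicator (cball 0 (R + 1)) x"
      proof (cases "norm x \<le> R + 1")
        case True
        have "norm (f x - h n x) \<le> 2 * M"
          using norm_triangle_ineq4[of "f x" "h n x"] M[of x] h_le[of n x] by linarith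
        then have "norm (f x - h n x) ^ p \<le> (2 * M) ^ p" by (intro power_mono) auto
        then show ?thesis using True by (simp add: norm_power)
      next
        case False
        then have "f x = 0" "h n x = 0" using R[of x] by (auto simp: h_def cutoff(4))
        then show ?thesis using False by (simp add: zero_power[OF p])
      qed
    qed
    show "AE x in lborel. (\<lambda>n. norm (f x - h n x) ^ p) \<longlonglongrightarrow> 0"
      using notN by eventually_elim (intro tendsto_norm_power_diff lim p)
  qed measurable
  then have "\<forall>\<^sub>F n in sequentially. (LBINT x. norm (f x - h n x) ^ p) < e"
    using e by (intro order_tendstoD) auto
  then show ?thesis using that[OF Cc_h] by (auto simp: eventually_sequentially)
qed

text \<open>Truncating both arguments and values reduces to the bounded case; dominated convergence
  controls the truncation error.\<close>

lemma Cc_dense: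
  fixes f :: "'a::euclidean_space \<Rightarrow> complex"
  assumes [measurable]: "f \<in> borel_measurable lborel" and int: "integrable lborel (\<lambda>x. norm (f x) ^ p)"
    and p: "p > 0" and e: "e > 0"
  obtains g where "Cc g" "(LBINT x. norm (f x - g x) ^ p) < e"
proof -
  define F where "F n x = (if norm x \<le> real n \<and> norm (f x) \<le> real n then f x else 0)" for n x
  have [measurable]: "F n \<in> borel_measurable lborel" for n unfolding F_def by measurable
  have F_le: "norm (f x - F n x) ^ p \<le> norm (f x) ^ p" for n x
    using p by (auto simp: F_def)
  have "(\<lambda>n. LBINT x. norm (f x - F n x) ^ p) \<longlonglongrightarrow> (\<integral>x. 0 \<partial>(lborel :: 'a measure))"
  proof (rule integral_dominated_convergence)
    show "integrable lborel (\<lambda>x. norm (f x) ^ p)" by (rule int)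
    show "AE x in lborel. norm (norm (f x - F n x) ^ p) \<le> norm (f x) ^ p" for n
      using F_le by (simp add: norm_power)
    show "AE x in lborel. (\<lambda>n. norm (f x - F n x) ^ p) \<longlonglongrightarrow> 0"
    proof (rule AE_I2, rule tendsto_norm_power_diff[OF _ p], rule tendsto_eventually)
      fix x
      have "\<forall>\<^sub>F n in sequentially. real n \<ge> norm x \<and> real n \<ge> norm (f x)"
        by (intro eventually_conj; real_asymp)
      then show "\<forall>\<^sub>F n in sequentially. F n x = f x"
        by eventually_elim (simp add: F_def)
    qed
  qed measurable
  then have "\<forall>\<^sub>F n in sequentially. (LBINT x. norm (f x - F n x) ^ p) < e / (2 * 2 ^ p)"
    using e by (intro order_tendstoD) auto
  then obtain n where n: "(LBINT x. norm (f x - F n x) ^ p) < e / (2 * 2 ^ p)"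
    by (auto simp: eventually_sequentially)
  have F_bd: "norm (F n x) \<le> real n" and F_supp: "norm x > real n \<Longrightarrow> F n x = 0" for x by (auto simp: F_def)
  have "e / (2 * 2 ^ p) > 0" using e by simp
  from Cc_dense_bounded[of "F n" "real n" "real n", OF _ F_bd F_supp p this]
  obtain g where g: "Cc g" "(LBINT x. norm (F n x - g x) ^ p) < e / (2 * 2 ^ p)" by auto
  have [measurable]: "g \<in> borel_measurable borel" by (rule Cc_measurable[OF g(1)])
  obtain Mg where Mg: "\<And>x. norm (g x) \<le> Mg" using Cc_bounded[OF g(1)] by blast
  obtain Rg where Rg: "\<And>x. norm x > Rg \<Longrightarrow> g x = 0" using g(1) by (auto simp: Cc_def)
  have int1: "integrable lborel (\<lambda>x. norm (f x - F n x) ^ p)"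
    by (rule Bochner_Integration.integrable_bound[OF int]) (use F_le in \<open>auto simp: norm_power\<close>)
  have int2: "integrable lborel (\<lambda>x. norm (F n x - g x) ^ p)"
  proof (rule integrable_bounded_support)
    show "norm (norm (F n x - g x) ^ p) \<le> (real n + Mg) ^ p" for x
      using norm_triangle_ineq4[of "F n x" "g x"] F_bd[of x] Mg[of x]
      by (auto simp: norm_power intro!: power_mono)
    show "norm x > max (real n) Rg \<Longrightarrow> norm (F n x - g x) ^ p = 0" for x
      using F_supp[of x] Rg[of x] p by simp
  qed measurable
  have "(LBINT x. norm (f x - g x) ^ p)
      \<le> (LBINT x. 2 ^ p * (norm (f x - F n x) ^ p + norm (F n x - g x) ^ p))"
  proof (rule integral_mono_AE')
    show "integrable lborel (\<lambda>x. 2 ^ p * (norm (f x - F n x) ^ p + norm (F n x - g x) ^ p))"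
      using int1 int2 by simp
    show "AE x in lborel. norm (f x - g x) ^ p \<le> 2 ^ p * (norm (f x - F n x) ^ p + norm (F n x - g x) ^ p)"
    proof (rule AE_I2)
      fix x
      have "norm (f x - g x) ^ p \<le> (norm (f x - F n x) + norm (F n x - g x)) ^ p"
        by (intro power_mono) (auto intro: norm_triangle_sub norm_diff_triangle_ineq order_trans[OF _ norm_triangle_ineq])
      also have "\<dots> \<le> 2 ^ p * (norm (f x - F n x) ^ p + norm (F n x - g x) ^ p)"
        by (rule add_power_le) auto
      finally show "norm (f x - g x) ^ p \<le> 2 ^ p * (norm (f x - F n x) ^ p + norm (F n x - g x) ^ p)" .
    qed
  qed auto
  also have "\<dots> = 2 ^ p * ((LBINT x. norm (f x - F n x) ^ p) + (LBINT x. norm (F n x - g x) ^ p))"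
    using int1 int2 by simp
  also have "\<dots> < 2 ^ p * (e / (2 * 2 ^ p) + e / (2 * 2 ^ p))"
    using n g(2) by (intro mult_strict_left_mono add_strict_mono) auto
  also have "\<dots> = e" by (simp add: field_simps)
  finally show ?thesis using that g(1) by blast
qed

section \<open>Affine changes of variables\<close>

lemma nn_integral_lborel_affine:
  fixes f :: "'a::euclidean_space \<Rightarrow> ennreal"
  assumes [measurable]: "f \<in> borel_measurable borel" and c: "c \<noteq> 0"
  shows "(\<integral>\<^sup>+x. f x \<partial>lborel) = ennreal (\<bar>c\<bar> ^ DIM('a)) * (\<integral>\<^sup>+x. f (t + c *\<^sub>R x) \<partial>lborel)"
  by (subst lborel_affine[OF c, of t])
    (simp add: nn_integral_density nn_integral_distr nn_integral_cmult ennreal_power)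

lemma integrable_lborel_affine:
  fixes f :: "'a::euclidean_space \<Rightarrow> 'b::{banach, second_countable_topology}"
  assumes f: "integrable lborel f" and c: "c \<noteq> 0"
  shows "integrable lborel (\<lambda>x. f (t + c *\<^sub>R x))"
proof -
  have [measurable]: "f \<in> borel_measurable borel" using f by (auto dest: borel_measurable_integrable)
  have "(\<integral>\<^sup>+x. ennreal (norm (f x)) \<partial>lborel) < \<infinity>" using f by (simp add: integrable_iff_bounded)
  then have "ennreal (\<bar>c\<bar> ^ DIM('a)) * (\<integral>\<^sup>+x. ennreal (norm (f (t + c *\<^sub>R x))) \<partial>lborel) < \<infinity>"
    using nn_integral_lborel_affine[of "\<lambda>x. ennreal (norm (f x))" c t] c by simp
  then have "(\<integral>\<^sup>+x. ennreal (norm (f (t + c *\<^sub>R x))) \<partial>lborel) < \<infinity>"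
    using c by (auto simp: ennreal_mult_less_top)
  then show ?thesis by (simp add: integrable_iff_bounded)
qed

lemma integrable_lborel_affine_iff:
  fixes f :: "'a::euclidean_space \<Rightarrow> 'b::{banach, second_countable_topology}"
  assumes c: "c \<noteq> 0"
  shows "integrable lborel (\<lambda>x. f (t + c *\<^sub>R x)) \<longleftrightarrow> integrable lborel f"
  using integrable_lborel_affine[of f c t] c
    integrable_lborel_affine[of "\<lambda>x. f (t + c *\<^sub>R x)" "1 / c" "- (1 / c) *\<^sub>R t"]
  by (auto simp: algebra_simps)

text \<open>Integrability transfers in both directions under an invertible affine map, so for a
  non-integrable \<open>f\<close> both sides take the default value 0.\<close>

lemma integral_lborel_affine:
  fixes f :: "'a::euclidean_space \<Rightarrow> 'b::{banach, second_countable_topology}"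
  assumes c: "c \<noteq> 0"
  shows "(LBINT x. f x) = \<bar>c\<bar> ^ DIM('a) *\<^sub>R (LBINT x. f (t + c *\<^sub>R x))"
proof (cases "integrable lborel f")
  case True
  then have [measurable]: "f \<in> borel_measurable borel" by (auto dest: borel_measurable_integrable)
  show ?thesis
    by (subst lborel_affine[OF c, of t]) (simp add: integral_density integral_distr)
next
  case False
  then show ?thesis using c by (simp add: integrable_lborel_affine_iff not_integrable_integral_eq)
qed

text \<open>Null sets are preserved by invertible affine maps. This carries the Hermitian identity
  for \<open>a\<close>, given almost everywhere, to the points \<open>y - x\<close> with
  \<open>y\<close> fixed.\<close>

lemma AE_lborel_affine:
  fixes P :: "'a::euclidean_space \<Rightarrow> bool"
  assumes ae: "AE x in lborel. P x" and c: "c \<noteq> 0"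
  shows "AE x in lborel. P (t + c *\<^sub>R x)"
proof -
  obtain N where N: "N \<in> null_sets lborel" "{x. \<not> P x} \<subseteq> N"
    using ae by (auto simp: eventually_ae_filter)
  then have [measurable]: "N \<in> sets borel" by auto
  have "(\<integral>\<^sup>+x. indicator N (t + c *\<^sub>R x) \<partial>lborel) = (0 :: ennreal)"
    using nn_integral_lborel_affine[of "indicator N" c t] N(1) c by (auto simp: null_sets_def)
  then have "AE x in lborel. indicator N (t + c *\<^sub>R x) = (0 :: ennreal)"
    by (subst (asm) nn_integral_0_iff_AE) auto
  then show ?thesis by eventually_elim (use N(2) in \<open>auto simp: indicator_def split: if_splits\<close>)
qed

lemma nn_integral_lborel_minus_right:
  fixes f :: "'a::euclidean_space \<Rightarrow> ennreal"
  assumes "f \<in> borel_measurable borel"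
  shows "(\<integral>\<^sup>+y. f (x - y) \<partial>lborel) = (\<integral>\<^sup>+y. f y \<partial>lborel)"
  using nn_integral_lborel_affine[OF assms, of "-1" x] by simp

lemma nn_integral_lborel_minus_left:
  fixes f :: "'a::euclidean_space \<Rightarrow> ennreal"
  assumes "f \<in> borel_measurable borel"
  shows "(\<integral>\<^sup>+x. f (x - y) \<partial>lborel) = (\<integral>\<^sup>+x. f x \<partial>lborel)"
  using nn_integral_lborel_affine[OF assms, of 1 "- y"] by simp

section \<open>Convolution operators\<close>

definition conv :: "('a::euclidean_space \<Rightarrow> complex) \<Rightarrow> ('a \<Rightarrow> complex) \<Rightarrow> 'a \<Rightarrow> complex" where
  "conv a f x = (LBINT y. a (x - y) * f y)"

lemma conv_cong_AE: "AE y in lborel. f y = g y \<Longrightarrow> f \<in> borel_measurable borel \<Longrightarrow> g \<in> borel_measurable borel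
  \<Longrightarrow> a \<in> borel_measurable borel \<Longrightarrow> conv a f x = conv a g x"
  unfolding conv_def by (rule integral_cong_AE) auto

lemma measurable_conv [measurable (raw)]:
  assumes [measurable]: "a \<in> borel_measurable borel" "f \<in> borel_measurable borel"
  shows "conv a f \<in> borel_measurable borel"
proof -
  have "(\<lambda>x. LBINT y. a (x - y) * f y) \<in> borel_measurable (borel :: 'a measure)"
    by (rule lborel.borel_measurable_lebesgue_integral) measurable
  then show ?thesis by (simp add: conv_def[abs_def])
qed

text \<open>Young's inequality: splitting \<open>|a|\<close> as \<open>sqrt |a| * sqrt |a|\<close>,
  Cauchy-Schwarz bounds the square of the inner integral by the mass of \<open>|a|\<close> times the
  convolution of \<open>|a|\<close> with \<open>|f|^2\<close>; Tonelli and translation invariance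
  evaluate the outer integral. Extended non-negative integrals avoid all integrability
  conditions.\<close>

lemma young_nn_integral:
  fixes a f :: "'a::euclidean_space \<Rightarrow> complex"
  assumes [measurable]: "a \<in> borel_measurable borel" "f \<in> borel_measurable borel"
  shows "(\<integral>\<^sup>+x. (\<integral>\<^sup>+y. ennreal (cmod (a (x - y) * f y)) \<partial>lborel)\<^sup>2 \<partial>lborel)
    \<le> (\<integral>\<^sup>+x. ennreal (cmod (a x)) \<partial>lborel)\<^sup>2 * (\<integral>\<^sup>+x. ennreal ((cmod (f x))\<^sup>2) \<partial>lborel)"
proof -
  let ?k = "\<lambda>x y. ennreal (cmod (a (x - y) * f y))"
  let ?q = "\<lambda>x y. ennreal (cmod (a (x - y)) * (cmod (f y))\<^sup>2)"
  let ?s = "\<lambda>x y. ennreal (sqrt (cmod (a (x - y))))"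
  define K where "K = (\<integral>\<^sup>+x. ennreal (cmod (a x)) \<partial>lborel)"
  have inner_le: "(\<integral>\<^sup>+y. ?k x y \<partial>lborel)\<^sup>2
      \<le> K * (\<integral>\<^sup>+y. ?q x y \<partial>lborel)" for x
  proof -
    have "(\<integral>\<^sup>+y. ?k x y \<partial>lborel)
        = (\<integral>\<^sup>+y. ?s x y * ennreal (sqrt (cmod (a (x - y))) * cmod (f y)) \<partial>lborel)"
      by (intro nn_integral_cong) (simp add: norm_mult flip: ennreal_mult' mult.assoc)
    also have "\<dots>\<^sup>2 \<le> (\<integral>\<^sup>+y. (?s x y)\<^sup>2 \<partial>lborel)
        * (\<integral>\<^sup>+y. (ennreal (sqrt (cmod (a (x - y))) * cmod (f y)))\<^sup>2 \<partial>lborel)"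
      by (rule Cauchy_Schwarz_nn_integral) measurable
    also have "(\<integral>\<^sup>+y. (?s x y)\<^sup>2 \<partial>lborel) = (\<integral>\<^sup>+y. ennreal (cmod (a (x - y))) \<partial>lborel)"
      by (simp add: ennreal_power)
    also have "\<dots> = K"
      unfolding K_def by (rule nn_integral_lborel_minus_right[of "\<lambda>x. ennreal (cmod (a x))"]) measurable
    finally show ?thesis by (simp add: ennreal_power power_mult_distrib)
  qed
  have "(\<integral>\<^sup>+x. (\<integral>\<^sup>+y. ?k x y \<partial>lborel)\<^sup>2 \<partial>lborel)
      \<le> (\<integral>\<^sup>+x. K * (\<integral>\<^sup>+y. ?q x y \<partial>lborel) \<partial>lborel)"
    by (intro nn_integral_mono inner_le)
  also have "\<dots> = K * (\<integral>\<^sup>+x. \<integral>\<^sup>+y. ?q x y \<partial>lborel \<partial>lborel)"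
    by (intro nn_integral_cmult) measurable
  also have "(\<integral>\<^sup>+x. \<integral>\<^sup>+y. ?q x y \<partial>lborel \<partial>lborel)
      = (\<integral>\<^sup>+y. \<integral>\<^sup>+x. ?q x y \<partial>lborel \<partial>lborel)"
    by (rule lborel_pair.Fubini') measurable
  also have "\<dots> = (\<integral>\<^sup>+y. K * ennreal ((cmod (f y))\<^sup>2) \<partial>lborel)"
  proof (rule nn_integral_cong)
    fix y :: 'a
    have "(\<integral>\<^sup>+x. ?q x y \<partial>lborel)
        = (\<integral>\<^sup>+x. ennreal (cmod (a (x - y))) \<partial>lborel) * ennreal ((cmod (f y))\<^sup>2)"
      by (simp add: ennreal_mult' nn_integral_multc)
    also have "(\<integral>\<^sup>+x. ennreal (cmod (a (x - y))) \<partial>lborel) = K"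
      unfolding K_def by (rule nn_integral_lborel_minus_left[of "\<lambda>x. ennreal (cmod (a x))"]) measurable
    finally show "(\<integral>\<^sup>+x. ?q x y \<partial>lborel) = K * ennreal ((cmod (f y))\<^sup>2)" .
  qed
  also have "\<dots> = K * (\<integral>\<^sup>+y. ennreal ((cmod (f y))\<^sup>2) \<partial>lborel)"
    by (intro nn_integral_cmult) measurable
  finally show ?thesis by (simp add: K_def power2_eq_square mult_ac)
qed

context
  fixes a :: "'a::euclidean_space \<Rightarrow> complex"
  assumes a: "integrable lborel a"
begin

lemma conv_kernel_measurable: "a \<in> borel_measurable borel"
  using a by (auto dest: borel_measurable_integrable)

lemma young_bound:
  assumes f: "f \<in> L2 lborel"
  shows "(\<integral>\<^sup>+x. (\<integral>\<^sup>+y. ennreal (cmod (a (x - y) * f y)) \<partial>lborel)\<^sup>2 \<partial>lborel)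
    \<le> ennreal (((LBINT x. cmod (a x)) * L2_norm lborel f)\<^sup>2)"
proof -
  have [measurable]: "a \<in> borel_measurable borel" "f \<in> borel_measurable borel"
    using conv_kernel_measurable f by (auto dest: L2_measurable)
  have "(\<integral>\<^sup>+x. ennreal (cmod (a x)) \<partial>lborel) = ennreal (LBINT x. cmod (a x))"
    using a by (intro nn_integral_eq_integral) auto
  moreover have "(\<integral>\<^sup>+x. ennreal ((cmod (f x))\<^sup>2) \<partial>lborel) = ennreal ((L2_norm lborel f)\<^sup>2)"
    using L2_integrable[OF f] by (subst nn_integral_eq_integral) (auto simp: L2_norm_def integral_nonneg_AE)
  ultimately show ?thesis
    using young_nn_integral[of a f] by (simp add: power_mult_distrib ennreal_mult' ennreal_power integral_nonneg_AE)
qed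

text \<open>Bochner integrals add only where both integrands are integrable, so additivity of the
  convolution rests on this statement.\<close>

lemma conv_integrand_integrable:
  assumes f: "f \<in> L2 lborel"
  shows "AE x in lborel. integrable lborel (\<lambda>y. a (x - y) * f y)"
proof -
  let ?I = "\<lambda>x. \<integral>\<^sup>+y. ennreal (cmod (a (x - y) * f y)) \<partial>lborel"
  have [measurable]: "a \<in> borel_measurable borel" "f \<in> borel_measurable borel"
    using conv_kernel_measurable f by (auto dest: L2_measurable)
  have "(\<integral>\<^sup>+x. (?I x)\<^sup>2 \<partial>lborel) < \<infinity>"
    by (rule le_less_trans[OF young_bound[OF f]]) simp
  then have "AE x in lborel. (?I x)\<^sup>2 \<noteq> \<infinity>"
    by (intro nn_integral_PInf_AE) auto
  then show ?thesis
  proof eventually_elim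
    fix x assume "(?I x)\<^sup>2 \<noteq> \<infinity>"
    then have "?I x < \<infinity>"
      by (auto simp: power2_eq_square ennreal_mult_eq_top_iff less_top)
    then show "integrable lborel (\<lambda>y. a (x - y) * f y)" by (simp add: integrable_iff_bounded)
  qed
qed

lemma conv_bound:
  assumes f: "f \<in> L2 lborel"
  shows "(\<integral>\<^sup>+x. ennreal ((cmod (conv a f x))\<^sup>2) \<partial>lborel)
    \<le> ennreal (((LBINT x. cmod (a x)) * L2_norm lborel f)\<^sup>2)"
proof (rule order_trans[OF nn_integral_mono young_bound[OF f]])
  fix x
  \<comment> \<open>Where the integrand is not integrable the convolution is 0 by default and the
    bound is trivial.\<close>
  have "ennreal (cmod (conv a f x)) \<le> (\<integral>\<^sup>+y. ennreal (cmod (a (x - y) * f y)) \<partial>lborel)"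
  proof (cases "integrable lborel (\<lambda>y. a (x - y) * f y)")
    case True
    then show ?thesis unfolding conv_def by (rule integral_norm_bound_ennreal)
  qed (simp add: conv_def not_integrable_integral_eq)
  then show "ennreal ((cmod (conv a f x))\<^sup>2) \<le> (\<integral>\<^sup>+y. ennreal (cmod (a (x - y) * f y)) \<partial>lborel)\<^sup>2"
    by (simp add: power_mono flip: ennreal_power)
qed

lemma conv_L2:
  assumes f: "f \<in> L2 lborel"
  shows "conv a f \<in> L2 lborel"
proof -
  have [measurable]: "a \<in> borel_measurable borel" "f \<in> borel_measurable borel"
    using conv_kernel_measurable f by (auto dest: L2_measurable)
  have "(\<integral>\<^sup>+x. ennreal ((cmod (conv a f x))\<^sup>2) \<partial>lborel) < \<infinity>"
    by (rule le_less_trans[OF conv_bound[OF f]]) simp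
  then have "integrable lborel (\<lambda>x. (cmod (conv a f x))\<^sup>2)"
    by (intro integrableI_nonneg) auto
  then show ?thesis by (simp add: L2_def)
qed

lemma l2_operator_conv: "l2_operator (conv a)"
proof
  fix f g :: "'a \<Rightarrow> complex" assume "f \<in> L2 lborel" "g \<in> L2 lborel" "AE x in lborel. f x = g x"
  then have "conv a f x = conv a g x" for x
    by (intro conv_cong_AE conv_kernel_measurable) (auto dest: L2_measurable)
  then show "AE x in lborel. conv a f x = conv a g x" by simp
qed (rule conv_L2)

lemma conv_add:
  assumes "f \<in> L2 lborel" "g \<in> L2 lborel"
  shows "AE x in lborel. conv a (\<lambda>x. f x + g x) x = conv a f x + conv a g x"
  using conv_integrand_integrable[OF assms(1)] conv_integrand_integrable[OF assms(2)]
  by eventually_elim (simp add: conv_def distrib_left)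

end

lemma conv_cmult: "conv a (\<lambda>x. c * f x) x = c * conv a f x"
  by (simp add: conv_def mult.left_commute)

section \<open>Convolution as a bounded symmetric operator on classes\<close>

abbreviation conv_op :: "('a::euclidean_space \<Rightarrow> complex) \<Rightarrow> 'a l2 \<Rightarrow> 'a l2" where
  "conv_op a \<equiv> l2_lift (conv a)"

lemma norm_conv_op_le:
  assumes a: "integrable lborel a"
  shows "norm (conv_op a u) \<le> (LBINT x. cmod (a x)) * norm u"
proof -
  have "ennreal ((norm (conv_op a u))\<^sup>2) = (\<integral>\<^sup>+x. ennreal ((cmod (l2_fun (conv_op a u) x))\<^sup>2) \<partial>lborel)"
    by (rule nn_integral_l2_fun[symmetric])
  also have "\<dots> = (\<integral>\<^sup>+x. ennreal ((cmod (conv a (l2_fun u) x))\<^sup>2) \<partial>lborel)"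
    by (rule nn_integral_cong_AE)
      (use l2_operator.l2_fun_lift[OF l2_operator_conv[OF a], of u] in eventually_elim, simp)
  also have "\<dots> \<le> ennreal (((LBINT x. cmod (a x)) * norm u)\<^sup>2)"
    unfolding norm_l2_eq by (rule conv_bound[OF a l2_fun_L2])
  finally show ?thesis
    by (auto intro!: power2_le_imp_le mult_nonneg_nonneg integral_nonneg_AE)
qed

lemma bounded_linear_conv_op:
  assumes a: "integrable lborel a"
  shows "bounded_linear (conv_op a)"
proof (rule bounded_linear_intro)
  interpret l2_operator "conv a" by (rule l2_operator_conv[OF a])
  have [measurable]: "a \<in> borel_measurable borel" by (rule conv_kernel_measurable[OF a])
  fix u v :: "'a l2" and r :: real
  have "conv_op a (u + v) = l2_abs (conv a (\<lambda>x. l2_fun u x + l2_fun v x))"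
    unfolding plus_l2_def by (intro l2_lift_abs L2_add l2_fun_L2)
  also have "\<dots> = l2_abs (\<lambda>x. conv a (l2_fun u) x + conv a (l2_fun v) x)"
    using conv_add[OF a l2_fun_L2 l2_fun_L2]
    by (subst l2_abs_eq_iff) (auto intro!: L2_add maps_L2)
  also have "\<dots> = conv_op a u + conv_op a v"
    by (simp add: l2_abs_add maps_L2 l2_lift_def)
  finally show "conv_op a (u + v) = conv_op a u + conv_op a v" .
  have "conv_op a (r *\<^sub>R u) = l2_abs (conv a (\<lambda>x. complex_of_real r * l2_fun u x))"
    unfolding scaleR_l2_def by (intro l2_lift_abs L2_cmult l2_fun_L2)
  also have "conv a (\<lambda>x. complex_of_real r * l2_fun u x) = (\<lambda>x. complex_of_real r * conv a (l2_fun u) x)"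
    by (rule ext) (rule conv_cmult)
  also have "l2_abs \<dots> = r *\<^sub>R conv_op a u"
    by (simp add: l2_abs_scaleR maps_L2 l2_lift_def)
  finally show "conv_op a (r *\<^sub>R u) = r *\<^sub>R conv_op a u" .
  show "norm (conv_op a u) \<le> norm u * (LBINT x. cmod (a x))"
    using norm_conv_op_le[OF a] by (simp add: mult.commute)
qed

lemma conv_op_diff_kernel:
  assumes a: "integrable lborel a" and b: "integrable lborel b"
  shows "conv_op (\<lambda>x. a x - b x) u = conv_op a u - conv_op b u"
proof (rule l2_eqI)
  have ab: "integrable lborel (\<lambda>x. a x - b x)" using a b by simp
  show "AE x in lborel. l2_fun (conv_op (\<lambda>x. a x - b x) u) x = l2_fun (conv_op a u - conv_op b u) x"
    using l2_fun_diff[of "conv_op a u" "conv_op b u"] l2_operator.l2_fun_lift[OF l2_operator_conv[OF a], of u]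
      l2_operator.l2_fun_lift[OF l2_operator_conv[OF b], of u] l2_operator.l2_fun_lift[OF l2_operator_conv[OF ab], of u]
      conv_integrand_integrable[OF a l2_fun_L2, of u] conv_integrand_integrable[OF b l2_fun_L2, of u]
    by eventually_elim (simp add: conv_def left_diff_distrib)
qed

text \<open>The bound \<open>|f(y)| |g(x)| \<le> |f(y)|^2 + |g(x)|^2\<close> separates the
  variables, after which translation invariance pulls out the mass of \<open>a\<close>. It licenses
  the exchange of integrals in the sesquilinear form.\<close>

lemma conv_form_integrable:
  fixes a :: "'a::euclidean_space \<Rightarrow> complex"
  assumes a: "integrable lborel a" and f: "f \<in> L2 lborel" and g: "g \<in> L2 lborel"
  shows "integrable (lborel \<Otimes>\<^sub>M lborel) (\<lambda>(x, y). a (x - y) * f y * cnj (g x))"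
proof -
  let ?f = "\<lambda>x y. ennreal (cmod (a (x - y))) * ennreal ((cmod (f y))\<^sup>2)"
  let ?g = "\<lambda>x y. ennreal (cmod (a (x - y))) * ennreal ((cmod (g x))\<^sup>2)"
  have [measurable]: "a \<in> borel_measurable borel" "f \<in> borel_measurable borel" "g \<in> borel_measurable borel"
    using conv_kernel_measurable[OF a] f g by (auto dest: L2_measurable)
  define K where "K = (\<integral>\<^sup>+x. ennreal (cmod (a x)) \<partial>lborel)"
  have K: "K < \<infinity>" using a by (simp add: K_def integrable_iff_bounded)
  have sq: "(\<integral>\<^sup>+x. ennreal ((cmod (h x))\<^sup>2) \<partial>lborel) < \<infinity>" if "h \<in> L2 lborel" for h :: "'a \<Rightarrow> complex"
    using L2_integrable[OF that] by (simp add: integrable_iff_bounded)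
  have "(\<integral>\<^sup>+z. ennreal (norm (case z of (x, y) \<Rightarrow> a (x - y) * f y * cnj (g x))) \<partial>(lborel \<Otimes>\<^sub>M lborel))
      = (\<integral>\<^sup>+x. \<integral>\<^sup>+y. ennreal (cmod (a (x - y) * f y * cnj (g x))) \<partial>lborel \<partial>lborel)"
    by (subst lborel.nn_integral_fst[symmetric]) auto
  also have "\<dots> \<le> (\<integral>\<^sup>+x. \<integral>\<^sup>+y. (?f x y
      + ?g x y) \<partial>lborel \<partial>lborel)"
  proof (intro nn_integral_mono)
    fix x y
    have "cmod (f y) * cmod (g x) \<le> (cmod (f y))\<^sup>2 + (cmod (g x))\<^sup>2"
      using sum_squares_bound[of "cmod (f y)" "cmod (g x)"]
        mult_nonneg_nonneg[OF norm_ge_zero[of "f y"] norm_ge_zero[of "g x"]] by linarith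
    then have "cmod (a (x - y) * f y * cnj (g x)) \<le> cmod (a (x - y)) * (cmod (f y))\<^sup>2 + cmod (a (x - y)) * (cmod (g x))\<^sup>2"
      by (simp add: norm_mult mult.assoc mult_left_mono flip: distrib_left)
    then show "ennreal (cmod (a (x - y) * f y * cnj (g x)))
      \<le> ?f x y + ?g x y"
      by (simp add: ennreal_leI flip: ennreal_mult' ennreal_plus)
  qed
  also have "\<dots> = (\<integral>\<^sup>+x. \<integral>\<^sup>+y. ?f x y \<partial>lborel \<partial>lborel)
      + (\<integral>\<^sup>+x. \<integral>\<^sup>+y. ?g x y \<partial>lborel \<partial>lborel)"
    by (subst nn_integral_add[symmetric]) (auto simp: nn_integral_add)
  also have "(\<integral>\<^sup>+x. \<integral>\<^sup>+y. ?f x y \<partial>lborel \<partial>lborel)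
      = (\<integral>\<^sup>+y. \<integral>\<^sup>+x. ?f x y \<partial>lborel \<partial>lborel)"
    by (rule lborel_pair.Fubini') measurable
  also have "\<dots> = K * (\<integral>\<^sup>+y. ennreal ((cmod (f y))\<^sup>2) \<partial>lborel)"
    unfolding K_def
    by (simp add: nn_integral_multc nn_integral_cmult nn_integral_lborel_minus_left[of "\<lambda>x. ennreal (cmod (a x))"])
  also have "(\<integral>\<^sup>+x. \<integral>\<^sup>+y. ?g x y \<partial>lborel \<partial>lborel)
      = K * (\<integral>\<^sup>+x. ennreal ((cmod (g x))\<^sup>2) \<partial>lborel)"
    unfolding K_def
    by (simp add: nn_integral_multc nn_integral_cmult nn_integral_lborel_minus_right[of "\<lambda>x. ennreal (cmod (a x))"])
  also have "K * (\<integral>\<^sup>+y. ennreal ((cmod (f y))\<^sup>2) \<partial>lborel) + K * (\<integral>\<^sup>+x. ennreal ((cmod (g x))\<^sup>2) \<partial>lborel) < \<infinity>"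
    using K sq[OF f] sq[OF g] by (simp add: ennreal_mult_less_top)
  finally show ?thesis by (simp add: integrable_iff_bounded)
qed

lemma inner_conv_op:
  assumes a: "integrable lborel a" and f: "f \<in> L2 lborel" and g: "g \<in> L2 lborel"
  shows "inner (conv_op a (l2_abs f)) (l2_abs g)
    = Re (LBINT x. LBINT y. a (x - y) * f y * cnj (g x))"
proof -
  have "inner (conv_op a (l2_abs f)) (l2_abs g) = (LBINT x. Re (conv a f x * cnj (g x)))"
    by (simp add: l2_operator.l2_lift_abs[OF l2_operator_conv[OF a] f] inner_l2_abs conv_L2[OF a f] g)
  also have "\<dots> = Re (LBINT x. conv a f x * cnj (g x))"
    by (rule integral_Re[OF L2_integrable_mult_cnj[OF conv_L2[OF a f] g]])
  also have "(LBINT x. conv a f x * cnj (g x)) = (LBINT x. LBINT y. a (x - y) * f y * cnj (g x))"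
    by (simp add: conv_def)
  finally show ?thesis .
qed

text \<open>After exchanging the integrals, \<open>a(x - y) = cnj (a(y - x))\<close> turns the
  double integral into the conjugate of the one with \<open>f\<close> and \<open>g\<close> swapped;
  the real part ignores the conjugation.\<close>

lemma conv_op_symmetric:
  assumes a: "integrable lborel a" and herm: "AE x in lborel. a (- x) = cnj (a x)"
  shows "inner (conv_op a u) v = inner u (conv_op a v)"
proof -
  define f where "f = l2_fun u"
  define g where "g = l2_fun v"
  have fg: "f \<in> L2 lborel" "g \<in> L2 lborel" by (simp_all add: f_def g_def)
  have uv: "u = l2_abs f" "v = l2_abs g" by (simp_all add: f_def g_def)
  have [measurable]: "a \<in> borel_measurable borel" "f \<in> borel_measurable borel" "g \<in> borel_measurable borel"
    using conv_kernel_measurable[OF a] fg by (auto dest: L2_measurable)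
  have "inner (conv_op a u) v = Re (LBINT x. LBINT y. a (x - y) * f y * cnj (g x))"
    unfolding uv by (rule inner_conv_op[OF a fg])
  also have "(LBINT x. LBINT y. a (x - y) * f y * cnj (g x))
      = (LBINT y. LBINT x. a (x - y) * f y * cnj (g x))"
    using conv_form_integrable[OF a fg] by (rule lborel_pair.Fubini_integral[symmetric])
  also have "\<dots> = (LBINT y. LBINT x. cnj (a (y - x) * g x * cnj (f y)))"
  proof (rule Bochner_Integration.integral_cong[OF refl], rule integral_cong_AE)
    fix y
    have "AE x in lborel. a (- (y + (-1) *\<^sub>R x)) = cnj (a (y + (-1) *\<^sub>R x))"
      by (rule AE_lborel_affine[OF herm]) simp
    then show "AE x in lborel. a (x - y) * f y * cnj (g x) = cnj (a (y - x) * g x * cnj (f y))"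
      by eventually_elim simp
  qed measurable
  also have "\<dots> = cnj (LBINT y. LBINT x. a (y - x) * g x * cnj (f y))"
    by (simp only: Bochner_Integration.integral_cnj)
  also have "Re \<dots> = inner (conv_op a v) u"
    unfolding uv inner_conv_op[OF a fg(2,1)] by simp
  finally show ?thesis by (simp add: inner_commute)
qed

section \<open>Compactness of a convolution after a multiplication\<close>

text \<open>Total boundedness, rather than compactness of the closure, because it passes directly to
  uniform limits on the unit ball.\<close>

definition precompact_op :: "('a::real_normed_vector \<Rightarrow> 'b::metric_space) \<Rightarrow> bool" where
  "precompact_op S \<longleftrightarrow> (\<forall>e>0. \<exists>K. finite K \<and> S ` cball 0 1 \<subseteq> (\<Union>x\<in>K. ball x e))"

lemma precompact_op_approx:
  assumes "\<And>e. e > 0 \<Longrightarrow> \<exists>S'. precompact_op S' \<and> (\<forall>u\<in>cball 0 1. dist (S u) (S' u) < e)"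
  shows "precompact_op S"
  unfolding precompact_op_def
proof (intro allI impI)
  let ?C = "S ` cball 0 1"
  fix e :: real assume "e > 0"
  then have e2: "e / 2 > 0" by simp
  obtain S' where S': "precompact_op S'" "\<And>u. u \<in> cball 0 1 \<Longrightarrow> dist (S u) (S' u) < e / 2"
    using assms[OF e2] by blast
  obtain K where K: "finite K" "S' ` cball 0 1 \<subseteq> (\<Union>x\<in>K. ball x (e / 2))"
    using S'(1) e2 unfolding precompact_op_def by blast
  have "?C \<subseteq> (\<Union>x\<in>K. ball x e)"
  proof
    fix y assume "y \<in> ?C"
    then obtain u where u: "u \<in> cball 0 1" "y = S u" by blast
    then obtain x where x: "x \<in> K" "dist x (S' u) < e / 2" using K(2) by fastforce
    have "dist x y \<le> dist x (S' u) + dist (S u) (S' u)" unfolding u(2) by (metis dist_triangle2)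
    then have "dist x y < e" using x(2) S'(2)[OF u(1)] by simp
    then show "y \<in> (\<Union>x\<in>K. ball x e)" using x(1) by auto
  qed
  then show "\<exists>K. finite K \<and> ?C \<subseteq> (\<Union>x\<in>K. ball x e)" using K(1) by blast
qed

lemma precompact_op_convergent_subseq:
  fixes S :: "'a::real_normed_vector \<Rightarrow> 'b::complete_space"
  assumes S: "precompact_op S" and x: "\<And>n. norm (x n) \<le> 1"
  obtains l r where "strict_mono (r :: nat \<Rightarrow> nat)" "(\<lambda>n. S (x (r n))) \<longlonglongrightarrow> l"
proof -
  let ?C = "S ` cball 0 1"
  have "compact (closure ?C)"
    unfolding compact_eq_totally_bounded
  proof (intro conjI allI impI)
    show "complete (closure ?C)" by (simp add: complete_eq_closed)
    fix e :: real assume e: "e > 0"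
    then obtain K where K: "finite K" "?C \<subseteq> (\<Union>x\<in>K. ball x (e / 2))"
      using S half_gt_zero[OF e] unfolding precompact_op_def by blast
    have "closure ?C \<subseteq> (\<Union>x\<in>K. cball x (e / 2))"
    proof (rule closure_minimal)
      show "?C \<subseteq> (\<Union>x\<in>K. cball x (e / 2))"
        by (rule order_trans[OF K(2)]) (intro UN_mono order_refl ball_subset_cball)
    qed (use K(1) in auto)
    also have "\<dots> \<subseteq> (\<Union>x\<in>K. ball x e)" using e by fastforce
    finally show "\<exists>k. finite k \<and> closure ?C \<subseteq> (\<Union>x\<in>k. ball x e)"
      using K(1) by blast
  qed
  moreover have "\<forall>n. S (x n) \<in> closure ?C"
    using x by (auto intro!: subsetD[OF closure_subset])
  ultimately have "\<exists>l\<in>closure ?C. \<exists>r. strict_mono (r :: nat \<Rightarrow> nat) \<and> ((\<lambda>n. S (x n)) \<circ> r) \<longlonglongrightarrow> l"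
    unfolding compact_def by (elim allE[of _ "\<lambda>n. S (x n)"] mp)
  then obtain l r where "strict_mono (r :: nat \<Rightarrow> nat)" "((\<lambda>n. S (x n)) \<circ> r) \<longlonglongrightarrow> l"
    by blast
  then show ?thesis using that by (simp add: o_def)
qed

text \<open>Points of the closure are replaced by image points within \<open>1 / (n + 1)\<close>, so
  a limit of the latter is a limit of the former; sequential compactness of the closure then implies
  total boundedness.\<close>

lemma precompact_opI_Cauchy_subseq:
  fixes S :: "'a::real_normed_vector \<Rightarrow> 'b::complete_space"
  assumes "\<And>x. (\<And>n. norm (x n) \<le> 1) \<Longrightarrow> \<exists>r. strict_mono (r :: nat \<Rightarrow> nat) \<and> Cauchy (\<lambda>n. S (x (r n)))"
  shows "precompact_op S"
proof -
  let ?C = "S ` cball 0 1"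
  have "seq_compact (closure ?C)"
    unfolding seq_compact_def
  proof (intro allI impI)
    fix y :: "nat \<Rightarrow> 'b" assume y: "\<forall>n. y n \<in> closure ?C"
    have "\<exists>u. norm u \<le> 1 \<and> dist (S u) (y n) < 1 / Suc n" for n
    proof -
      have "0 < 1 / real (Suc n)" by simp
      then obtain z where z: "z \<in> ?C" "dist z (y n) < 1 / Suc n"
        using y[rule_format, of n] unfolding closure_approachable by blast
      from z(1) obtain u where "u \<in> cball 0 1" "z = S u" by blast
      then show ?thesis using z(2) by (intro exI[of _ u]) simp
    qed
    then obtain x where x: "\<And>n. norm (x n) \<le> 1" "\<And>n. dist (S (x n)) (y n) < 1 / Suc n" by metis
    obtain r where r: "strict_mono (r :: nat \<Rightarrow> nat)" "Cauchy (\<lambda>n. S (x (r n)))"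
    proof -
      have "\<exists>r. strict_mono (r :: nat \<Rightarrow> nat) \<and> Cauchy (\<lambda>n. S (x (r n)))"
        by (rule assms) (rule x(1))
      then show ?thesis using that by (elim exE conjE)
    qed
    obtain l where l: "(\<lambda>n. S (x (r n))) \<longlonglongrightarrow> l" using Cauchy_convergent[OF r(2)] by (auto simp: convergent_def)
    have "(\<lambda>n. dist (y (r n)) l) \<longlonglongrightarrow> 0"
    proof (rule Lim_null_comparison)
      have "norm (dist (y (r n)) l) \<le> 1 / Suc (r n) + dist (S (x (r n))) l" for n
        using dist_triangle3[of "y (r n)" l "S (x (r n))"] x(2)[of "r n"] by simp
      then show "\<forall>\<^sub>F n in sequentially. norm (dist (y (r n)) l) \<le> 1 / Suc (r n) + dist (S (x (r n))) l"
        by (intro always_eventually) blast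
      have "(\<lambda>n. 1 / real (Suc (r n))) \<longlonglongrightarrow> 0"
        using LIMSEQ_subseq_LIMSEQ[OF LIMSEQ_one_over_Suc r(1)] by (simp add: o_def)
      moreover have "(\<lambda>n. dist (S (x (r n))) l) \<longlonglongrightarrow> 0"
        by (rule iffD1[OF tendsto_dist_iff l])
      ultimately show "(\<lambda>n. 1 / real (Suc (r n)) + dist (S (x (r n))) l) \<longlonglongrightarrow> 0"
        using tendsto_add by fastforce
    qed
    then have yl: "(\<lambda>n. y (r n)) \<longlonglongrightarrow> l" by (rule iffD2[OF tendsto_dist_iff])
    have "l \<in> closure ?C"
      by (rule Lim_in_closed_set[OF closed_closure _ _ yl]) (use y in auto)
    then show "\<exists>l\<in>closure ?C. \<exists>r. strict_mono r \<and> (y \<circ> r) \<longlonglongrightarrow> l"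
      using r(1) yl by (auto simp: o_def)
  qed
  from seq_compact_imp_totally_bounded[OF this] show ?thesis
    unfolding precompact_op_def by (meson closure_subset order_trans)
qed

text \<open>On a fixed ball the supremum norm controls the \<open>L^2\<close> norm; this converts
  the uniform convergence given by Arzela-Ascoli into convergence of classes.\<close>

lemma norm_l2_le_of_bounded_support:
  fixes f :: "'a::euclidean_space \<Rightarrow> complex"
  assumes f: "f \<in> L2 lborel" and M: "\<And>x. x \<in> cball 0 R \<Longrightarrow> cmod (f x) \<le> M" and R: "\<And>x. x \<notin> cball 0 R \<Longrightarrow> f x = 0"
    and "M \<ge> 0"
  shows "norm (l2_abs f) \<le> M * sqrt (measure lborel (cball (0::'a) R))"
proof -
  have int: "integrable lborel (\<lambda>x. M\<^sup>2 * indicator (cball (0::'a) R) x :: real)"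
    by (rule integrable_indicator_cball)
  have "(norm (l2_abs f))\<^sup>2 = (LBINT x. (cmod (f x))\<^sup>2)"
    by (simp add: norm_l2_abs f L2_norm_def integral_nonneg_AE)
  also have "\<dots> \<le> (LBINT x. M\<^sup>2 * indicator (cball (0::'a) R) x)"
  proof (rule Bochner_Integration.integral_mono[OF L2_integrable[OF f] int])
    fix x
    show "(cmod (f x))\<^sup>2 \<le> M\<^sup>2 * indicator (cball 0 R) x"
      using M[of x] R[of x] by (cases "x \<in> cball 0 R") (auto intro: power_mono)
  qed
  also have "\<dots> = M\<^sup>2 * measure lborel (cball (0::'a) R)" by simp
  also have "\<dots> = (M * sqrt (measure lborel (cball (0::'a) R)))\<^sup>2" by (simp add: power_mult_distrib)
  finally show ?thesis using \<open>M \<ge> 0\<close> by (auto intro: power2_le_imp_le)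
qed

text \<open>The functions \<open>V * x n\<close> are bounded in \<open>L^1\<close> and vanish
  outside a fixed ball. Convolution with a uniformly continuous kernel of compact support makes them
  uniformly bounded, equicontinuous and supported in one ball, so Arzela-Ascoli applies.\<close>

lemma precompact_conv_mult_Cc:
  fixes a V :: "'a::euclidean_space \<Rightarrow> complex"
  assumes a: "Cc a" and V: "Cc V"
  shows "precompact_op (\<lambda>u. conv_op a (mult_op V u))"
proof (rule precompact_opI_Cauchy_subseq)
  fix x :: "nat \<Rightarrow> 'a l2" assume x: "\<And>n. norm (x n) \<le> 1"
  have [measurable]: "a \<in> borel_measurable borel" "V \<in> borel_measurable borel"
    using a V by (auto dest: Cc_measurable)
  obtain Ma where Ma: "Ma > 0" "\<And>x. cmod (a x) \<le> Ma" using Cc_bounded[OF a] by blast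
  obtain MV where MV: "\<And>x. cmod (V x) \<le> MV" using Cc_bounded[OF V] by blast
  obtain Ra where Ra: "\<And>x. norm x > Ra \<Longrightarrow> a x = 0" using a by (auto simp: Cc_def)
  obtain RV where RV: "\<And>x. norm x > RV \<Longrightarrow> V x = 0" using V by (auto simp: Cc_def)
  define R where "R = Ra + RV"
  define w where "w n y = V y * l2_fun (x n) y" for n y
  have wL2: "w n \<in> L2 lborel" for n
    unfolding w_def by (rule L2_bounded_mult[OF l2_fun_L2 _ MV]) measurable
  have [measurable]: "w n \<in> borel_measurable borel" for n
    using L2_measurable[OF wL2] by simp
  \<comment> \<open>Bounds the \<open>L^1\<close> norm of \<open>w n\<close> through
    \<open>|V| |x| \<le> |V|^2 + |x|^2\<close> and \<open>norm (x n) \<le> 1\<close>.\<close>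
  define M where "M = (LBINT y. (cmod (V y))\<^sup>2) + 1"
  have "0 \<le> (LBINT y. (cmod (V y))\<^sup>2)" by (rule integral_nonneg_AE) auto
  then have "M > 0" unfolding M_def by linarith
  have w_int: "integrable lborel (w n)" and w_norm: "(LBINT y. cmod (w n y)) \<le> M" for n
  proof -
    have V2: "integrable lborel (\<lambda>y. (cmod (V y))\<^sup>2)" by (rule Cc_integrable_power[OF V]) simp
    have x2: "integrable lborel (\<lambda>y. (cmod (l2_fun (x n) y))\<^sup>2)" by (rule L2_integrable[OF l2_fun_L2])
    have le: "cmod (w n y) \<le> (cmod (V y))\<^sup>2 + (cmod (l2_fun (x n) y))\<^sup>2" for y
      using sum_squares_bound[of "cmod (V y)" "cmod (l2_fun (x n) y)"]
        mult_nonneg_nonneg[OF norm_ge_zero[of "V y"] norm_ge_zero[of "l2_fun (x n) y"]]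
      unfolding w_def norm_mult by linarith
    have int: "integrable lborel (\<lambda>y. cmod (w n y))"
      by (rule Bochner_Integration.integrable_bound[OF Bochner_Integration.integrable_add[OF V2 x2]])
        (use le in \<open>auto intro!: order_trans[OF _ abs_ge_self]\<close>)
    then show "integrable lborel (w n)" by (simp add: integrable_norm_iff)
    have "(LBINT y. cmod (w n y)) \<le> (LBINT y. (cmod (V y))\<^sup>2 + (cmod (l2_fun (x n) y))\<^sup>2)"
      by (intro Bochner_Integration.integral_mono int Bochner_Integration.integrable_add V2 x2 le)
    also have "\<dots> = (LBINT y. (cmod (V y))\<^sup>2) + (norm (x n))\<^sup>2"
      using V2 x2 by (simp add: norm_l2_eq L2_norm_def integral_nonneg_AE)
    also have "\<dots> \<le> M" using x[of n] by (simp add: M_def power_le_one)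
    finally show "(LBINT y. cmod (w n y)) \<le> M" .
  qed
  define F where "F n = conv a (w n)" for n
  have FL2: "F n \<in> L2 lborel" for n unfolding F_def by (rule conv_L2[OF Cc_integrable[OF a] wL2])
  have int_aw: "integrable lborel (\<lambda>y. a (p - y) * w n y)" for p n
  proof (rule Bochner_Integration.integrable_bound)
    show "integrable lborel (\<lambda>y. Ma * cmod (w n y))" using w_int by simp
    show "AE y in lborel. norm (a (p - y) * w n y) \<le> norm (Ma * cmod (w n y))"
      using Ma by (auto simp: norm_mult abs_mult intro!: mult_right_mono)
  qed measurable
  have F_diff: "cmod (F n p - F n q) \<le> e * M" if "\<And>y. cmod (a (p - y) - a (q - y)) \<le> e" for n p q e
  proof -
    have "0 \<le> e" using that[of 0] norm_ge_zero order_trans by blast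
    have "F n p - F n q = (LBINT y. (a (p - y) - a (q - y)) * w n y)"
      unfolding F_def conv_def left_diff_distrib
      by (rule Bochner_Integration.integral_diff[OF int_aw int_aw, symmetric])
    also have "cmod \<dots> \<le> (LBINT y. e * cmod (w n y))"
    proof (rule Bochner_Integration.integral_norm_bound_integral)
      show "integrable lborel (\<lambda>y. (a (p - y) - a (q - y)) * w n y)"
        unfolding left_diff_distrib by (rule Bochner_Integration.integrable_diff[OF int_aw int_aw])
      show "integrable lborel (\<lambda>y. e * cmod (w n y))" using w_int by simp
      show "norm ((a (p - y) - a (q - y)) * w n y) \<le> e * cmod (w n y)" for y
        using that by (simp add: norm_mult mult_right_mono)
    qed
    also have "\<dots> \<le> e * M" using w_norm \<open>0 \<le> e\<close> by (simp add: mult_left_mono)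
    finally show ?thesis .
  qed
  have F_supp: "F n p = 0" if "p \<notin> cball 0 R" for n p
  proof -
    have "a (p - y) * w n y = 0" for y
    proof (cases "norm y > RV")
      case False
      then have "norm (p - y) > Ra" using that norm_triangle_sub[of p y] by (simp add: R_def)
      then show ?thesis by (simp add: Ra)
    qed (simp add: RV w_def)
    then show ?thesis by (simp only: F_def conv_def Bochner_Integration.integral_zero)
  qed
  obtain g k where gk: "strict_mono (k :: nat \<Rightarrow> nat)"
    "\<And>e. 0 < e \<Longrightarrow> \<exists>N. \<forall>n p. n \<ge> N \<and> p \<in> cball 0 R \<longrightarrow> cmod (F (k n) p - g p) < e"
  proof (rule Arzela_Ascoli[of "cball 0 R" F "Ma * M"])
    show "compact (cball (0::'a) R)" by simp
    show "cmod (F n p) \<le> Ma * M" if "p \<in> cball 0 R" for n p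
    proof -
      have "cmod (F n p) \<le> (LBINT y. Ma * cmod (w n y))"
        unfolding F_def conv_def
      proof (rule Bochner_Integration.integral_norm_bound_integral[OF int_aw])
        show "integrable lborel (\<lambda>y. Ma * cmod (w n y))" using w_int by simp
        show "norm (a (p - y) * w n y) \<le> Ma * cmod (w n y)" for y
          using Ma by (simp add: norm_mult mult_right_mono)
      qed
      also have "\<dots> \<le> Ma * M" using w_norm Ma(1) by simp
      finally show ?thesis .
    qed
    show "\<exists>d. 0 < d \<and> (\<forall>n q. q \<in> cball 0 R \<and> norm (p - q) < d \<longrightarrow> cmod (F n p - F n q) < e)"
      if "p \<in> cball 0 R" "0 < e" for p e
    proof -
      have "e / (2 * M) > 0" using \<open>e > 0\<close> \<open>M > 0\<close> by simp
      then obtain d where d: "d > 0" "\<And>x y. norm (x - y) < d \<Longrightarrow> norm (a x - a y) < e / (2 * M)"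
        using Cc_uniformly_continuous[OF a] by metis
      have "cmod (F n p - F n q) < e" if "norm (p - q) < d" for n q
      proof -
        have "cmod (a (p - y) - a (q - y)) \<le> e / (2 * M)" for y
          using d(2)[of "p - y" "q - y"] that by simp
        then have "cmod (F n p - F n q) \<le> e / (2 * M) * M" by (rule F_diff)
        also have "\<dots> < e" using \<open>e > 0\<close> \<open>M > 0\<close> by simp
        finally show ?thesis .
      qed
      then show ?thesis using d(1) by blast
    qed
  qed blast
  have eq: "conv_op a (mult_op V (x n)) = l2_abs (F n)" for n
    unfolding mult_op_def F_def w_def[symmetric]
    by (rule l2_operator.l2_lift_abs[OF l2_operator_conv[OF Cc_integrable[OF a]] wL2])
  \<comment> \<open>The added 1 keeps \<nu> positive even if the ball is empty or a point.\<close>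
  define \<nu> where "\<nu> = sqrt (measure lborel (cball (0::'a) R)) + 1"
  have "\<nu> > 0" by (simp add: \<nu>_def add_nonneg_pos)
  have "Cauchy (\<lambda>n. conv_op a (mult_op V (x (k n))))"
    unfolding eq Cauchy_iff
  proof (intro allI impI)
    fix e :: real assume "e > 0"
    then have "e / (4 * \<nu>) > 0" using \<open>\<nu> > 0\<close> by simp
    then obtain N where N: "\<And>n p. n \<ge> N \<Longrightarrow> p \<in> cball 0 R \<Longrightarrow> cmod (F (k n) p - g p) < e / (4 * \<nu>)"
      using gk(2) by blast
    have "norm (l2_abs (F (k m)) - l2_abs (F (k n))) < e" if mn: "m \<ge> N" "n \<ge> N" for m n
    proof -
      have "norm (l2_abs (F (k m)) - l2_abs (F (k n))) = norm (l2_abs (\<lambda>p. F (k m) p - F (k n) p))"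
        by (simp add: l2_abs_diff FL2)
      also have "\<dots> \<le> (e / (2 * \<nu>)) * sqrt (measure lborel (cball (0::'a) R))"
      proof (rule norm_l2_le_of_bounded_support)
        show "(\<lambda>p. F (k m) p - F (k n) p) \<in> L2 lborel" by (intro L2_diff FL2)
        show "cmod (F (k m) p - F (k n) p) \<le> e / (2 * \<nu>)" if "p \<in> cball 0 R" for p
          using norm_diff_triangle_less[OF N[OF mn(1) that], of "F (k n) p" "e / (4 * \<nu>)"] N[OF mn(2) that]
          by (simp add: norm_minus_commute)
        show "F (k m) p - F (k n) p = 0" if "p \<notin> cball 0 R" for p by (simp only: F_supp[OF that] diff_self)
        show "0 \<le> e / (2 * \<nu>)" using \<open>e > 0\<close> \<open>\<nu> > 0\<close> by simp
      qed
      also have "\<dots> \<le> (e / (2 * \<nu>)) * \<nu>"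
        using \<open>e > 0\<close> \<open>\<nu> > 0\<close> by (intro mult_left_mono) (auto simp: \<nu>_def)
      also have "\<dots> < e" using \<open>e > 0\<close> \<open>\<nu> > 0\<close> by simp
      finally show ?thesis .
    qed
    then show "\<exists>N. \<forall>m\<ge>N. \<forall>n\<ge>N. norm (l2_abs (F (k m)) - l2_abs (F (k n))) < e" by blast
  qed
  then show "\<exists>r. strict_mono (r :: nat \<Rightarrow> nat) \<and> Cauchy (\<lambda>n. conv_op a (mult_op V (x (r n))))"
    using gk(1) by blast
qed

text \<open>With \<open>b\<close> close to \<open>a\<close> in \<open>L^1\<close> and
  \<open>W\<close> a cut-off of \<open>V\<close>, the error is convolution with \<open>a - b\<close>
  after \<open>V\<close> plus convolution with \<open>b\<close> after \<open>V - W\<close>. The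
  decay of \<open>V\<close> makes the second term small in operator norm.\<close>

lemma precompact_conv_mult:
  fixes a V :: "'a::euclidean_space \<Rightarrow> complex"
  assumes a: "integrable lborel a" and V: "continuous_on UNIV V"
    and vanish: "\<And>e. e > 0 \<Longrightarrow> \<exists>R. \<forall>x. norm x > R \<longrightarrow> cmod (V x) < e"
    and B: "\<And>x. cmod (V x) \<le> B"
  shows "precompact_op (\<lambda>u. conv_op a (mult_op V u))"
proof (rule precompact_op_approx)
  fix e :: real assume e: "e > 0"
  have [measurable]: "a \<in> borel_measurable borel" "V \<in> borel_measurable borel"
    using conv_kernel_measurable[OF a] V by (auto intro: borel_measurable_continuous_onI)
  have "0 \<le> B" by (rule order_trans[OF norm_ge_zero B])
  have "e / (2 * (B + 1)) > 0" using e \<open>0 \<le> B\<close> by simp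
  then obtain b where b: "Cc b" "(LBINT x. cmod (a x - b x)) < e / (2 * (B + 1))"
    using Cc_dense[of a 1 "e / (2 * (B + 1))"] a by (auto simp: integrable_norm_iff)
  have b_int: "integrable lborel b" by (rule Cc_integrable[OF b(1)])
  define nb where "nb = (LBINT x. cmod (b x))"
  have "0 \<le> nb" unfolding nb_def by (rule integral_nonneg_AE) auto
  \<comment> \<open>Chosen after \<open>b\<close>, because the second error term is
    \<open>e'\<close> times the \<open>L^1\<close> norm of \<open>b\<close>; the two terms end up at
    most \<open>e / 2\<close> and \<open>e / 4\<close>.\<close>
  define e' where "e' = e / (4 * (nb + 1))"
  have e': "e' > 0" using e \<open>0 \<le> nb\<close> by (simp add: e'_def)
  then obtain R where R: "\<And>x. norm x > R \<Longrightarrow> cmod (V x) < e'" using vanish by blast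
  define W where "W x = complex_of_real (cutoff R x) * V x" for x
  have W: "Cc W" unfolding W_def by (rule Cc_cutoff[OF V])
  have [measurable]: "W \<in> borel_measurable borel" by (rule Cc_measurable[OF W])
  have VW_eq: "V x - W x = complex_of_real (1 - cutoff R x) * V x" for x
    by (simp add: W_def algebra_simps)
  have VW: "cmod (V x - W x) \<le> e'" for x
  proof (cases "norm x > R")
    case True
    have "cmod (V x - W x) = (1 - cutoff R x) * cmod (V x)"
      unfolding VW_eq norm_mult norm_of_real using cutoff(2)[of R x] by simp
    also have "\<dots> \<le> 1 * e'" using cutoff(1,2)[of R x] R[OF True] by (intro mult_mono) auto
    finally show ?thesis by simp
  next
    case False
    then show ?thesis using e' by (simp add: VW_eq cutoff(3))
  qed
  have WB: "cmod (W x) \<le> B" for x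
  proof -
    have "cmod (W x) = cutoff R x * cmod (V x)" by (simp add: W_def norm_mult cutoff(1))
    also have "\<dots> \<le> 1 * B" using cutoff(1,2)[of R x] B[of x] by (intro mult_mono) auto
    finally show ?thesis by simp
  qed
  have "dist (conv_op a (mult_op V u)) (conv_op b (mult_op W u)) < e" if u: "u \<in> cball 0 1" for u
  proof -
    have u1: "norm u \<le> 1" using u by simp
    have "conv_op a (mult_op V u) - conv_op b (mult_op W u)
        = conv_op (\<lambda>x. a x - b x) (mult_op V u) + conv_op b (mult_op (\<lambda>x. V x - W x) u)"
      using mult_op_diff[of V B W B u] B WB
      by (simp add: conv_op_diff_kernel[OF a b_int] linear_diff[OF bounded_linear.linear, OF bounded_linear_conv_op[OF b_int]])
    then have "dist (conv_op a (mult_op V u)) (conv_op b (mult_op W u))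
        \<le> norm (conv_op (\<lambda>x. a x - b x) (mult_op V u)) + norm (conv_op b (mult_op (\<lambda>x. V x - W x) u))"
      by (metis dist_norm norm_triangle_ineq)
    also have "norm (conv_op (\<lambda>x. a x - b x) (mult_op V u)) \<le> e / (2 * (B + 1)) * B"
    proof -
      have "norm (mult_op V u) \<le> B * norm u" by (rule norm_mult_op_le) (use B in auto)
      also have "\<dots> \<le> B" using u1 \<open>0 \<le> B\<close> by (simp add: mult_left_le)
      finally have "norm (mult_op V u) \<le> B" .
      moreover have "integrable lborel (\<lambda>x. a x - b x)" using a b_int by simp
      from norm_conv_op_le[OF this, of "mult_op V u"]
      have "norm (conv_op (\<lambda>x. a x - b x) (mult_op V u)) \<le> (LBINT x. cmod (a x - b x)) * norm (mult_op V u)" .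
      moreover have "(LBINT x. cmod (a x - b x)) * norm (mult_op V u) \<le> e / (2 * (B + 1)) * B"
        using b(2) \<open>norm (mult_op V u) \<le> B\<close> \<open>e / (2 * (B + 1)) > 0\<close> by (intro mult_mono) auto
      ultimately show ?thesis by linarith
    qed
    also have "norm (conv_op b (mult_op (\<lambda>x. V x - W x) u)) \<le> nb * e'"
    proof -
      have "norm (mult_op (\<lambda>x. V x - W x) u) \<le> e' * norm u" by (rule norm_mult_op_le) (use VW in auto)
      also have "\<dots> \<le> e'" using u1 e' by (simp add: mult_left_le)
      finally show ?thesis
        using norm_conv_op_le[OF b_int, of "mult_op (\<lambda>x. V x - W x) u"] \<open>0 \<le> nb\<close> unfolding nb_def[symmetric]
        by (meson mult_left_mono order_trans)
    qed
    also have "e / (2 * (B + 1)) * B + nb * e' < e"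
    proof -
      have "e / (2 * (B + 1)) * B \<le> e / 2" using e \<open>0 \<le> B\<close> by (simp add: field_simps)
      moreover have "nb * e' \<le> e / 4" unfolding e'_def using e \<open>0 \<le> nb\<close> by (simp add: field_simps)
      ultimately show ?thesis using e by linarith
    qed
    finally show ?thesis by simp
  qed
  then show "\<exists>S'. precompact_op S' \<and> (\<forall>u\<in>cball 0 1. dist (conv_op a (mult_op V u)) (S' u) < e)"
    using precompact_conv_mult_Cc[OF b(1) W] by blast
qed

section \<open>The Fourier transform\<close>

lemma cmod_phase [simp]: "cmod (exp (- (\<i> * complex_of_real r))) = 1" "cmod (exp (\<i> * complex_of_real r)) = 1"
  by (simp_all add: norm_exp_eq_Re)

lemma integrable_phase:
  fixes u :: "'a::euclidean_space \<Rightarrow> complex" and \<theta> :: "'a \<Rightarrow> real"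
  assumes "integrable lborel u" and [measurable]: "\<theta> \<in> borel_measurable borel"
  shows "integrable lborel (\<lambda>\<xi>. u \<xi> * iexp (\<theta> \<xi>))"
    and "integrable lborel (\<lambda>\<xi>. u \<xi> * exp (- \<i> * complex_of_real (\<theta> \<xi>)))"
proof -
  have [measurable]: "u \<in> borel_measurable borel" by (rule conv_kernel_measurable[OF assms(1)])
  show "integrable lborel (\<lambda>\<xi>. u \<xi> * iexp (\<theta> \<xi>))"
    by (rule Bochner_Integration.integrable_bound[OF assms(1)]) (auto simp: norm_mult)
  show "integrable lborel (\<lambda>\<xi>. u \<xi> * exp (- \<i> * complex_of_real (\<theta> \<xi>)))"
    by (rule Bochner_Integration.integrable_bound[OF assms(1)]) (auto simp: norm_mult)
qed

lemma norm_fourier_le: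
  fixes u :: "real ^ 'n \<Rightarrow> complex"
  shows "cmod (fourier u x) \<le> (LBINT \<xi>. cmod (u \<xi>))"
proof -
  have "cmod (fourier u x) \<le> (LBINT \<xi>. cmod (u \<xi> * exp (- \<i> * complex_of_real (x \<bullet> \<xi>))))"
    unfolding fourier_def by (rule integral_norm_bound)
  then show ?thesis by (simp add: norm_mult)
qed

lemma continuous_fourier:
  fixes u :: "real ^ 'n \<Rightarrow> complex"
  assumes u: "integrable lborel u"
  shows "continuous_on UNIV (fourier u)"
  unfolding continuous_on_sequentially
proof (intro allI ballI impI, elim conjE)
  fix x :: "nat \<Rightarrow> real ^ 'n" and p assume x: "x \<longlonglongrightarrow> p"
  have [measurable]: "u \<in> borel_measurable borel" by (rule conv_kernel_measurable[OF u])
  show "(fourier u \<circ> x) \<longlonglongrightarrow> fourier u p"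
    unfolding o_def fourier_def
  proof (rule integral_dominated_convergence[where w = "\<lambda>\<xi>. cmod (u \<xi>)"])
    show "AE \<xi> in lborel. (\<lambda>i. u \<xi> * exp (- \<i> * complex_of_real (x i \<bullet> \<xi>))) \<longlonglongrightarrow> u \<xi> * exp (- \<i> * complex_of_real (p \<bullet> \<xi>))"
      by (intro AE_I2 tendsto_intros x)
  qed (use u in \<open>auto simp: norm_mult\<close>)
qed

lemma fourier_diff:
  fixes u v :: "real ^ 'n \<Rightarrow> complex"
  assumes "integrable lborel u" "integrable lborel v"
  shows "fourier (\<lambda>\<xi>. u \<xi> - v \<xi>) x = fourier u x - fourier v x"
  unfolding fourier_def left_diff_distrib
  by (rule Bochner_Integration.integral_diff[OF integrable_phase(2)[OF assms(1)] integrable_phase(2)[OF assms(2)]])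
    measurable

lemma fourier_hermitian_real:
  fixes u :: "real ^ 'n \<Rightarrow> complex"
  assumes u: "integrable lborel u" and herm: "AE x in lborel. u (- x) = cnj (u x)"
  shows "cnj (fourier u x) = fourier u x"
proof -
  have [measurable]: "u \<in> borel_measurable borel" by (rule conv_kernel_measurable[OF u])
  have "cnj (fourier u x) = (LBINT \<xi>. cnj (u \<xi> * exp (- \<i> * complex_of_real (x \<bullet> \<xi>))))"
    unfolding fourier_def by (rule Bochner_Integration.integral_cnj[symmetric])
  also have "\<dots> = (LBINT \<xi>. u (- \<xi>) * exp (- \<i> * complex_of_real (x \<bullet> (- \<xi>))))"
  proof (rule integral_cong_AE)
    show "AE \<xi> in lborel. cnj (u \<xi> * exp (- \<i> * complex_of_real (x \<bullet> \<xi>)))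
        = u (- \<xi>) * exp (- \<i> * complex_of_real (x \<bullet> (- \<xi>)))"
      using herm by eventually_elim (simp add: exp_cnj)
  qed measurable
  also have "\<dots> = fourier u x"
    unfolding fourier_def
    using integral_lborel_affine[of "-1" "\<lambda>\<xi>. u \<xi> * exp (- \<i> * complex_of_real (x \<bullet> \<xi>))" 0] by simp
  finally show ?thesis .
qed

text \<open>Shifting \<open>\<xi>\<close> by \<open>\<pi> x / |x|\<^sup>2\<close> changes the sign of the phase.\<close>

lemma riemann_lebesgue_Cc:
  fixes u :: "real ^ 'n \<Rightarrow> complex"
  assumes u: "Cc u" and e: "e > 0"
  shows "\<exists>R. \<forall>x. norm x > R \<longrightarrow> cmod (fourier u x) < e"
proof -
  have [measurable]: "u \<in> borel_measurable borel" using u by (rule Cc_measurable)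
  obtain R where R: "\<And>x. norm x > R \<Longrightarrow> u x = 0" using u by (auto simp: Cc_def)
  define \<nu> where "\<nu> = measure lborel (cball (0::real ^ 'n) (R + 1)) + 1"
  have \<nu>: "\<nu> > 0" unfolding \<nu>_def by (simp add: add_nonneg_pos)
  have "e / \<nu> > 0" using e \<nu> by simp
  then obtain d where d: "d > 0" "\<And>x y. norm (x - y) < d \<Longrightarrow> cmod (u x - u y) < e / \<nu>"
    using Cc_uniformly_continuous[OF u] by metis
  \<comment> \<open>Beyond this threshold the shift \<open>s\<close> has norm
    \<open>pi / norm x < min d 1\<close>: below \<open>d\<close> for uniform continuity, below 1 so
    that the shifted support stays in the ball of radius \<open>R + 1\<close>.\<close>
  have "cmod (fourier u x) < e" if x: "norm x > pi / min d 1" for x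
  proof -
    have "pi / min d 1 > 0" using d(1) by simp
    then have x0: "norm x > 0" using x by linarith
    define s where "s = (pi / (norm x)\<^sup>2) *\<^sub>R x"
    have ns: "norm s = pi / norm x" using x0 by (simp add: s_def power2_eq_square)
    have "norm s < min d 1"
      unfolding ns using x x0 d(1) pos_divide_less_eq[of "min d 1" pi "norm x"] pos_divide_less_eq[of "norm x" pi "min d 1"]
      by (simp add: mult.commute)
    have xs: "x \<bullet> s = pi" using x0 by (simp add: s_def power2_norm_eq_inner)
    define E where "E \<xi> = exp (- \<i> * complex_of_real (x \<bullet> \<xi>))" for \<xi>
    have E_meas [measurable]: "E \<in> borel_measurable borel" unfolding E_def by measurable
    have E_norm: "cmod (E \<xi>) = 1" for \<xi> unfolding E_def by simp
    have E_shift: "E (s + \<xi>) = - E \<xi>" for \<xi>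
    proof -
      have "- \<i> * complex_of_real (pi + x \<bullet> \<xi>) = - (\<i> * complex_of_real pi) + - \<i> * complex_of_real (x \<bullet> \<xi>)"
        by (simp add: algebra_simps)
      moreover have "exp (- (\<i> * complex_of_real pi)) = -1" by (subst exp_minus) simp
      ultimately show ?thesis unfolding E_def inner_add_right xs by (simp only: exp_add) simp
    qed
    have u_int: "integrable lborel (\<lambda>\<xi>. u \<xi> * E \<xi>)"
      unfolding E_def by (rule integrable_phase(2)[OF Cc_integrable[OF u]]) measurable
    have us_int: "integrable lborel (\<lambda>\<xi>. u (s + \<xi>) * E \<xi>)"
      using integrable_lborel_affine[OF u_int, of 1 s] by (simp add: E_shift)
    have "fourier u x = (LBINT \<xi>. u \<xi> * E \<xi>)" by (simp add: fourier_def E_def)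
    moreover have "(LBINT \<xi>. u \<xi> * E \<xi>) = - (LBINT \<xi>. u (s + \<xi>) * E \<xi>)"
      using integral_lborel_affine[of 1 "\<lambda>\<xi>. u \<xi> * E \<xi>" s] by (simp add: E_shift)
    \<comment> \<open>Adding the shifted form of the integral leaves only increments of
      \<open>u\<close>, which uniform continuity makes small.\<close>
    ultimately have "2 * fourier u x = (LBINT \<xi>. u \<xi> * E \<xi>) - (LBINT \<xi>. u (s + \<xi>) * E \<xi>)"
      by simp
    also have "\<dots> = (LBINT \<xi>. u \<xi> * E \<xi> - u (s + \<xi>) * E \<xi>)"
      by (rule Bochner_Integration.integral_diff[OF u_int us_int, symmetric])
    finally have "2 * fourier u x = (LBINT \<xi>. u \<xi> * E \<xi> - u (s + \<xi>) * E \<xi>)" .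
    then have "cmod (2 * fourier u x) = cmod (LBINT \<xi>. u \<xi> * E \<xi> - u (s + \<xi>) * E \<xi>)" by simp
    also have "\<dots> \<le> (LBINT \<xi>. (e / \<nu>) * indicator (cball (0::real ^ 'n) (R + 1)) \<xi>)"
    proof (rule Bochner_Integration.integral_norm_bound_integral)
      show "integrable lborel (\<lambda>\<xi>. u \<xi> * E \<xi> - u (s + \<xi>) * E \<xi>)"
        by (rule Bochner_Integration.integrable_diff[OF u_int us_int])
      show "integrable lborel (\<lambda>\<xi>. (e / \<nu>) * indicator (cball (0::real ^ 'n) (R + 1)) \<xi> :: real)"
        by (rule integrable_indicator_cball)
      fix \<xi> :: "real ^ 'n"
      have eq: "cmod (u \<xi> * E \<xi> - u (s + \<xi>) * E \<xi>) = cmod (u \<xi> - u (s + \<xi>))"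
        unfolding left_diff_distrib[symmetric] norm_mult E_norm by simp
      show "cmod (u \<xi> * E \<xi> - u (s + \<xi>) * E \<xi>) \<le> e / \<nu> * indicator (cball 0 (R + 1)) \<xi>"
      proof (cases "norm \<xi> \<le> R + 1")
        case True
        have "cmod (u \<xi> - u (s + \<xi>)) < e / \<nu>" using \<open>norm s < min d 1\<close> by (intro d(2)) simp
        then show ?thesis unfolding eq using True by simp
      next
        case False
        then have "norm (s + \<xi>) > R"
          using norm_triangle_sub[of \<xi> "s + \<xi>"] \<open>norm s < min d 1\<close> by simp
        then show ?thesis unfolding eq using False by (simp add: R)
      qed
    qed
    also have "\<dots> = (e / \<nu>) * measure lborel (cball (0::real ^ 'n) (R + 1))" by simp
    also have "\<dots> \<le> (e / \<nu>) * \<nu>"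
      using e \<nu> by (intro mult_left_mono) (auto simp: \<nu>_def)
    also have "\<dots> = e" using \<nu> by simp
    finally show ?thesis using e by (simp add: norm_mult)
  qed
  then show ?thesis by blast
qed

text \<open>Density of \<open>Cc\<close> in \<open>L^1\<close> and the bound of the transform by the
  \<open>L^1\<close> norm. It yields the decay of \<open>V\<close> on which compactness
  rests.\<close>

lemma riemann_lebesgue:
  fixes u :: "real ^ 'n \<Rightarrow> complex"
  assumes u: "integrable lborel u" and e: "e > 0"
  shows "\<exists>R. \<forall>x. norm x > R \<longrightarrow> cmod (fourier u x) < e"
proof -
  have e2: "e / 2 > 0" using e by simp
  obtain v where v: "Cc v" "(LBINT x. cmod (u x - v x)) < e / 2"
    using Cc_dense[of u 1 "e / 2"] u e2 conv_kernel_measurable[OF u] by (auto simp: integrable_norm_iff)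
  obtain R where R: "\<And>x. norm x > R \<Longrightarrow> cmod (fourier v x) < e / 2"
    using riemann_lebesgue_Cc[OF v(1) e2] by blast
  have "cmod (fourier u x) < e" if "norm x > R" for x
  proof -
    have "cmod (fourier u x - fourier v x) < e / 2"
      using norm_fourier_le[of "\<lambda>x. u x - v x" x] v(2)
      by (simp add: fourier_diff[OF u Cc_integrable[OF v(1)]])
    then show ?thesis using R[OF that] norm_triangle_sub[of "fourier u x" "fourier v x"] by linarith
  qed
  then show ?thesis by blast
qed

section \<open>The Gaussian and its Fourier transform\<close>

definition gauss :: "'a::euclidean_space \<Rightarrow> real" where
  "gauss x = (\<Prod>b\<in>Basis. std_normal_density (x \<bullet> b))"

lemma lborel_integral_prod:
  fixes f :: "'a::euclidean_space \<Rightarrow> real \<Rightarrow> 'b::{real_normed_field, banach, second_countable_topology}"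
  assumes f: "\<And>b. b \<in> Basis \<Longrightarrow> integrable lborel (f b)"
  shows "(LBINT x. (\<Prod>b\<in>Basis. f b (x \<bullet> b))) = (\<Prod>b\<in>Basis. LBINT t. f b t)"
    and "integrable lborel (\<lambda>x. \<Prod>b\<in>Basis. f b (x \<bullet> b))"
proof -
  interpret product_sigma_finite "\<lambda>b::'a. lborel :: real measure" ..
  have [measurable]: "f b \<in> borel_measurable borel" if "b \<in> Basis" for b
    using f[OF that] by (auto dest: borel_measurable_integrable)
  have comp: "(\<Sum>b'\<in>Basis. g b' *\<^sub>R b') \<bullet> b = g b" if "b \<in> Basis" for g :: "'a \<Rightarrow> real" and b :: 'a
    using that by simp
  have meas: "(\<lambda>g. \<Sum>b\<in>Basis. g b *\<^sub>R b) \<in> (\<Pi>\<^sub>M b\<in>(Basis::'a set). lborel) \<rightarrow>\<^sub>M borel"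
    by measurable
  have eq: "(\<Prod>b\<in>Basis. f b ((\<Sum>b'\<in>Basis. g b' *\<^sub>R b') \<bullet> b)) = (\<Prod>b\<in>Basis. f b (g b))" for g
    by (intro prod.cong) (auto simp: comp)
  show "(LBINT x. (\<Prod>b\<in>Basis. f b (x \<bullet> b))) = (\<Prod>b\<in>Basis. LBINT t. f b t)"
    unfolding lborel_eq[where 'a = 'a]
    by (subst integral_distr[OF meas]) (auto simp: eq product_integral_prod f)
  show "integrable lborel (\<lambda>x. \<Prod>b\<in>Basis. f b (x \<bullet> b))"
    unfolding lborel_eq[where 'a = 'a]
    by (subst integrable_distr_eq[OF meas]) (auto simp: eq product_integrable_prod f)
qed

lemma integrable_gauss: "integrable lborel (gauss :: 'a::euclidean_space \<Rightarrow> real)"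
  unfolding gauss_def[abs_def] by (rule lborel_integral_prod) simp

lemma integral_gauss: "(\<integral>x. gauss x \<partial>(lborel :: 'a::euclidean_space measure)) = 1"
  unfolding gauss_def[abs_def] by (subst lborel_integral_prod) simp_all

lemma gauss_nonneg: "0 \<le> gauss x"
  unfolding gauss_def by (intro prod_nonneg) simp

lemma gauss_measurable [measurable]: "gauss \<in> borel_measurable borel"
  using integrable_gauss by (auto dest: borel_measurable_integrable)

text \<open>In each coordinate this is the characteristic function \<open>exp (- t^2 / 2)\<close> of
  the standard normal law, which is its density times \<open>sqrt (2 * pi)\<close>; so the Gaussian
  reproduces itself with that factor per dimension.\<close>

lemma gauss_fourier:
  fixes \<tau> :: "'a::euclidean_space"
  shows "(LBINT \<eta>. complex_of_real (gauss \<eta>) * iexp (\<tau> \<bullet> \<eta>))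
    = complex_of_real (sqrt (2 * pi) ^ DIM('a) * gauss \<tau>)"
proof -
  define f where "f b t = complex_of_real (std_normal_density t) * iexp ((\<tau> \<bullet> b) * t)" for b :: 'a and t
  have f_int: "integrable lborel (f b)" for b
    unfolding f_def by (rule integrable_phase(1)[of _ "\<lambda>t. (\<tau> \<bullet> b) * t"]) auto
  have f_val: "(LBINT t. f b t) = complex_of_real (exp (- (\<tau> \<bullet> b)\<^sup>2 / 2))" for b
  proof -
    have "char std_normal_distribution (\<tau> \<bullet> b) = (LBINT t. f b t)"
      unfolding char_def f_def
      by (subst integral_density) (auto simp: scaleR_conv_of_real intro!: Bochner_Integration.integral_cong)
    then show ?thesis by (simp add: char_std_normal_distribution)
  qed
  have prod_eq: "complex_of_real (gauss \<eta>) * iexp (\<tau> \<bullet> \<eta>) = (\<Prod>b\<in>Basis. f b (\<eta> \<bullet> b))" for \<eta>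
  proof -
    have "\<tau> \<bullet> \<eta> = (\<Sum>b\<in>Basis. (\<tau> \<bullet> b) * (\<eta> \<bullet> b))" by (rule euclidean_inner)
    then show ?thesis
      by (simp add: gauss_def f_def prod.distrib exp_sum sum_distrib_left)
  qed
  have "(LBINT \<eta>. complex_of_real (gauss \<eta>) * iexp (\<tau> \<bullet> \<eta>))
      = (\<Prod>b\<in>Basis. complex_of_real (exp (- (\<tau> \<bullet> b)\<^sup>2 / 2)))"
    unfolding prod_eq by (subst lborel_integral_prod(1)) (auto simp: f_int f_val)
  also have "\<dots> = (\<Prod>b\<in>Basis. complex_of_real (sqrt (2 * pi) * std_normal_density (\<tau> \<bullet> b)))"
    by (intro prod.cong refl) (simp add: std_normal_density_def)
  also have "\<dots> = complex_of_real (sqrt (2 * pi) ^ DIM('a) * gauss \<tau>)"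
    by (simp add: gauss_def prod.distrib prod_constant)
  finally show ?thesis .
qed

section \<open>The lower bound of a convolution form\<close>

text \<open>The condition for Fubini when the factor \<open>h\<close> coupling the variables is
  merely bounded, such as a phase or a translate of a bounded function.\<close>

lemma integrable_pair_product:
  fixes f g :: "'a::euclidean_space \<Rightarrow> complex"
  assumes f: "integrable lborel f" and g: "integrable lborel g"
    and h [measurable]: "(\<lambda>(x, y). h x y) \<in> borel_measurable (borel \<Otimes>\<^sub>M borel)" and C: "\<And>x y. cmod (h x y) \<le> C"
  shows "integrable (lborel \<Otimes>\<^sub>M lborel) (\<lambda>(x, y). f x * g y * h x y)"
proof -
  have [measurable]: "f \<in> borel_measurable borel" "g \<in> borel_measurable borel"
    using conv_kernel_measurable[OF f] conv_kernel_measurable[OF g] by auto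
  have "0 \<le> C" by (rule order_trans[OF norm_ge_zero C])
  have "(\<integral>\<^sup>+z. ennreal (norm (case z of (x, y) \<Rightarrow> f x * g y * h x y)) \<partial>(lborel \<Otimes>\<^sub>M lborel))
      = (\<integral>\<^sup>+x. \<integral>\<^sup>+y. ennreal (cmod (f x * g y * h x y)) \<partial>lborel \<partial>lborel)"
    by (subst lborel.nn_integral_fst[symmetric]) auto
  also have "\<dots> \<le> (\<integral>\<^sup>+x. \<integral>\<^sup>+y. ennreal C * ennreal (cmod (f x)) * ennreal (cmod (g y)) \<partial>lborel \<partial>lborel)"
  proof (intro nn_integral_mono)
    fix x y
    have "cmod (f x * g y * h x y) \<le> C * cmod (f x) * cmod (g y)"
      using mult_right_mono[OF C[of x y], of "cmod (f x) * cmod (g y)"] by (simp add: norm_mult mult_ac)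
    then show "ennreal (cmod (f x * g y * h x y)) \<le> ennreal C * ennreal (cmod (f x)) * ennreal (cmod (g y))"
      using \<open>0 \<le> C\<close> by (simp add: ennreal_leI flip: ennreal_mult')
  qed
  also have "\<dots> = ennreal C * (\<integral>\<^sup>+x. ennreal (cmod (f x)) \<partial>lborel) * (\<integral>\<^sup>+y. ennreal (cmod (g y)) \<partial>lborel)"
    by (simp add: nn_integral_cmult nn_integral_multc)
  also have "\<dots> < \<infinity>" using f g by (simp add: integrable_iff_bounded ennreal_mult_less_top)
  finally show ?thesis by (simp add: integrable_iff_bounded)
qed

text \<open>The conjugate falls on the translated factor. With this convention the form of a
  convolution is the integral of \<open>a\<close> against \<open>autocorr u\<close>, and the
  transform with phase \<open>iexp (\<xi> \<bullet> t)\<close> is the non-negative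
  \<open>|fourier u \<xi>|^2\<close>.\<close>

definition autocorr :: "('a::euclidean_space \<Rightarrow> complex) \<Rightarrow> 'a \<Rightarrow> complex" where
  "autocorr u t = (LBINT y. u y * cnj (u (y + t)))"

lemma autocorr_0:
  assumes "Cc u"
  shows "autocorr u 0 = complex_of_real ((norm (l2_abs u))\<^sup>2)"
proof -
  have "autocorr u 0 = (LBINT y. complex_of_real ((cmod (u y))\<^sup>2))"
    by (simp only: autocorr_def add_0_right complex_norm_square)
  then show ?thesis
    by (simp add: norm_l2_abs Cc_L2 assms L2_norm_def integral_nonneg_AE del: of_real_power)
qed

lemma Cc_autocorr:
  fixes u :: "'a::euclidean_space \<Rightarrow> complex"
  assumes u: "Cc u"
  shows "Cc (autocorr u)"
  unfolding Cc_def
proof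
  have [measurable]: "u \<in> borel_measurable borel" using u by (rule Cc_measurable)
  obtain M where M: "\<And>x. cmod (u x) \<le> M" using Cc_bounded[OF u] by blast
  obtain R where R: "\<And>x. norm x > R \<Longrightarrow> u x = 0" using u by (auto simp: Cc_def)
  have cont: "continuous_on UNIV u" using u by (simp add: Cc_def)
  show "continuous_on UNIV (autocorr u)"
    unfolding continuous_on_sequentially
  proof (intro allI ballI impI, elim conjE)
    fix t :: "nat \<Rightarrow> 'a" and p assume t: "t \<longlonglongrightarrow> p"
    show "(autocorr u \<circ> t) \<longlonglongrightarrow> autocorr u p"
      unfolding o_def autocorr_def
    proof (rule integral_dominated_convergence[where w = "\<lambda>y. cmod (u y) * M"])
      have "(\<lambda>i. u (y + t i)) \<longlonglongrightarrow> u (y + p)" for y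
        by (rule continuous_on_tendsto_compose[OF cont]) (auto intro: tendsto_intros t)
      then show "AE y in lborel. (\<lambda>i. u y * cnj (u (y + t i))) \<longlonglongrightarrow> u y * cnj (u (y + p))"
        by (intro AE_I2 tendsto_intros)
      show "integrable lborel (\<lambda>y. cmod (u y) * M)" using Cc_integrable[OF u] by simp
      show "AE y in lborel. norm (u y * cnj (u (y + t i))) \<le> cmod (u y) * M" for i
        using M by (simp add: norm_mult mult_left_mono)
    qed measurable
  qed
  have "autocorr u t = 0" if "norm t > 2 * R" for t
  proof -
    have "u y * cnj (u (y + t)) = 0" for y
    proof (cases "norm y > R")
      case False
      then have "norm (y + t) > R" using that norm_triangle_sub[of t "- y"] by (simp add: add.commute)
      then show ?thesis by (simp add: R)
    qed (simp add: R)
    then show ?thesis by (simp only: autocorr_def Bochner_Integration.integral_zero)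
  qed
  then show "\<exists>R. \<forall>t. norm t > R \<longrightarrow> autocorr u t = 0" by blast
qed

text \<open>Substitute \<open>x = y + t\<close>. Continuity of \<open>u\<close> is not assumed, so
  the identity serves both the functions in \<open>Cc\<close> and the indicator of a cube.\<close>

lemma conv_form_eq_autocorr:
  fixes a u :: "'a::euclidean_space \<Rightarrow> complex"
  assumes a: "integrable lborel a" and u: "integrable lborel u" "u \<in> L2 lborel" and M: "\<And>x. cmod (u x) \<le> M"
  shows "(LBINT x. LBINT y. a (x - y) * u y * cnj (u x)) = (LBINT t. a t * autocorr u t)"
proof -
  have [measurable]: "u \<in> borel_measurable borel" "a \<in> borel_measurable borel"
    using conv_kernel_measurable[OF u(1)] conv_kernel_measurable[OF a] by auto
  have "(LBINT x. LBINT y. a (x - y) * u y * cnj (u x))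
      = (LBINT y. LBINT x. a (x - y) * u y * cnj (u x))"
    by (rule lborel_pair.Fubini_integral[OF conv_form_integrable[OF a u(2) u(2)], symmetric])
  also have "\<dots> = (LBINT y. LBINT t. u y * a t * cnj (u (y + t)))"
  proof (rule Bochner_Integration.integral_cong[OF refl])
    fix y
    show "(LBINT x. a (x - y) * u y * cnj (u x)) = (LBINT t. u y * a t * cnj (u (y + t)))"
      using integral_lborel_affine[of 1 "\<lambda>x. a (x - y) * u y * cnj (u x)" y] by (simp add: mult_ac)
  qed
  also have "\<dots> = (LBINT t. LBINT y. u y * a t * cnj (u (y + t)))"
    by (rule lborel_pair.Fubini_integral[symmetric], rule integrable_pair_product[OF u(1) a, of _ M])
      (auto simp: M)
  also have "\<dots> = (LBINT t. a t * autocorr u t)"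
  proof (rule Bochner_Integration.integral_cong[OF refl])
    fix t
    have "(LBINT y. u y * a t * cnj (u (y + t))) = (LBINT y. a t * (u y * cnj (u (y + t))))"
      by (simp add: mult_ac)
    then show "(LBINT y. u y * a t * cnj (u (y + t))) = a t * autocorr u t"
      by (simp add: autocorr_def)
  qed
  finally show ?thesis .
qed

text \<open>Writing \<open>E t = cnj (E y) * E (y + t)\<close> splits the double integral, after the
  translation \<open>x = y + t\<close>, into a product of two Fourier integrals.\<close>

lemma fourier_autocorr:
  fixes u :: "real ^ 'n \<Rightarrow> complex"
  assumes u: "Cc u"
  shows "(LBINT t. autocorr u t * iexp (\<xi> \<bullet> t)) = complex_of_real ((cmod (fourier u \<xi>))\<^sup>2)"
proof -
  have [measurable]: "u \<in> borel_measurable borel" using Cc_measurable[OF u] by auto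
  obtain M where M: "\<And>x. cmod (u x) \<le> M" using Cc_bounded[OF u] by blast
  have "0 \<le> M" by (rule order_trans[OF norm_ge_zero M])
  obtain R where R: "\<And>x. norm x > R \<Longrightarrow> u x = 0" using u by (auto simp: Cc_def)
  define E where "E x = iexp (\<xi> \<bullet> x)" for x
  have [measurable]: "E \<in> borel_measurable borel" unfolding E_def by measurable
  have E_norm: "cmod (E x) = 1" for x unfolding E_def by simp
  have E_add: "E t = cnj (E y) * E (y + t)" for y t
    unfolding E_def by (simp add: exp_cnj inner_add_right algebra_simps flip: exp_add)
  \<comment> \<open>The product \<open>u(y) cnj (u(y + t))\<close> vanishes for
    \<open>norm t > 2 * R\<close>; inserting this indicator supplies the integrable factor in
    \<open>t\<close> that Fubini needs here.\<close>
  define cut where "cut t = (indicator (cball (0::real ^ 'n) (2 * R)) t :: complex)" for t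
  have cut_int: "integrable lborel cut"
    unfolding cut_def by (rule integrable_bounded_support[of _ 1 "2 * R"]) (auto simp: indicator_def)
  have cut_supp: "u y * cnj (u (y + t)) * E t = cut t * u y * (cnj (u (y + t)) * E t)" for y t
  proof (cases "norm t \<le> 2 * R")
    case False
    then have "norm y > R \<or> norm (y + t) > R" using norm_triangle_sub[of t "- y"] by (auto simp: add.commute)
    then show ?thesis using R by auto
  qed (simp add: cut_def)
  have "(LBINT t. autocorr u t * E t) = (LBINT t. LBINT y. cut t * u y * (cnj (u (y + t)) * E t))"
    by (simp only: autocorr_def cut_supp[symmetric] Bochner_Integration.integral_mult_left_zero)
  also have "\<dots> = (LBINT y. LBINT t. cut t * u y * (cnj (u (y + t)) * E t))"
    by (rule lborel_pair.Fubini_integral[symmetric], rule integrable_pair_product[OF cut_int Cc_integrable[OF u], of _ M])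
      (auto simp: M norm_mult E_norm)
  also have "\<dots> = (LBINT y. u y * cnj (E y) * cnj (fourier u \<xi>))"
  proof (rule Bochner_Integration.integral_cong[OF refl])
    fix y
    have F: "cnj (fourier u \<xi>) = (LBINT x. cnj (u x) * E x)"
      unfolding fourier_def E_def
      by (simp add: exp_cnj flip: Bochner_Integration.integral_cnj)
    have "(LBINT t. cut t * u y * (cnj (u (y + t)) * E t)) = (LBINT t. u y * cnj (E y) * (cnj (u (y + t)) * E (y + t)))"
      unfolding cut_supp[symmetric] by (subst E_add[of _ y]) (simp add: mult_ac)
    also have "\<dots> = u y * cnj (E y) * (LBINT t. cnj (u (y + t)) * E (y + t))" by simp
    also have "(LBINT t. cnj (u (y + t)) * E (y + t)) = (LBINT x. cnj (u x) * E x)"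
      using integral_lborel_affine[of 1 "\<lambda>x. cnj (u x) * E x" y] by simp
    finally show "(LBINT t. cut t * u y * (cnj (u (y + t)) * E t)) = u y * cnj (E y) * cnj (fourier u \<xi>)"
      by (simp add: F)
  qed
  also have "\<dots> = (LBINT y. u y * cnj (E y)) * cnj (fourier u \<xi>)" by simp
  also have "(LBINT y. u y * cnj (E y)) = fourier u \<xi>"
    by (simp add: fourier_def E_def exp_cnj)
  finally show ?thesis by (simp only: E_def complex_norm_square)
qed

text \<open>Fourier inversion is only needed after Gaussian smoothing: \<open>\<phi>(s + \<epsilon> \<tau>)\<close> averaged over a
  Gaussian \<open>\<tau>\<close> is a Fourier integral with the non-negative weight
  \<open>gauss \<eta> |\<F>[u](\<eta> / \<epsilon>)|\<^sup>2\<close>, where \<open>\<phi>\<close> is the autocorrelation of \<open>u\<close>.\<close>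

lemma gauss_average_autocorr:
  fixes u :: "real ^ 'n \<Rightarrow> complex"
  assumes u: "Cc u" and \<epsilon>: "\<epsilon> > 0"
  shows "complex_of_real (sqrt (2 * pi) ^ CARD('n) * \<epsilon> ^ CARD('n))
      * (LBINT \<tau>. autocorr u (s + \<epsilon> *\<^sub>R \<tau>) * complex_of_real (gauss \<tau>))
    = (LBINT \<eta>. complex_of_real (gauss \<eta> * (cmod (fourier u (\<eta> /\<^sub>R \<epsilon>)))\<^sup>2)
        * exp (- \<i> * complex_of_real ((\<eta> /\<^sub>R \<epsilon>) \<bullet> s)))"
proof -
  define \<phi> where "\<phi> = autocorr u"
  let ?E = "\<lambda>\<eta>. exp (- \<i> * complex_of_real ((\<eta> /\<^sub>R \<epsilon>) \<bullet> s))"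
  let ?I = "\<lambda>\<eta>. LBINT \<tau>. \<phi> (s + \<epsilon> *\<^sub>R \<tau>) * iexp (\<tau> \<bullet> \<eta>)"
  have \<phi>: "Cc \<phi>" unfolding \<phi>_def by (rule Cc_autocorr[OF u])
  have [measurable]: "\<phi> \<in> borel_measurable borel" by (rule Cc_measurable[OF \<phi>])
  have g_int: "integrable lborel (\<lambda>\<eta>::real ^ 'n. complex_of_real (gauss \<eta>))"
    using integrable_gauss[where 'a = "real ^ 'n"] by simp
  have \<phi>_int: "integrable lborel (\<lambda>\<tau>. \<phi> (s + \<epsilon> *\<^sub>R \<tau>))"
    using \<epsilon> by (intro integrable_lborel_affine Cc_integrable \<phi>) simp
  \<comment> \<open>Substitution \<open>t = s + \<epsilon> \<tau>\<close>: the Jacobian accounts for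
    \<open>\<epsilon>^d\<close>, and the phase \<open>\<tau> \<bullet> \<eta>\<close> becomes
    \<open>(\<eta> / \<epsilon>) \<bullet> (t - s)\<close>.\<close>
  have inner: "complex_of_real (\<epsilon> ^ CARD('n)) * ?I \<eta>
      = complex_of_real ((cmod (fourier u (\<eta> /\<^sub>R \<epsilon>)))\<^sup>2) * ?E \<eta>" for \<eta>
  proof -
    define f where "f t = \<phi> t * iexp ((\<eta> /\<^sub>R \<epsilon>) \<bullet> (t - s))" for t
    have "f (s + \<epsilon> *\<^sub>R \<tau>) = \<phi> (s + \<epsilon> *\<^sub>R \<tau>) * iexp (\<tau> \<bullet> \<eta>)" for \<tau>
    proof -
      have "(\<eta> /\<^sub>R \<epsilon>) \<bullet> (s + \<epsilon> *\<^sub>R \<tau> - s) = \<tau> \<bullet> \<eta>" using \<epsilon> by (simp add: inner_commute)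
      then show ?thesis unfolding f_def by (simp only:)
    qed
    then have "complex_of_real (\<epsilon> ^ CARD('n)) * ?I \<eta>
        = (LBINT t. f t)"
      using integral_lborel_affine[of \<epsilon> f s] \<epsilon> by (simp add: scaleR_conv_of_real)
    also have "f t = \<phi> t * iexp ((\<eta> /\<^sub>R \<epsilon>) \<bullet> t) * ?E \<eta>" for t
      unfolding f_def mult.assoc exp_add[symmetric] by (simp add: inner_diff_right algebra_simps)
    then have "(LBINT t. f t) = (LBINT t. \<phi> t * iexp ((\<eta> /\<^sub>R \<epsilon>) \<bullet> t))
        * ?E \<eta>" by simp
    also have "(LBINT t. \<phi> t * iexp ((\<eta> /\<^sub>R \<epsilon>) \<bullet> t))
        = complex_of_real ((cmod (fourier u (\<eta> /\<^sub>R \<epsilon>)))\<^sup>2)"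
      unfolding \<phi>_def by (rule fourier_autocorr[OF u])
    finally show ?thesis .
  qed
  \<comment> \<open>The factor \<open>sqrt (2 * pi)^d\<close> turns \<open>gauss \<tau>\<close> into
    its own Fourier integral over \<eta>.\<close>
  have "complex_of_real (sqrt (2 * pi) ^ CARD('n)) * (LBINT \<tau>. \<phi> (s + \<epsilon> *\<^sub>R \<tau>) * complex_of_real (gauss \<tau>))
      = (LBINT \<tau>. \<phi> (s + \<epsilon> *\<^sub>R \<tau>) * (LBINT \<eta>. complex_of_real (gauss \<eta>) * iexp (\<tau> \<bullet> \<eta>)))"
    by (simp add: gauss_fourier mult.left_commute flip: Bochner_Integration.integral_mult_right_zero)
  also have "\<dots> = (LBINT \<tau>. LBINT \<eta>. \<phi> (s + \<epsilon> *\<^sub>R \<tau>) * complex_of_real (gauss \<eta>) * iexp (\<tau> \<bullet> \<eta>))"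
    by (simp add: mult.assoc)
  also have "\<dots> = (LBINT \<eta>. LBINT \<tau>. \<phi> (s + \<epsilon> *\<^sub>R \<tau>) * complex_of_real (gauss \<eta>) * iexp (\<tau> \<bullet> \<eta>))"
    by (rule lborel_pair.Fubini_integral[symmetric], rule integrable_pair_product[OF \<phi>_int g_int, of _ 1]) auto
  also have "\<dots> = (LBINT \<eta>. complex_of_real (gauss \<eta>) * ?I \<eta>)"
    by (simp add: mult_ac flip: Bochner_Integration.integral_mult_right_zero)
  finally have "complex_of_real (\<epsilon> ^ CARD('n)) * (complex_of_real (sqrt (2 * pi) ^ CARD('n)) * (LBINT \<tau>. \<phi> (s + \<epsilon> *\<^sub>R \<tau>) * complex_of_real (gauss \<tau>)))
      = (LBINT \<eta>. complex_of_real (gauss \<eta>) * (complex_of_real (\<epsilon> ^ CARD('n)) * ?I \<eta>))"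
    by (simp only: mult.left_commute[of "complex_of_real (gauss _)"] Bochner_Integration.integral_mult_right_zero)
  then show ?thesis
    unfolding inner by (simp add: \<phi>_def mult_ac)
qed

text \<open>With the smoothed autocorrelation the form becomes the integral of
  \<open>fourier a (\<eta> / \<epsilon>)\<close> against a non-negative weight \<rho> whose mass is
  a multiple of the smoothed value at 0, so the pointwise bound \<open>m\<close> can be inserted.
  The Gaussian factor makes \<rho> integrable from boundedness of \<open>fourier u\<close> alone.
  Letting \<epsilon> tend to 0 removes the smoothing.\<close>

lemma conv_form_lower_bound_Cc:
  fixes a u :: "real ^ 'n \<Rightarrow> complex"
  assumes a: "integrable lborel a" and m: "\<And>\<xi>. m \<le> Re (fourier a \<xi>)" and u: "Cc u"
  shows "m * (norm (l2_abs u))\<^sup>2 \<le> inner (conv_op a (l2_abs u)) (l2_abs u)"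
proof -
  define \<phi> where "\<phi> = autocorr u"
  have \<phi>: "Cc \<phi>" unfolding \<phi>_def by (rule Cc_autocorr[OF u])
  obtain M where M: "\<And>x. cmod (\<phi> x) \<le> M" using Cc_bounded[OF \<phi>] by blast
  obtain Mu where Mu: "\<And>x. cmod (u x) \<le> Mu" using Cc_bounded[OF u] by blast
  have [measurable]: "\<phi> \<in> borel_measurable borel" "a \<in> borel_measurable borel" "u \<in> borel_measurable borel"
    using Cc_measurable[OF \<phi>] conv_kernel_measurable[OF a] Cc_measurable[OF u] by auto
  have [measurable]: "fourier u \<in> borel_measurable borel" "fourier a \<in> borel_measurable borel"
    using continuous_fourier[OF a] continuous_fourier[OF Cc_integrable[OF u]]
    by (auto intro: borel_measurable_continuous_onI)
  define \<Phi> where "\<Phi> \<epsilon> s = (LBINT \<tau>. \<phi> (s + \<epsilon> *\<^sub>R \<tau>) * complex_of_real (gauss \<tau>))" for \<epsilon> s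
  have \<Phi>_meas [measurable]: "\<Phi> \<epsilon> \<in> borel_measurable borel" for \<epsilon>
  proof -
    have "(\<lambda>s. LBINT \<tau>. \<phi> (s + \<epsilon> *\<^sub>R \<tau>) * complex_of_real (gauss \<tau>)) \<in> borel_measurable borel"
      by (rule lborel.borel_measurable_lebesgue_integral) measurable
    then show ?thesis by (simp add: \<Phi>_def[abs_def])
  qed
  have smoothed: "m * Re (\<Phi> \<epsilon> 0) \<le> Re (LBINT s. a s * \<Phi> \<epsilon> s)" if \<epsilon>: "\<epsilon> > 0" for \<epsilon>
  proof -
    define k where "k = sqrt (2 * pi) ^ CARD('n) * \<epsilon> ^ CARD('n)"
    have k: "k > 0" using \<epsilon> by (simp add: k_def)
    define \<rho> where "\<rho> \<eta> = gauss \<eta> * (cmod (fourier u (\<eta> /\<^sub>R \<epsilon>)))\<^sup>2" for \<eta> :: "real ^ 'n"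
    let ?h = "\<lambda>\<eta>. complex_of_real (\<rho> \<eta>) * fourier a (\<eta> /\<^sub>R \<epsilon>)"
    have [measurable]: "\<rho> \<in> borel_measurable borel" unfolding \<rho>_def by measurable
    have \<rho>_nonneg: "0 \<le> \<rho> \<eta>" for \<eta> by (simp add: \<rho>_def gauss_nonneg)
    have \<rho>_int: "integrable lborel \<rho>"
    proof (rule Bochner_Integration.integrable_bound)
      show "integrable lborel (\<lambda>\<eta>::real ^ 'n. gauss \<eta> * (LBINT \<xi>. cmod (u \<xi>))\<^sup>2)" using integrable_gauss[where 'a = "real ^ 'n"] by simp
      show "AE \<eta> in lborel. norm (\<rho> \<eta>) \<le> norm (gauss \<eta> * (LBINT \<xi>. cmod (u \<xi>))\<^sup>2)"
        using norm_fourier_le[of u]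
        by (auto simp: \<rho>_def gauss_nonneg intro!: mult_left_mono power_mono)
    qed measurable
    have \<Phi>_eq: "complex_of_real k * \<Phi> \<epsilon> s
        = (LBINT \<eta>. complex_of_real (\<rho> \<eta>) * exp (- \<i> * complex_of_real ((\<eta> /\<^sub>R \<epsilon>) \<bullet> s)))" for s
      unfolding k_def \<Phi>_def \<phi>_def \<rho>_def by (rule gauss_average_autocorr[OF u \<epsilon>])
    have "complex_of_real k * (LBINT s. a s * \<Phi> \<epsilon> s) = (LBINT s. a s * (complex_of_real k * \<Phi> \<epsilon> s))"
      by (simp add: mult.left_commute flip: Bochner_Integration.integral_mult_right_zero)
    also have "\<dots> = (LBINT s. LBINT \<eta>. a s * complex_of_real (\<rho> \<eta>) * exp (- \<i> * complex_of_real ((\<eta> /\<^sub>R \<epsilon>) \<bullet> s)))"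
      unfolding \<Phi>_eq by (simp add: mult.assoc)
    also have "\<dots> = (LBINT \<eta>. LBINT s. a s * complex_of_real (\<rho> \<eta>) * exp (- \<i> * complex_of_real ((\<eta> /\<^sub>R \<epsilon>) \<bullet> s)))"
      by (rule lborel_pair.Fubini_integral[symmetric], rule integrable_pair_product[OF a, of _ _ 1]) (use \<rho>_int in auto)
    also have "\<dots> = (LBINT \<eta>. ?h \<eta>)"
      unfolding fourier_def by (simp add: mult_ac flip: Bochner_Integration.integral_mult_right_zero)
    finally have a\<Phi>: "complex_of_real k * (LBINT s. a s * \<Phi> \<epsilon> s)
        = (LBINT \<eta>. ?h \<eta>)" .
    have Re_k: "k * Re z = Re (complex_of_real k * z)" for z by simp
    have \<rho>a_int: "integrable lborel (\<lambda>\<eta>. ?h \<eta>)"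
    proof (rule Bochner_Integration.integrable_bound)
      show "integrable lborel (\<lambda>\<eta>. \<rho> \<eta> * (LBINT \<xi>. cmod (a \<xi>)))" using \<rho>_int by simp
      show "AE \<eta> in lborel. norm (?h \<eta>) \<le> norm (\<rho> \<eta> * (LBINT \<xi>. cmod (a \<xi>)))"
        using norm_fourier_le[of a]
        by (auto simp: norm_mult abs_mult intro!: AE_I2 mult_left_mono)
    qed measurable
    have "k * Re (LBINT s. a s * \<Phi> \<epsilon> s) = Re (LBINT \<eta>. ?h \<eta>)"
      unfolding Re_k a\<Phi> ..
    also have "Re (LBINT \<eta>. ?h \<eta>)
        = (LBINT \<eta>. Re (?h \<eta>))"
      by (rule integral_Re[OF \<rho>a_int, symmetric])
    also have "\<dots> \<ge> (LBINT \<eta>. m * \<rho> \<eta>)"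
    proof (rule Bochner_Integration.integral_mono)
      show "integrable lborel (\<lambda>\<eta>. m * \<rho> \<eta>)" using \<rho>_int by simp
      show "integrable lborel (\<lambda>\<eta>. Re (?h \<eta>))"
        by (rule integrable_Re[OF \<rho>a_int])
      show "m * \<rho> \<eta> \<le> Re (?h \<eta>)" for \<eta>
        using mult_right_mono[OF m \<rho>_nonneg] by (simp add: mult.commute)
    qed
    finally have le: "m * (LBINT \<eta>. \<rho> \<eta>) \<le> k * Re (LBINT s. a s * \<Phi> \<epsilon> s)" by simp
    \<comment> \<open>At \<open>s = 0\<close> the phase is 1, so up to \<open>k\<close> the smoothed
      autocorrelation is the total mass of \<rho>.\<close>
    have "complex_of_real k * \<Phi> \<epsilon> 0 = complex_of_real (LBINT \<eta>. \<rho> \<eta>)"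
      using \<Phi>_eq[of 0] by simp
    then have "k * Re (\<Phi> \<epsilon> 0) = (LBINT \<eta>. \<rho> \<eta>)"
      unfolding Re_k by simp
    then have "k * (m * Re (\<Phi> \<epsilon> 0)) \<le> k * Re (LBINT s. a s * \<Phi> \<epsilon> s)" using le by (metis mult.left_commute)
    then show ?thesis using k by simp
  qed
  define \<epsilon> where "\<epsilon> n = 1 / real (Suc n)" for n
  have \<epsilon>: "\<epsilon> n > 0" for n by (simp add: \<epsilon>_def)
  have \<epsilon>0: "\<epsilon> \<longlonglongrightarrow> 0"
    unfolding \<epsilon>_def by (rule LIMSEQ_one_over_Suc)
  have g_int: "integrable lborel (\<lambda>\<tau>::real ^ 'n. M * gauss \<tau>)" using integrable_gauss[where 'a = "real ^ 'n"] by simp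
  have \<Phi>_le: "cmod (\<phi> (s + e *\<^sub>R \<tau>) * complex_of_real (gauss \<tau>)) \<le> M * gauss \<tau>" for s e \<tau>
    using M by (simp add: norm_mult gauss_nonneg mult_right_mono)
  have \<Phi>_lim: "(\<lambda>n. \<Phi> (\<epsilon> n) s) \<longlonglongrightarrow> \<phi> s" for s
  proof -
    have "(\<lambda>n. \<Phi> (\<epsilon> n) s) \<longlonglongrightarrow> (LBINT \<tau>. \<phi> s * complex_of_real (gauss (\<tau> :: real ^ 'n)))"
      unfolding \<Phi>_def
    proof (rule integral_dominated_convergence[where w = "\<lambda>\<tau>. M * gauss \<tau>"])
      have "(\<lambda>n. \<phi> (s + \<epsilon> n *\<^sub>R \<tau>)) \<longlonglongrightarrow> \<phi> (s + 0 *\<^sub>R \<tau>)" for \<tau>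
      proof (rule continuous_on_tendsto_compose[OF Cc_continuous[OF \<phi>, of UNIV]])
        show "(\<lambda>n. s + \<epsilon> n *\<^sub>R \<tau>) \<longlonglongrightarrow> s + 0 *\<^sub>R \<tau>" by (intro tendsto_intros \<epsilon>0)
      qed auto
      then show "AE \<tau> in lborel. (\<lambda>n. \<phi> (s + \<epsilon> n *\<^sub>R \<tau>) * complex_of_real (gauss \<tau>)) \<longlonglongrightarrow> \<phi> s * complex_of_real (gauss \<tau>)"
        by (intro AE_I2 tendsto_mult_right) simp
    qed (use \<Phi>_le g_int in auto)
    also have "(LBINT \<tau>. \<phi> s * complex_of_real (gauss (\<tau> :: real ^ 'n))) = \<phi> s" by (simp add: integral_gauss)
    finally show ?thesis .
  qed
  have \<Phi>_bd: "cmod (\<Phi> e s) \<le> M" for e s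
  proof -
    have "cmod (\<Phi> e s) \<le> (LBINT \<tau>. M * gauss (\<tau> :: real ^ 'n))"
      unfolding \<Phi>_def
    proof (rule Bochner_Integration.integral_norm_bound_integral[OF _ g_int \<Phi>_le])
      show "integrable lborel (\<lambda>\<tau>. \<phi> (s + e *\<^sub>R \<tau>) * complex_of_real (gauss \<tau>))"
        by (rule Bochner_Integration.integrable_bound[OF g_int])
          (auto intro!: order_trans[OF \<Phi>_le abs_ge_self])
    qed
    then show ?thesis by (simp add: integral_gauss)
  qed
  have "(\<lambda>n. LBINT s. a s * \<Phi> (\<epsilon> n) s) \<longlonglongrightarrow> (LBINT s. a s * \<phi> s)"
  proof (rule integral_dominated_convergence[where w = "\<lambda>s. cmod (a s) * M"])
    show "integrable lborel (\<lambda>s. cmod (a s) * M)" using a by simp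
    show "AE s in lborel. (\<lambda>n. a s * \<Phi> (\<epsilon> n) s) \<longlonglongrightarrow> a s * \<phi> s"
      by (intro AE_I2 tendsto_mult_left \<Phi>_lim)
    show "AE s in lborel. norm (a s * \<Phi> (\<epsilon> n) s) \<le> cmod (a s) * M" for n
      using \<Phi>_bd by (simp add: norm_mult mult_left_mono)
  qed measurable
  then have "(\<lambda>n. Re (LBINT s. a s * \<Phi> (\<epsilon> n) s)) \<longlonglongrightarrow> Re (LBINT s. a s * \<phi> s)" by (rule tendsto_Re)
  moreover have "(\<lambda>n. m * Re (\<Phi> (\<epsilon> n) 0)) \<longlonglongrightarrow> m * Re (\<phi> 0)"
    by (intro tendsto_mult_left tendsto_Re \<Phi>_lim)
  ultimately have "m * Re (\<phi> 0) \<le> Re (LBINT s. a s * \<phi> s)"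
    using smoothed[OF \<epsilon>] by (intro LIMSEQ_le) auto
  also have "Re (LBINT s. a s * \<phi> s) = inner (conv_op a (l2_abs u)) (l2_abs u)"
    unfolding \<phi>_def inner_conv_op[OF a Cc_L2[OF u] Cc_L2[OF u]]
      conv_form_eq_autocorr[OF a Cc_integrable[OF u] Cc_L2[OF u] Mu] ..
  finally show ?thesis unfolding \<phi>_def autocorr_0[OF u] by simp
qed

text \<open>Both sides are continuous in the norm, so the inequality extends from the dense class
  \<open>Cc\<close>.\<close>

lemma conv_form_lower_bound:
  fixes a :: "real ^ 'n \<Rightarrow> complex"
  assumes a: "integrable lborel a" and m: "\<And>\<xi>. m \<le> Re (fourier a \<xi>)"
  shows "m * (norm u)\<^sup>2 \<le> inner (conv_op a u) u"
proof -
  have "\<exists>g. Cc g \<and> (LBINT x. norm (l2_fun u x - g x) ^ 2) < (1 / real (Suc n))\<^sup>2" for n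
    using Cc_dense[of "l2_fun u" 2 "(1 / real (Suc n))\<^sup>2"] L2_integrable[OF l2_fun_L2, of u] l2_fun_measurable[of u] by auto
  then obtain g where g: "\<And>n. Cc (g n)" "\<And>n. (LBINT x. norm (l2_fun u x - g n x) ^ 2) < (1 / real (Suc n))\<^sup>2"
    by metis
  define v where "v n = l2_abs (g n)" for n
  have "norm (u - v n) \<le> 1 / real (Suc n)" for n
  proof -
    have "u - v n = l2_abs (\<lambda>x. l2_fun u x - g n x)"
      by (simp add: v_def l2_abs_diff Cc_L2 g(1))
    then have "norm (u - v n) = sqrt (LBINT x. norm (l2_fun u x - g n x) ^ 2)"
      by (simp add: norm_l2_abs L2_diff Cc_L2 g(1) L2_norm_def)
    also have "\<dots> \<le> sqrt ((1 / real (Suc n))\<^sup>2)" using g(2)[of n] by (intro real_sqrt_le_mono) simp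
    finally show ?thesis by simp
  qed
  then have "\<forall>\<^sub>F n in sequentially. norm (u - v n) \<le> 1 / real (Suc n)"
    by (intro always_eventually) blast
  then have "(\<lambda>n. u - v n) \<longlonglongrightarrow> 0" using LIMSEQ_one_over_Suc by (rule Lim_null_comparison)
  from tendsto_diff[OF tendsto_const[of u] this] have v: "v \<longlonglongrightarrow> u" by simp
  have "(\<lambda>n. m * (norm (v n))\<^sup>2) \<longlonglongrightarrow> m * (norm u)\<^sup>2" by (intro tendsto_intros v)
  moreover have "(\<lambda>n. inner (conv_op a (v n)) (v n)) \<longlonglongrightarrow> inner (conv_op a u) u"
    by (intro tendsto_intros v bounded_linear.tendsto[OF bounded_linear_conv_op[OF a]])
  ultimately show ?thesis
    using conv_form_lower_bound_Cc[OF a m g(1)] by (intro LIMSEQ_le) (auto simp: v_def)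
qed

section \<open>The sum of a convolution and a multiplication operator\<close>

lemma coercive_imp_bounded_below:
  fixes A :: "'a::real_inner \<Rightarrow> 'a"
  assumes "\<alpha> * (norm w)\<^sup>2 \<le> inner (A w) w"
  shows "(\<alpha> - \<kappa>) * norm w \<le> norm (A w - \<kappa> *\<^sub>R w)"
proof (cases "w = 0")
  case False
  have "(\<alpha> - \<kappa>) * norm w * norm w \<le> inner (A w - \<kappa> *\<^sub>R w) w"
    using assms by (simp add: inner_diff_left power2_norm_eq_inner[symmetric] power2_eq_square algebra_simps)
  also have "\<dots> \<le> norm (A w - \<kappa> *\<^sub>R w) * norm w" by (rule norm_cauchy_schwarz)
  finally show ?thesis using False by simp
qed simp

text \<open>On a subsequence \<open>A M\<close> converges; with the residual tending to 0, so does
  \<open>P\<close>, the product of the two shifted operators. A linear map bounded below reflects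
  Cauchy sequences, and completeness finishes the argument.\<close>

lemma palais_smale_sum:
  fixes A M :: "'a::{real_inner,complete_space} \<Rightarrow> 'a"
  assumes A: "bounded_linear A" "\<And>u v. inner (A u) v = inner u (A v)" "\<And>w. \<alpha> * (norm w)\<^sup>2 \<le> inner (A w) w"
    and M: "bounded_linear M" "\<And>u v. inner (M u) v = inner u (M v)" "\<And>w. \<beta> * (norm w)\<^sup>2 \<le> inner (M w) w"
    and comp: "precompact_op (\<lambda>u. A (M u))" and \<kappa>: "\<kappa> < \<alpha>" "\<kappa> < \<beta>"
  shows "palais_smale (\<lambda>u. A u + M u) \<kappa>"
proof (rule palais_smale.intro)
  show "bounded_linear (\<lambda>u. A u + M u)" using A(1) M(1) by (rule bounded_linear_add)
  show "inner (A u + M u) v = inner u (A v + M v)" for u v by (simp add: inner_add A(2) M(2))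
  fix x :: "nat \<Rightarrow> 'a"
  assume x1: "\<And>n. norm (x n) = 1" and x0: "(\<lambda>n. A (x n) + M (x n) - \<kappa> *\<^sub>R x n) \<longlonglongrightarrow> 0"
  obtain l r where r: "strict_mono (r :: nat \<Rightarrow> nat)" and l: "(\<lambda>n. A (M (x (r n)))) \<longlonglongrightarrow> l"
    by (rule precompact_op_convergent_subseq[OF comp, of x]) (simp_all add: x1)
  define D where "D w = (M w - \<kappa> *\<^sub>R w)" for w
  define P where "P w = A (D w) - \<kappa> *\<^sub>R D w" for w
  have linA: "linear A" and linM: "linear M" using A(1) M(1) by (auto intro: bounded_linear.linear)
  have P_eq: "P w = A (M w) - \<kappa> *\<^sub>R (A w + M w - \<kappa> *\<^sub>R w)" for w
    by (simp add: P_def D_def linear_diff[OF linA] linear_scale[OF linA] algebra_simps)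
  have D_diff: "D (v - w) = D v - D w" for v w
    by (simp add: D_def linear_diff[OF linM] algebra_simps)
  have P_diff: "P (v - w) = P v - P w" for v w
    by (simp add: P_def D_diff linear_diff[OF linA] algebra_simps)
  \<comment> \<open>The product of the coercivity gaps of the two factors; both are positive because
    \<kappa> lies below \<alpha> and \<beta>.\<close>
  define c where "c = (\<alpha> - \<kappa>) * (\<beta> - \<kappa>)"
  have c: "c > 0" using \<kappa> by (simp add: c_def)
  have P_below: "c * norm w \<le> norm (P w)" for w
  proof -
    have "c * norm w \<le> (\<alpha> - \<kappa>) * norm (D w)"
      using coercive_imp_bounded_below[where A = M, OF M(3)] \<kappa>(1) unfolding c_def D_def mult.assoc
      by (intro mult_left_mono) auto
    also have "\<dots> \<le> norm (P w)"
      unfolding P_def by (rule coercive_imp_bounded_below[where A = A, OF A(3)])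
    finally show ?thesis .
  qed
  have "(\<lambda>n. A (x (r n)) + M (x (r n)) - \<kappa> *\<^sub>R x (r n)) \<longlonglongrightarrow> 0"
    using LIMSEQ_subseq_LIMSEQ[OF x0 r] by (simp add: o_def)
  then have "(\<lambda>n. P (x (r n))) \<longlonglongrightarrow> l - \<kappa> *\<^sub>R 0"
    unfolding P_eq by (intro tendsto_intros l)
  then have "Cauchy (\<lambda>n. P (x (r n)))" by (rule LIMSEQ_imp_Cauchy)
  then have "Cauchy (\<lambda>n. x (r n))"
    unfolding Cauchy_iff
  proof (intro allI impI)
    fix e :: real
    assume *: "\<forall>e>0. \<exists>N. \<forall>m\<ge>N. \<forall>n\<ge>N. norm (P (x (r m)) - P (x (r n))) < e" and "e > 0"
    then have "c * e > 0" using c by simp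
    then obtain N where N: "\<And>m n. m \<ge> N \<Longrightarrow> n \<ge> N \<Longrightarrow> norm (P (x (r m)) - P (x (r n))) < c * e"
      using * by blast
    have "norm (x (r m) - x (r n)) < e" if "m \<ge> N" "n \<ge> N" for m n
    proof -
      have "c * norm (x (r m) - x (r n)) < c * e"
        using P_below[of "x (r m) - x (r n)"] N[OF that] by (simp add: P_diff)
      then show ?thesis using c by simp
    qed
    then show "\<exists>N. \<forall>m\<ge>N. \<forall>n\<ge>N. norm (x (r m) - x (r n)) < e" by blast
  qed
  then obtain l' where "(\<lambda>n. x (r n)) \<longlonglongrightarrow> l'" using Cauchy_convergent by (auto simp: convergent_def)
  then show "\<exists>l r. strict_mono (r :: nat \<Rightarrow> nat) \<and> (x \<circ> r) \<longlonglongrightarrow> l"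
    using r by (auto simp: o_def)
qed

lemma mult_form_lower_bound:
  fixes V :: "'a::euclidean_space \<Rightarrow> complex"
  assumes V [measurable]: "V \<in> borel_measurable lborel" and B: "\<And>x. cmod (V x) \<le> B" and m: "\<And>x. m \<le> Re (V x)"
  shows "m * (norm u)\<^sup>2 \<le> inner (mult_op V u) u"
proof -
  have Vu: "(\<lambda>x. V x * l2_fun u x) \<in> L2 lborel" by (rule L2_bounded_mult[OF l2_fun_L2 V B])
  have eq: "Re (V x * l2_fun u x * cnj (l2_fun u x)) = Re (V x) * (cmod (l2_fun u x))\<^sup>2" for x
  proof -
    have "V x * l2_fun u x * cnj (l2_fun u x) = V x * complex_of_real ((cmod (l2_fun u x))\<^sup>2)"
      by (simp only: mult.assoc complex_norm_square)
    moreover have "Re (z * complex_of_real c) = Re z * c" for z c by simp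
    ultimately show ?thesis by (simp only:)
  qed
  have "m * (norm u)\<^sup>2 = (LBINT x. m * (cmod (l2_fun u x))\<^sup>2)"
    by (simp add: norm_l2_eq L2_norm_def integral_nonneg_AE)
  also have "\<dots> \<le> (LBINT x. Re (V x) * (cmod (l2_fun u x))\<^sup>2)"
  proof (rule Bochner_Integration.integral_mono)
    show "integrable lborel (\<lambda>x. m * (cmod (l2_fun u x))\<^sup>2)" using L2_integrable[OF l2_fun_L2, of u] by simp
    show "integrable lborel (\<lambda>x. Re (V x) * (cmod (l2_fun u x))\<^sup>2)"
      using integrable_Re[OF L2_integrable_mult_cnj[OF Vu l2_fun_L2, of u]] unfolding eq .
  qed (use m in \<open>auto intro: mult_right_mono\<close>)
  also have "\<dots> = inner (l2_abs (\<lambda>x. V x * l2_fun u x)) (l2_abs (l2_fun u))"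
    unfolding inner_l2_abs[OF Vu l2_fun_L2] eq ..
  finally show ?thesis by (simp add: mult_op_def)
qed

section \<open>The operator of the theorem as a lifted symmetric operator\<close>

lemma L_op_eq: "L_op a V f = (\<lambda>x. conv a f x + V x * f x)"
  by (rule ext) (simp add: L_op_def conv_def)

lemma l2_complex_symmetric_L_op:
  fixes a V :: "real ^ 'n \<Rightarrow> complex"
  assumes a: "integrable lborel a" and herm: "AE x in lborel. a (- x) = cnj (a x)"
    and V [measurable]: "V \<in> borel_measurable lborel" and B: "\<And>x. cmod (V x) \<le> B" and real: "\<And>x. cnj (V x) = V x"
  shows "l2_complex_symmetric (L_op a V)" and "l2_lift (L_op a V) = (\<lambda>u. conv_op a u + mult_op V u)"
proof -
  interpret conv: l2_operator "conv a" by (rule l2_operator_conv[OF a])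
  have T_L2: "L_op a V f \<in> L2 lborel" if "f \<in> L2 lborel" for f
    unfolding L_op_eq by (intro L2_add conv.maps_L2 L2_bounded_mult[OF _ V B] that)
  show lift: "l2_lift (L_op a V) = (\<lambda>u. conv_op a u + mult_op V u)"
    by (rule ext) (simp add: l2_lift_def L_op_eq mult_op_def l2_abs_add conv.maps_L2 L2_bounded_mult[OF _ V B])
  have i: "AE x in lborel. l2_fun (mult_op (\<lambda>_. \<i>) u) x = \<i> * l2_fun u x" for u :: "(real ^ 'n) l2"
    by (rule l2_fun_mult_op[of _ 1]) auto
  have conv_i: "conv_op a (mult_op (\<lambda>_. \<i>) u) = mult_op (\<lambda>_. \<i>) (conv_op a u)" for u
  proof -
    have "conv_op a (mult_op (\<lambda>_. \<i>) u) = l2_abs (conv a (\<lambda>x. \<i> * l2_fun u x))"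
      unfolding mult_op_def by (intro conv.l2_lift_abs L2_cmult l2_fun_L2)
    also have "\<dots> = l2_abs (\<lambda>x. \<i> * conv a (l2_fun u) x)" by (simp add: conv_cmult[abs_def])
    also have "\<dots> = mult_op (\<lambda>_. \<i>) (conv_op a u)"
      unfolding l2_lift_def by (rule mult_op_abs[of _ 1, symmetric]) (auto intro: conv.maps_L2)
    finally show ?thesis .
  qed
  have mult_i: "mult_op V (mult_op (\<lambda>_. \<i>) u) = mult_op (\<lambda>_. \<i>) (mult_op V u)" for u
    by (rule l2_eqI) (use i[of u] i[of "mult_op V u"] l2_fun_mult_op[OF V B, of u]
      l2_fun_mult_op[OF V B, of "mult_op (\<lambda>_. \<i>) u"] in eventually_elim, simp)
  show "l2_complex_symmetric (L_op a V)"
  proof (intro l2_complex_symmetric.intro l2_operator.intro l2_complex_symmetric_axioms.intro)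
    show "f \<in> L2 lborel \<Longrightarrow> L_op a V f \<in> L2 lborel" for f by (rule T_L2)
    show "AE x in lborel. L_op a V f x = L_op a V g x"
      if "f \<in> L2 lborel" "g \<in> L2 lborel" "AE x in lborel. f x = g x" for f g
      using conv.cong_AE[OF that] that(3) by eventually_elim (simp add: L_op_eq)
    show "bounded_linear (l2_lift (L_op a V))"
      unfolding lift by (intro bounded_linear_add bounded_linear_conv_op a bounded_linear_mult_op[OF V B])
    show "inner (l2_lift (L_op a V) u) v = inner u (l2_lift (L_op a V) v)" for u v
      unfolding lift inner_add conv_op_symmetric[OF a herm] inner_mult_op[OF V B] real ..
    show "l2_lift (L_op a V) (mult_op (\<lambda>_. \<i>) u) = mult_op (\<lambda>_. \<i>) (l2_lift (L_op a V) u)" for u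
      unfolding lift conv_i mult_i
      by (rule linear_add[OF bounded_linear.linear[OF bounded_linear_mult_op[of _ 1]], symmetric]) auto
  qed
qed

section \<open>The indicator of a cube as a trial function\<close>

lemma cube_eq_cbox: "cube r x0 = cbox (\<chi> i. x0 $ i - r / 2) (\<chi> i. x0 $ i + r / 2)"
proof -
  have eq: "\<bar>p - c\<bar> \<le> h \<longleftrightarrow> c - h \<le> p \<and> p \<le> c + h" for p c h :: real by linarith
  show ?thesis by (simp only: cube_def set_eq_iff mem_Collect_eq mem_box_cart vec_lambda_beta eq simp_thms)
qed

lemma cube_sets [measurable]: "cube r x0 \<in> sets borel"
  by (simp add: cube_eq_cbox)

text \<open>A cube meets its translate in a box with side \<open>r - |t_i|\<close> in direction
  \<open>i\<close>. The truncation at 0 handles an empty intersection, where two negative factors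
  could otherwise give a positive product.\<close>

lemma measure_cube_Int_translate:
  fixes x0 t :: "real ^ 'n"
  assumes r: "r > 0"
  shows "measure lborel {y. y \<in> cube r x0 \<and> y + t \<in> cube r x0} = (\<Prod>i\<in>UNIV. max 0 (r - \<bar>t $ i\<bar>))"
proof -
  \<comment> \<open>A negative coordinate of \<open>t\<close> raises the lower face of the box, a
    positive one lowers the upper face; hence the positive parts of \<open>-t\<close> and
    \<open>t\<close>.\<close>
  define p where "p = (\<chi> i. x0 $ i - r / 2 + max 0 (- t $ i))"
  define q where "q = (\<chi> i. x0 $ i + r / 2 - max 0 (t $ i))"
  have eq: "{y. y \<in> cube r x0 \<and> y + t \<in> cube r x0} = cbox p q"
  proof -
    have "(\<bar>y $ i - x0 $ i\<bar> \<le> r / 2 \<and> \<bar>(y + t) $ i - x0 $ i\<bar> \<le> r / 2) \<longleftrightarrow> (p $ i \<le> y $ i \<and> y $ i \<le> q $ i)" for y i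
    proof -
      have "(\<bar>b - c\<bar> \<le> h \<and> \<bar>b + d - c\<bar> \<le> h) \<longleftrightarrow> (c - h + max 0 (- d) \<le> b \<and> b \<le> c + h - max 0 d)"
        for b c d h :: real by (auto simp: max_def abs_le_iff)
      then show ?thesis unfolding p_def q_def vector_add_component vec_lambda_beta .
    qed
    then show ?thesis unfolding cube_def set_eq_iff mem_Collect_eq mem_box_cart by blast
  qed
  have pq: "q $ i - p $ i = r - \<bar>t $ i\<bar>" for i by (simp add: p_def q_def max_def)
  show ?thesis
  proof (cases "\<forall>i. \<bar>t $ i\<bar> \<le> r")
    case True
    then have ne: "cbox p q \<noteq> {}" using pq by (auto simp: interval_ne_empty_cart) (smt (verit))
    have "measure lborel (cbox p q) = (\<Prod>i\<in>UNIV. q $ i - p $ i)" by (rule content_cbox_cart[OF ne])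
    also have "\<dots> = (\<Prod>i\<in>UNIV. max 0 (r - \<bar>t $ i\<bar>))"
      using True by (intro prod.cong) (auto simp: pq)
    finally show ?thesis unfolding eq .
  next
    case False
    then obtain i where i: "r < \<bar>t $ i\<bar>" by (auto simp: not_le)
    then have "q $ i < p $ i" using pq[of i] by linarith
    then have "cbox p q = {}" by (auto simp: interval_eq_empty_cart)
    moreover have "(\<Prod>i\<in>UNIV. max 0 (r - \<bar>t $ i\<bar>)) = 0"
      using i by (intro prod_zero[OF finite] bexI[of _ i]) auto
    ultimately show ?thesis unfolding eq by simp
  qed
qed

lemma measure_cube: "r > 0 \<Longrightarrow> measure lborel (cube r (x0 :: real ^ 'n)) = r ^ CARD('n)"
  using measure_cube_Int_translate[of r x0 0] by simp

lemma cube_finite_measure: "emeasure lborel (cube r x0) < \<infinity>"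
  unfolding cube_eq_cbox by (rule emeasure_lborel_cbox_finite)

definition cube_fun :: "real \<Rightarrow> real ^ 'n \<Rightarrow> real ^ 'n \<Rightarrow> complex" where
  "cube_fun r x0 x = indicator (cube r x0) x"

lemma cube_fun_measurable [measurable]: "cube_fun r x0 \<in> borel_measurable borel"
  unfolding cube_fun_def[abs_def] by measurable

lemma cube_fun_integrable: "integrable lborel (cube_fun r x0)"
proof -
  have "integrable lborel (\<lambda>x. complex_of_real (indicator (cube r x0) x))"
    using cube_finite_measure[of r x0] by simp
  moreover have "complex_of_real (indicator (cube r x0) x) = cube_fun r x0 x" for x
    by (simp add: cube_fun_def indicator_def)
  ultimately show ?thesis by (simp add: eta_contract_eq)
qed

lemma cmod_cube_fun: "(cmod (cube_fun r x0 x))\<^sup>2 = indicator (cube r x0) x" "cmod (cube_fun r x0 x) \<le> 1"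
  by (auto simp: cube_fun_def indicator_def)

lemma cube_fun_L2: "cube_fun r x0 \<in> L2 lborel"
  using cube_finite_measure[of r x0] by (simp add: L2_def cmod_cube_fun)

lemma norm_cube_fun:
  assumes "r > 0"
  shows "(norm (l2_abs (cube_fun r (x0 :: real ^ 'n))))\<^sup>2 = r ^ CARD('n)"
  using assms by (simp add: norm_l2_abs cube_fun_L2 L2_norm_def cmod_cube_fun measure_cube)

lemma autocorr_cube_fun:
  assumes "r > 0"
  shows "autocorr (cube_fun r x0) t = complex_of_real (\<Prod>i\<in>UNIV. max 0 (r - \<bar>t $ i\<bar>))"
proof -
  define S where "S = {y. y \<in> cube r x0 \<and> y + t \<in> cube r x0}"
  have "cube_fun r x0 y * cnj (cube_fun r x0 (y + t)) = complex_of_real (indicator S y)" for y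
    by (auto simp: cube_fun_def indicator_def S_def)
  then have "autocorr (cube_fun r x0) t = complex_of_real (measure lborel S)"
    by (simp add: autocorr_def)
  then show ?thesis unfolding S_def measure_cube_Int_translate[OF assms] .
qed

text \<open>The autocorrelation of the cube is a product of tent functions. Scaling
  \<open>t = r x\<close> gives \<open>r^d\<close> as Jacobian and another \<open>r^d\<close> from
  the tents; the unit tents vanish outside \<open>cube 2 0\<close>, which is the origin of that
  domain and of the weight.\<close>

lemma conv_form_cube_fun:
  fixes a :: "real ^ 'n \<Rightarrow> complex"
  assumes a: "integrable lborel a" and r: "r > 0"
  shows "inner (conv_op a (l2_abs (cube_fun r x0))) (l2_abs (cube_fun r x0))
    = (r ^ CARD('n))\<^sup>2 * (LINT x : cube 2 0 | lborel. ((\<Prod>i\<in>UNIV. (1 - \<bar>x $ i\<bar>)) * Re (a (r *\<^sub>R x))))"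
proof -
  let ?q = "cube_fun r x0"
  have [measurable]: "a \<in> borel_measurable borel" by (rule conv_kernel_measurable[OF a])
  define k where "k t = (\<Prod>i\<in>UNIV. max 0 (r - \<bar>t $ i\<bar>))" for t :: "real ^ 'n"
  have k0: "0 \<le> k t" for t unfolding k_def by (intro prod_nonneg) auto
  have k_le: "k t \<le> r ^ CARD('n)" for t
    unfolding k_def using prod_mono[of UNIV "\<lambda>i. max 0 (r - \<bar>t $ i\<bar>)" "\<lambda>_. r"] r by simp
  have [measurable]: "k \<in> borel_measurable borel"
    unfolding k_def[abs_def] by measurable
  have ak: "integrable lborel (\<lambda>t. a t * complex_of_real (k t))"
  proof (rule Bochner_Integration.integrable_bound)
    show "integrable lborel (\<lambda>t. cmod (a t) * r ^ CARD('n))" using a by simp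
    show "AE t in lborel. norm (a t * complex_of_real (k t)) \<le> norm (cmod (a t) * r ^ CARD('n))"
      using k0 k_le r by (auto simp: norm_mult abs_mult intro!: AE_I2 mult_left_mono)
  qed measurable
  have "inner (conv_op a (l2_abs ?q)) (l2_abs ?q) = Re (LBINT t. a t * complex_of_real (k t))"
    unfolding inner_conv_op[OF a cube_fun_L2 cube_fun_L2]
      conv_form_eq_autocorr[OF a cube_fun_integrable cube_fun_L2 cmod_cube_fun(2)] autocorr_cube_fun[OF r] k_def ..
  also have "\<dots> = (LBINT t. Re (a t * complex_of_real (k t)))" by (rule integral_Re[OF ak, symmetric])
  also have "\<dots> = r ^ CARD('n) * (LBINT x. Re (a (r *\<^sub>R x) * complex_of_real (k (r *\<^sub>R x))))"
    using integral_lborel_affine[of r "\<lambda>t. Re (a t * complex_of_real (k t))" 0] r by simp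
  also have "(\<lambda>x. Re (a (r *\<^sub>R x) * complex_of_real (k (r *\<^sub>R x))))
      = (\<lambda>x. r ^ CARD('n) * (indicator (cube 2 0) x *\<^sub>R ((\<Prod>i\<in>UNIV. (1 - \<bar>x $ i\<bar>)) * Re (a (r *\<^sub>R x)))))"
  proof (rule ext)
    fix x :: "real ^ 'n"
    have "max 0 (r - \<bar>(r *\<^sub>R x) $ i\<bar>) = r * max 0 (1 - \<bar>x $ i\<bar>)" for i
      using r by (auto simp: max_def abs_mult algebra_simps mult_le_cancel_left1)
    then have kx: "k (r *\<^sub>R x) = r ^ CARD('n) * (\<Prod>i\<in>UNIV. max 0 (1 - \<bar>x $ i\<bar>))"
      by (simp add: k_def prod.distrib)
    have "(\<Prod>i\<in>UNIV. max 0 (1 - \<bar>x $ i\<bar>)) = indicator (cube 2 0) x * (\<Prod>i\<in>UNIV. 1 - \<bar>x $ i\<bar>)"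
    proof (cases "x \<in> cube 2 0")
      case True
      then show ?thesis by (auto simp: cube_def intro!: prod.cong)
    next
      case False
      then obtain i where "\<bar>x $ i\<bar> > 1" by (auto simp: cube_def not_le)
      then have "(\<Prod>i\<in>UNIV. max 0 (1 - \<bar>x $ i\<bar>)) = 0" by (intro prod_zero[OF finite] bexI[of _ i]) auto
      then show ?thesis using False by simp
    qed
    then show "Re (a (r *\<^sub>R x) * complex_of_real (k (r *\<^sub>R x)))
        = r ^ CARD('n) * (indicator (cube 2 0) x *\<^sub>R ((\<Prod>i\<in>UNIV. (1 - \<bar>x $ i\<bar>)) * Re (a (r *\<^sub>R x))))"
      unfolding kx by (simp del: of_real_mult of_real_prod)
  qed
  finally show ?thesis by (simp add: set_lebesgue_integral_def power2_eq_square)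
qed

text \<open>Here only the Jacobian of \<open>x0 + r x\<close> appears, one power \<open>r^d\<close>
  against two in the convolution form. Subtracting \<open>m\<close> times the squared norm
  \<open>r^d\<close> moves the constant under the integral.\<close>

lemma mult_form_cube_fun:
  fixes V :: "real ^ 'n \<Rightarrow> complex"
  assumes V [measurable]: "V \<in> borel_measurable lborel" and B: "\<And>x. cmod (V x) \<le> B" and r: "r > 0"
  shows "inner (mult_op V (l2_abs (cube_fun r x0))) (l2_abs (cube_fun r x0)) - m * (norm (l2_abs (cube_fun r x0)))\<^sup>2
    = r ^ CARD('n) * (LINT x : cube 1 0 | lborel. (Re (V (x0 + r *\<^sub>R x)) - m))"
proof -
  let ?q = "cube_fun r x0"
  let ?Q = "indicator (cube r x0) :: _ \<Rightarrow> real"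
  have Vc: "(\<lambda>x. V x * ?q x) \<in> L2 lborel" by (rule L2_bounded_mult[OF cube_fun_L2 V B])
  have eq: "Re (V x * ?q x * cnj (?q x)) = ?Q x * Re (V x)" for x
    by (simp add: cube_fun_def indicator_def)
  have int: "integrable lborel (\<lambda>x. ?Q x * Re (V x))"
    using integrable_Re[OF L2_integrable_mult_cnj[OF Vc cube_fun_L2[of r x0]]] unfolding eq .
  have int_m: "integrable lborel (\<lambda>x. ?Q x * m)"
    using cube_finite_measure[of r x0] by (intro integrable_mult_left integrable_real_indicator) auto
  have "inner (mult_op V (l2_abs ?q)) (l2_abs ?q) - m * (norm (l2_abs ?q))\<^sup>2
      = (LBINT x. ?Q x * Re (V x)) - (LBINT x. ?Q x * m)"
    unfolding mult_op_abs[OF V B cube_fun_L2] inner_l2_abs[OF Vc cube_fun_L2] eq norm_cube_fun[OF r]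
    using r by (simp add: measure_cube)
  also have "\<dots> = (LBINT x. ?Q x * Re (V x) - ?Q x * m)"
    by (rule Bochner_Integration.integral_diff[OF int int_m, symmetric])
  also have "\<dots> = r ^ CARD('n) * (LBINT x. ?Q (x0 + r *\<^sub>R x) * Re (V (x0 + r *\<^sub>R x))
      - ?Q (x0 + r *\<^sub>R x) * m)"
    using integral_lborel_affine[of r "\<lambda>x. ?Q x * Re (V x) - ?Q x * m" x0] r by simp
  also have "(\<lambda>x. ?Q (x0 + r *\<^sub>R x) * Re (V (x0 + r *\<^sub>R x)) - ?Q (x0 + r *\<^sub>R x) * m)
      = (\<lambda>x. indicator (cube 1 0) x *\<^sub>R (Re (V (x0 + r *\<^sub>R x)) - m))"
  proof (rule ext)
    fix x :: "real ^ 'n"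
    have "x0 + r *\<^sub>R x \<in> cube r x0 \<longleftrightarrow> x \<in> cube 1 0"
      using r by (simp add: cube_def abs_mult field_simps)
    then show "?Q (x0 + r *\<^sub>R x) * Re (V (x0 + r *\<^sub>R x)) - ?Q (x0 + r *\<^sub>R x) * m
      = indicator (cube 1 0) x *\<^sub>R (Re (V (x0 + r *\<^sub>R x)) - m)"
      by (simp add: indicator_def)
  qed
  finally show ?thesis by (simp add: set_lebesgue_integral_def)
qed

text \<open>The transform is bounded by the \<open>L^1\<close> norm, so the infimum is over a set
  bounded below and is a genuine lower bound.\<close>

lemma inf_Re_fourier_le:
  fixes u :: "real ^ 'n \<Rightarrow> complex"
  shows "inf_Re (fourier u) \<le> Re (fourier u \<xi>)"
  unfolding inf_Re_def
proof (rule cINF_lower)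
  show "bdd_below (range (\<lambda>x. Re (fourier u x)))"
  proof (rule bdd_belowI2)
    show "- (LBINT \<xi>. cmod (u \<xi>)) \<le> Re (fourier u x)" for x
      using abs_Re_le_cmod[of "fourier u x"] norm_fourier_le[of u x] by linarith
  qed
qed simp

theorem theorem2p2:
  fixes a V Vh :: "real ^ 'n \<Rightarrow> complex"
    and x0 :: "real ^ 'n"
    and a_min V_min \<mu>0 :: real
  assumes a_L1: "integrable lborel a"
    and a_herm: "AE x in lborel. a (- x) = cnj (a x)"
    and Vh_L1: "integrable lborel Vh"
    and Vh_herm: "AE x in lborel. Vh (- x) = cnj (Vh x)"
    and V_eq: "V = fourier Vh"
    and a_min: "a_min = inf_Re (fourier a)"
    and V_min: "V_min = inf_Re V"
    and mu0: "\<mu>0 = min a_min V_min"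
    and x0_min: "\<forall>x. Re (V x0) \<le> Re (V x)"
    and V_le_a: "V_min \<le> a_min"
    and delta: "\<exists>\<delta>>0.
      (LINT x : cube 2 0 | lborel. ((\<Prod>i\<in>UNIV. (1 - \<bar>x $ i\<bar>)) * Re (a (\<delta> *\<^sub>R x))))
      + (1 / \<delta> ^ CARD('n)) * (LINT x : cube 1 0 | lborel. (Re (V (x0 + \<delta> *\<^sub>R x)) - V_min)) < 0"
  shows "complex_of_real ` {a_min + V_min ..< \<mu>0} \<inter> discrete_spectrum lborel (L_op a V) \<noteq> {}"
proof -
  define B where "B = (\<integral>\<xi>. cmod (Vh \<xi>) \<partial>lborel)"
  have V_cont: "continuous_on UNIV V" unfolding V_eq by (rule continuous_fourier[OF Vh_L1])
  then have V_meas: "V \<in> borel_measurable lborel" by (auto intro: borel_measurable_continuous_onI)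
  have B: "cmod (V x) \<le> B" for x unfolding V_eq B_def by (rule norm_fourier_le)
  have V_real: "cnj (V x) = V x" for x unfolding V_eq by (rule fourier_hermitian_real[OF Vh_L1 Vh_herm])
  have V_ge: "V_min \<le> Re (V x)" for x unfolding V_min V_eq by (rule inf_Re_fourier_le)
  have a_ge: "a_min \<le> Re (fourier a \<xi>)" for \<xi> unfolding a_min by (rule inf_Re_fourier_le)
  define A where "A = conv_op a"
  define M where "M = mult_op V"
  define L where "L = l2_lift (L_op a V)"
  interpret L: l2_complex_symmetric "L_op a V"
    by (rule l2_complex_symmetric_L_op[OF a_L1 a_herm V_meas B V_real])
  have L_eq: "L = (\<lambda>u. A u + M u)"
    unfolding L_def A_def M_def by (rule l2_complex_symmetric_L_op[OF a_L1 a_herm V_meas B V_real])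
  have A_ge: "a_min * (norm u)\<^sup>2 \<le> inner (A u) u" for u
    unfolding A_def by (rule conv_form_lower_bound[OF a_L1 a_ge])
  have M_ge: "V_min * (norm u)\<^sup>2 \<le> inner (M u) u" for u
    unfolding M_def by (rule mult_form_lower_bound[OF V_meas B V_ge])
  define I1 where "I1 r = (LINT x : cube 2 0 | lborel. ((\<Prod>i\<in>UNIV. (1 - \<bar>x $ i\<bar>)) * Re (a (r *\<^sub>R x))))" for r
  define I2 where "I2 r = (LINT x : cube 1 0 | lborel. (Re (V (x0 + r *\<^sub>R x)) - V_min))" for r
  obtain \<delta> where \<delta>: "\<delta> > 0" and neg: "I1 \<delta> + (1 / \<delta> ^ CARD('n)) * I2 \<delta> < 0"
    using delta unfolding I1_def I2_def by blast
  define f where "f = l2_abs (cube_fun \<delta> x0)"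
  have "inner (L f) f - V_min * (norm f)\<^sup>2 < 0"
  proof -
    have "inner (L f) f - V_min * (norm f)\<^sup>2 = (\<delta> ^ CARD('n))\<^sup>2 * I1 \<delta> + \<delta> ^ CARD('n) * I2 \<delta>"
      using conv_form_cube_fun[OF a_L1 \<delta>, of x0] mult_form_cube_fun[OF V_meas B \<delta>, of x0 V_min]
      unfolding L_eq inner_add_left A_def M_def f_def I1_def I2_def by linarith
    \<comment> \<open>Factoring out \<open>\<delta>^(2d)\<close> leaves the expression that is
      assumed negative.\<close>
    also have "\<dots> = (\<delta> ^ CARD('n))\<^sup>2 * (I1 \<delta> + (1 / \<delta> ^ CARD('n)) * I2 \<delta>)"
      using \<delta> by (simp add: field_simps power2_eq_square)
    also have "\<dots> < 0" using neg \<delta> by (intro mult_pos_neg) auto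
    finally show ?thesis .
  qed
  moreover have f0: "norm f > 0"
  proof -
    have "(norm f)\<^sup>2 > 0" unfolding f_def norm_cube_fun[OF \<delta>] using \<delta> by simp
    then show ?thesis by simp
  qed
  have L_scale: "inner (L (c *\<^sub>R u)) (c *\<^sub>R u) = c\<^sup>2 * inner (L u) u" for c u
    using linear_scale[OF bounded_linear.linear[OF L.bounded_linear_lift]] unfolding L_def
    by (simp add: power2_eq_square)
  \<comment> \<open>Values of the form on unit vectors; homogeneity of degree two brings every
    nonzero vector, in particular the trial function \<open>f\<close>, into this set.\<close>
  define Q where "Q = (\<lambda>u. inner (L u) u) ` {u. norm u = 1}"
  define \<kappa> where "\<kappa> = Inf Q"
  have Q_normalised: "inner (L u) u / (norm u)\<^sup>2 \<in> Q" if "u \<noteq> 0" for u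
  proof -
    have "inner (L u) u / (norm u)\<^sup>2 = inner (L (u /\<^sub>R norm u)) (u /\<^sub>R norm u)"
      unfolding L_scale by (simp add: field_simps)
    moreover have "norm (u /\<^sub>R norm u) = 1" using that by simp
    ultimately show ?thesis unfolding Q_def by blast
  qed
  have Q_ge: "a_min + V_min \<le> q" if q: "q \<in> Q" for q
  proof -
    obtain u where u: "norm u = 1" "q = inner (L u) u" using q unfolding Q_def by blast
    show ?thesis using A_ge[of u] M_ge[of u] u(1) unfolding u(2) L_eq inner_add_left by simp
  qed
  have Q_ne: "Q \<noteq> {}" using Q_normalised[of f] f0 by auto
  have Q_bdd: "bdd_below Q" using Q_ge by (rule bdd_belowI)
  have \<kappa>_ge: "a_min + V_min \<le> \<kappa>" unfolding \<kappa>_def using Q_ne Q_ge by (rule cInf_greatest)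
  have \<kappa>_less: "\<kappa> < V_min"
  proof -
    have "\<kappa> \<le> inner (L f) f / (norm f)\<^sup>2"
      unfolding \<kappa>_def using f0 by (intro cInf_lower Q_normalised Q_bdd) auto
    also have "\<dots> < V_min" using \<open>inner (L f) f - V_min * (norm f)\<^sup>2 < 0\<close> f0 by (simp add: divide_less_eq)
    finally show ?thesis .
  qed
  have "palais_smale L \<kappa>"
    unfolding L_eq
  proof (rule palais_smale_sum)
    show "bounded_linear A" unfolding A_def by (rule bounded_linear_conv_op[OF a_L1])
    show "inner (A u) v = inner u (A v)" for u v unfolding A_def by (rule conv_op_symmetric[OF a_L1 a_herm])
    show "bounded_linear M" unfolding M_def by (rule bounded_linear_mult_op[OF V_meas B])
    show "inner (M u) v = inner u (M v)" for u v unfolding M_def inner_mult_op[OF V_meas B] V_real ..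
    show "precompact_op (\<lambda>u. A (M u))"
      unfolding A_def M_def
    proof (rule precompact_conv_mult[OF a_L1 V_cont _ B])
      show "\<exists>R. \<forall>x. norm x > R \<longrightarrow> cmod (V x) < e" if "e > 0" for e
        unfolding V_eq by (rule riemann_lebesgue[OF Vh_L1 that])
    qed
    \<comment> \<open>The trial function only places \<kappa> below \<open>V_min\<close>; the
      product argument needs it below \<open>a_min\<close> as well, and
      \<open>V_min \<le> a_min\<close> provides this.\<close>
    show "\<kappa> < a_min" "\<kappa> < V_min" using \<kappa>_less V_le_a by auto
  qed (rule A_ge M_ge)+
  then have "complex_of_real \<kappa> \<in> discrete_spectrum lborel (L_op a V)"
    unfolding L_def
  proof (rule L.bottom_in_discrete_spectrum)
    show "\<kappa> * (norm u)\<^sup>2 \<le> inner (l2_lift (L_op a V) u) u" for u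
    proof (cases "u = 0")
      case False
      then have "\<kappa> \<le> inner (L u) u / (norm u)\<^sup>2"
        unfolding \<kappa>_def by (intro cInf_lower Q_normalised Q_bdd)
      then show ?thesis using False unfolding L_def by (simp add: le_divide_eq)
    qed simp
    show "\<exists>u. norm u = 1 \<and> inner (l2_lift (L_op a V) u) u < \<kappa> + e" if "e > 0" for e
    proof -
      have "Inf Q < \<kappa> + e" using that by (simp add: \<kappa>_def)
      then obtain q where "q \<in> Q" "q < \<kappa> + e" using cInf_lessD[OF Q_ne] by blast
      then show ?thesis unfolding Q_def L_def by blast
    qed
  qed
  moreover have "\<kappa> \<in> {a_min + V_min ..< \<mu>0}" using \<kappa>_ge \<kappa>_less V_le_a by (simp add: mu0)
  ultimately show ?thesis by blast
qed

end
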